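(* Let $(M,L)$ be a pseudo-Finsler manifold with conic domain $A\subset TM\setminus\mathbf{0}$, let $v\in A$, and let $\pi=\mathrm{span}\{v,u\}\subset T_pM$ be a plane through $v$, where $p$ is the base point of $v$, such that $\pi$ is $g_v$-nondegenerate. Let $\gamma_v$ be the geodesic of $(M,L)$ with velocity $v$ at $t=0$. Then the quantity $$K_v(u)=\frac{g_v(R^{\gamma_v}(v,u)u,v)}{L(v)g_v(u,u)-g_v(v,u)^2}$$ is the flag curvature of $\pi$ with flagpole $v$, where $R^{\gamma_v}(v,u)u:=R^V_{p}(V,U)U'$ for any $L$-admissible local extension $V$ of $\dot\gamma_v$ and any local extensions $U,U'$ of $u$ to vector fields.
   Context: Let $M$ be a smooth $n$-manifold. An open subset $A\subset TM\setminus\mathbf{0}$ is conic if $\lambda v\in A$ for all $v\in A$, $\lambda>0$. A (two-homogeneous, conic) pseudo-Finsler metric is a smooth function $L:A\to\mathbb{R}$ with $L(\lambda v)=\lambda^2L(v)$ for all $v\in A$, $\lambda>0$, such that for every $v\in A$ (with base point $p$) the fundamental tensor $g_v(u,w)=\frac12\frac{\partial^2}{\partial t\,\partial s}L(v+tu+sw)|_{t=s=0}$, $u,w\in T_pM$, is non-degenerate. $(M,L)$ is then called a pseudo-Finsler manifold. The Cartan tensor is $C_v(w_1,w_2,w_3)=\frac14\frac{\partial^3}{\partial s_3\partial s_2\partial s_1}L(v+\sum_{i=1}^3s_iw_i)|_{s_1=s_2=s_3=0}$. A vector field $V$ on an open set $\Omega\subset M$ is $L$-admissible if $V(x)\in A\cap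 T_xM$ for all $x\in\Omega$. For such $V$, $\nabla^V$ is the unique affine connection on $\Omega$ that is torsion-free and almost $g$-compatible, i.e. $\nabla^V_XY-\nabla^V_YX=[X,Y]$ and $X(g_V(Y,Z))=g_V(\nabla^V_XY,Z)+g_V(Y,\nabla^V_XZ)+2C_V(\nabla^V_XV,Y,Z)$ for all $X,Y,Z\in\mathfrak{X}(\Omega)$. Its curvature tensor is $R^V(X,Y)Z=\nabla^V_X\nabla^V_YZ-\nabla^V_Y\nabla^V_XZ-\nabla^V_{[X,Y]}Z$. The Einstein summation convention is used. In coordinates $x^1,\dots,x^n$ on an open set $\Omega$, with induced coordinates $x^1,\dots,x^n,y^1,\dots,y^n$ on $T\Omega$, the Christoffel symbols, defined by $\nabla^V_{\partial/\partial x^i}\frac{\partial}{\partial x^j}=\Gamma^k_{\ ij}(V)\frac{\partial}{\partial x^k}$, depend at each point only on the value of $V$ there, so they are functions $\Gamma^k_{\ ij}$ on $A\cap T\Omega$ (the Christoffel symbols of the Chern connection). A smooth curve $\gamma$ with $\dot\gamma(t)\in A$ for all $t$ is a geodesic if $D^{\dot\gamma}_\gamma\dot\gamma=0$, where $D^{\dot\gamma}_\gamma X=\left(\frac{dX^k}{dt}+X^i\dot\gamma^j\Gamma^k_{\ ij}(\dot\gamma)\right)\frac{\partial}{\partial x^k}$. An $L$-admissible local extension of $\dot\gamma_v$ is an $L$-admissible vector field $V$ near $p$ with $V(\gamma_v(t))=\dot\gamma_v(t)$ for $t$ near $0$; extensions of $u$ are vector fields near $p$ with value $u$ at $p$. Put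 $N^p_{\ k}(v)=v^i\Gamma^p_{\ ki}(v)$. The $hh$-curvature tensor of the Chern connection is $R_v(X,Y)Z=Z^jX^kY^l\,R^{\ i}_{j\ kl}(v)\frac{\partial}{\partial x^i}$ for $v\in A$, with $$R^{\ i}_{j\ kl}=\frac{\partial\Gamma^i_{\ jl}}{\partial x^k}-N^p_{\ k}\frac{\partial\Gamma^i_{\ jl}}{\partial y^p}-\frac{\partial\Gamma^i_{\ jk}}{\partial x^l}+N^p_{\ l}\frac{\partial\Gamma^i_{\ jk}}{\partial y^p}+\Gamma^i_{\ hk}\Gamma^h_{\ jl}-\Gamma^i_{\ hl}\Gamma^h_{\ jk}.$$ The flag curvature of $\pi=\mathrm{span}\{v,u\}$ with flagpole $v$ is $$\frac{g_v(R_v(u,v)v,u)}{L(v)g_v(u,u)-g_v(v,u)^2}.$$ *)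

theory Defs
  imports "HOL-Analysis.Analysis"
begin

section \<open>Smooth maps between Euclidean spaces\<close>

text \<open>Intended for open \<open>S\<close>: derivatives are two-sided, taken with respect to \<open>at x\<close>.\<close>

primrec Ck_on :: "nat \<Rightarrow> 'a::euclidean_space set \<Rightarrow> ('a \<Rightarrow> 'b::euclidean_space) \<Rightarrow> bool" where
  "Ck_on 0 S f \<longleftrightarrow> continuous_on S f"
| "Ck_on (Suc k) S f \<longleftrightarrow>
     (\<forall>x\<in>S. f differentiable (at x)) \<and> (\<forall>h. Ck_on k S (\<lambda>x. frechet_derivative f (at x) h))"

definition smooth_on :: "'a::euclidean_space set \<Rightarrow> ('a \<Rightarrow> 'b::euclidean_space) \<Rightarrow> bool" where
  "smooth_on S f \<longleftrightarrow> (\<forall>k. Ck_on k S f)"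


section \<open>Smooth manifolds\<close>

text \<open>A chart is a pair of its domain and its coordinate map. The values of the coordinate map
  outside the domain are irrelevant. The dimension of the manifold is \<open>CARD('n)\<close>.\<close>

type_synonym ('m, 'n) chart = "'m set \<times> ('m \<Rightarrow> real ^ 'n)"

abbreviation dom_of :: "('m, 'n::finite) chart \<Rightarrow> 'm set" where
  "dom_of c \<equiv> fst c"

abbreviation coords :: "('m, 'n::finite) chart \<Rightarrow> 'm \<Rightarrow> real ^ 'n" where
  "coords c \<equiv> snd c"

definition inv_coords :: "('m, 'n::finite) chart \<Rightarrow> real ^ 'n \<Rightarrow> 'm" where
  "inv_coords c = inv_into (dom_of c) (coords c)"

definition is_chart :: "('m::topological_space, 'n::finite) chart \<Rightarrow> bool" where
  "is_chart c \<longleftrightarrow> open (dom_of c) \<and> open (coords c ` dom_of c) \<and>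
     homeomorphism (dom_of c) (coords c ` dom_of c) (coords c) (inv_coords c)"

definition smooth_transition :: "('m, 'n::finite) chart \<Rightarrow> ('m, 'n) chart \<Rightarrow> bool" where
  "smooth_transition c c' \<longleftrightarrow>
     smooth_on (coords c ` (dom_of c \<inter> dom_of c')) (coords c' \<circ> inv_coords c)"

text \<open>The manifold is the whole type \<open>'m\<close>, its smooth structure is a maximal smooth atlas.\<close>

definition smooth_manifold ::
    "('m::{t2_space, second_countable_topology}, 'n::finite) chart set \<Rightarrow> bool" where
  "smooth_manifold \<A> \<longleftrightarrow>
     (\<forall>c\<in>\<A>. is_chart c) \<and>
     (\<Union>c\<in>\<A>. dom_of c) = UNIV \<and>
     (\<forall>c\<in>\<A>. \<forall>c'\<in>\<A>. smooth_transition c c') \<and>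
     (\<forall>c. is_chart c \<and> (\<forall>c'\<in>\<A>. smooth_transition c c' \<and> smooth_transition c' c) \<longrightarrow> c \<in> \<A>)"

definition charts_at :: "('m, 'n::finite) chart set \<Rightarrow> 'm \<Rightarrow> ('m, 'n) chart set" where
  "charts_at \<A> p = {c \<in> \<A>. p \<in> dom_of c}"

definition smooth_fun :: "('m, 'n::finite) chart set \<Rightarrow> 'm set \<Rightarrow> ('m \<Rightarrow> real) \<Rightarrow> bool" where
  "smooth_fun \<A> \<Omega> f \<longleftrightarrow> (\<forall>c\<in>\<A>. smooth_on (coords c ` (dom_of c \<inter> \<Omega>)) (f \<circ> inv_coords c))"


section \<open>Tangent vectors\<close>

text \<open>A tangent vector at \<open>p\<close> is a family of component vectors, one for each chart around
  \<open>p\<close>, transforming by the Jacobians of the coordinate changes. The type \<open>tvec\<close> consists of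
  all families indexed by charts; \<open>tangent_space\<close> singles out the tangent vectors at a
  given point (components in charts that are not around \<open>p\<close> are 0 by convention). It is a linear
  subspace of \<open>tvec\<close>. The base point is not part of a \<open>tvec\<close>, so elements of
  the tangent bundle are pairs.\<close>

typedef ('m, 'n) tvec = "UNIV :: (('m, 'n::finite) chart \<Rightarrow> real ^ 'n) set"
  morphisms comp Tvec ..

setup_lifting type_definition_tvec

instantiation tvec :: (type, finite) real_vector
begin

lift_definition zero_tvec :: "('a, 'b) tvec" is "\<lambda>c. 0" .
lift_definition plus_tvec :: "('a, 'b) tvec \<Rightarrow> ('a, 'b) tvec \<Rightarrow> ('a, 'b) tvec"
  is "\<lambda>v w c. v c + w c" .
lift_definition minus_tvec :: "('a, 'b) tvec \<Rightarrow> ('a, 'b) tvec \<Rightarrow> ('a, 'b) tvec"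
  is "\<lambda>v w c. v c - w c" .
lift_definition uminus_tvec :: "('a, 'b) tvec \<Rightarrow> ('a, 'b) tvec" is "\<lambda>v c. - v c" .
lift_definition scaleR_tvec :: "real \<Rightarrow> ('a, 'b) tvec \<Rightarrow> ('a, 'b) tvec"
  is "\<lambda>r v c. r *\<^sub>R v c" .

instance
  by standard (transfer; auto simp: fun_eq_iff algebra_simps)+

end

definition transition_deriv ::
    "('m, 'n::finite) chart \<Rightarrow> ('m, 'n) chart \<Rightarrow> 'm \<Rightarrow> real ^ 'n \<Rightarrow> real ^ 'n" where
  "transition_deriv c c' p = frechet_derivative (coords c' \<circ> inv_coords c) (at (coords c p))"

definition tangent_space :: "('m, 'n::finite) chart set \<Rightarrow> 'm \<Rightarrow> ('m, 'n) tvec set" where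
  "tangent_space \<A> p = {w.
     (\<forall>c\<in>charts_at \<A> p. \<forall>c'\<in>charts_at \<A> p. comp w c' = transition_deriv c c' p (comp w c)) \<and>
     (\<forall>c. c \<notin> charts_at \<A> p \<longrightarrow> comp w c = 0)}"

text \<open>The tangent vector at \<open>p\<close> whose component vector in the chart \<open>c\<close> is \<open>\<xi>\<close>.\<close>

definition tvec_of ::
    "('m, 'n::finite) chart set \<Rightarrow> ('m, 'n) chart \<Rightarrow> 'm \<Rightarrow> real ^ 'n \<Rightarrow> ('m, 'n) tvec" where
  "tvec_of \<A> c p \<xi> =
     Tvec (\<lambda>c'. if c' \<in> charts_at \<A> p then transition_deriv c c' p \<xi> else 0)"

definition tcoords ::
    "('m, 'n::finite) chart \<Rightarrow> 'm \<times> ('m, 'n) tvec \<Rightarrow> (real ^ 'n) \<times> (real ^ 'n)" where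
  "tcoords c = (\<lambda>(p, v). (coords c p, comp v c))"

definition inv_tcoords :: "('m, 'n::finite) chart set \<Rightarrow> ('m, 'n) chart \<Rightarrow>
    (real ^ 'n) \<times> (real ^ 'n) \<Rightarrow> 'm \<times> ('m, 'n) tvec" where
  "inv_tcoords \<A> c = (\<lambda>(x, y). (inv_coords c x, tvec_of \<A> c (inv_coords c x) y))"

definition tangent_bundle :: "('m, 'n::finite) chart set \<Rightarrow> ('m \<times> ('m, 'n) tvec) set" where
  "tangent_bundle \<A> = {(p, v). v \<in> tangent_space \<A> p}"

definition tcoords_image :: "('m, 'n::finite) chart \<Rightarrow> ('m \<times> ('m, 'n) tvec) set \<Rightarrow>
    ((real ^ 'n) \<times> (real ^ 'n)) set" where
  "tcoords_image c A = tcoords c ` {(p, v) \<in> A. p \<in> dom_of c}"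

definition open_in_tangent_bundle ::
    "('m, 'n::finite) chart set \<Rightarrow> ('m \<times> ('m, 'n) tvec) set \<Rightarrow> bool" where
  "open_in_tangent_bundle \<A> A \<longleftrightarrow>
     A \<subseteq> tangent_bundle \<A> \<and> (\<forall>c\<in>\<A>. open (tcoords_image c A))"

definition smooth_on_tangent_bundle :: "('m, 'n::finite) chart set \<Rightarrow>
    ('m \<times> ('m, 'n) tvec) set \<Rightarrow> ('m \<times> ('m, 'n) tvec \<Rightarrow> real) \<Rightarrow> bool" where
  "smooth_on_tangent_bundle \<A> A L \<longleftrightarrow>
     (\<forall>c\<in>\<A>. smooth_on (tcoords_image c A) (L \<circ> inv_tcoords \<A> c))"


section \<open>Vector fields\<close>

text \<open>Vector fields on \<open>\<Omega>\<close> are extended by 0 outside \<open>\<Omega>\<close>, so that distinct elements of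
  \<open>vector_fields \<A> \<Omega>\<close> are distinct vector fields on \<open>\<Omega>\<close>.\<close>

definition vector_fields ::
    "('m, 'n::finite) chart set \<Rightarrow> 'm set \<Rightarrow> ('m \<Rightarrow> ('m, 'n) tvec) set" where
  "vector_fields \<A> \<Omega> = {X.
     (\<forall>x\<in>\<Omega>. X x \<in> tangent_space \<A> x) \<and> (\<forall>x. x \<notin> \<Omega> \<longrightarrow> X x = 0) \<and>
     (\<forall>c\<in>\<A>. smooth_on (coords c ` (dom_of c \<inter> \<Omega>)) (\<lambda>\<xi>. comp (X (inv_coords c \<xi>)) c))}"

text \<open>The derivative \<open>X(f)\<close>. It does not depend on the chart used to compute it.\<close>

definition deriv_along ::
    "('m, 'n::finite) chart set \<Rightarrow> ('m \<Rightarrow> ('m, 'n) tvec) \<Rightarrow> ('m \<Rightarrow> real) \<Rightarrow> 'm \<Rightarrow> real" where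
  "deriv_along \<A> X f x = (let c = (SOME c. c \<in> charts_at \<A> x) in
     frechet_derivative (f \<circ> inv_coords c) (at (coords c x)) (comp (X x) c))"

text \<open>In every chart, \<open>[X, Y]\<^sup>k = X\<^sup>i \<partial>\<^sub>i Y\<^sup>k - Y\<^sup>i \<partial>\<^sub>i X\<^sup>k\<close>.\<close>

definition lie_bracket :: "('m, 'n::finite) chart set \<Rightarrow> 'm set \<Rightarrow>
    ('m \<Rightarrow> ('m, 'n) tvec) \<Rightarrow> ('m \<Rightarrow> ('m, 'n) tvec) \<Rightarrow> 'm \<Rightarrow> ('m, 'n) tvec" where
  "lie_bracket \<A> \<Omega> X Y x = Tvec (\<lambda>c. if x \<in> \<Omega> \<and> c \<in> charts_at \<A> x then
     frechet_derivative (\<lambda>\<xi>. comp (Y (inv_coords c \<xi>)) c) (at (coords c x)) (comp (X x) c) -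
     frechet_derivative (\<lambda>\<xi>. comp (X (inv_coords c \<xi>)) c) (at (coords c x)) (comp (Y x) c)
     else 0)"

definition coord_field :: "('m, 'n::finite) chart set \<Rightarrow> 'm set \<Rightarrow> ('m, 'n) chart \<Rightarrow>
    'n \<Rightarrow> 'm \<Rightarrow> ('m, 'n) tvec" where
  "coord_field \<A> \<Omega> c i x = (if x \<in> \<Omega> then tvec_of \<A> c x (axis i 1) else 0)"


section \<open>Affine connections and their curvature\<close>

type_synonym ('m, 'n) field_op =
  "('m \<Rightarrow> ('m, 'n) tvec) \<Rightarrow> ('m \<Rightarrow> ('m, 'n) tvec) \<Rightarrow> 'm \<Rightarrow> ('m, 'n) tvec"

definition affine_connection ::
    "('m, 'n::finite) chart set \<Rightarrow> 'm set \<Rightarrow> ('m, 'n) field_op \<Rightarrow> bool" where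
  "affine_connection \<A> \<Omega> D \<longleftrightarrow>
     (\<forall>X\<in>vector_fields \<A> \<Omega>. \<forall>Y\<in>vector_fields \<A> \<Omega>. D X Y \<in> vector_fields \<A> \<Omega>) \<and>
     (\<forall>X\<in>vector_fields \<A> \<Omega>. \<forall>X'\<in>vector_fields \<A> \<Omega>. \<forall>Y\<in>vector_fields \<A> \<Omega>.
        D (\<lambda>x. X x + X' x) Y = (\<lambda>x. D X Y x + D X' Y x)) \<and>
     (\<forall>X\<in>vector_fields \<A> \<Omega>. \<forall>Y\<in>vector_fields \<A> \<Omega>. \<forall>f. smooth_fun \<A> \<Omega> f \<longrightarrow>
        D (\<lambda>x. f x *\<^sub>R X x) Y = (\<lambda>x. f x *\<^sub>R D X Y x)) \<and>
     (\<forall>X\<in>vector_fields \<A> \<Omega>. \<forall>Y\<in>vector_fields \<A> \<Omega>. \<forall>Y'\<in>vector_fields \<A> \<Omega>.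
        D X (\<lambda>x. Y x + Y' x) = (\<lambda>x. D X Y x + D X Y' x)) \<and>
     (\<forall>X\<in>vector_fields \<A> \<Omega>. \<forall>Y\<in>vector_fields \<A> \<Omega>. \<forall>f. smooth_fun \<A> \<Omega> f \<longrightarrow>
        D X (\<lambda>x. f x *\<^sub>R Y x) = (\<lambda>x. f x *\<^sub>R D X Y x + deriv_along \<A> X f x *\<^sub>R Y x))"

definition curvature :: "('m, 'n::finite) chart set \<Rightarrow> 'm set \<Rightarrow> ('m, 'n) field_op \<Rightarrow>
    ('m \<Rightarrow> ('m, 'n) tvec) \<Rightarrow> ('m \<Rightarrow> ('m, 'n) tvec) \<Rightarrow> ('m \<Rightarrow> ('m, 'n) tvec) \<Rightarrow>
    'm \<Rightarrow> ('m, 'n) tvec" where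
  "curvature \<A> \<Omega> D X Y Z x =
     D X (D Y Z) x - D Y (D X Z) x - D (lie_bracket \<A> \<Omega> X Y) Z x"


section \<open>Pseudo-Finsler metrics\<close>

text \<open>\<open>fund_tensor L p v u w\<close> is \<open>g\<^sub>v(u, w)\<close>, and \<open>cartan_tensor L p v w1 w2 w3\<close> is
  \<open>C\<^sub>v(w1, w2, w3)\<close>, where \<open>p\<close> is the base point of \<open>v\<close>.\<close>

definition fund_tensor :: "('m \<times> ('m, 'n::finite) tvec \<Rightarrow> real) \<Rightarrow> 'm \<Rightarrow>
    ('m, 'n) tvec \<Rightarrow> ('m, 'n) tvec \<Rightarrow> ('m, 'n) tvec \<Rightarrow> real" where
  "fund_tensor L p v u w =
     1 / 2 * deriv (\<lambda>t. deriv (\<lambda>s. L (p, v + t *\<^sub>R u + s *\<^sub>R w)) 0) 0"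

definition cartan_tensor :: "('m \<times> ('m, 'n::finite) tvec \<Rightarrow> real) \<Rightarrow> 'm \<Rightarrow>
    ('m, 'n) tvec \<Rightarrow> ('m, 'n) tvec \<Rightarrow> ('m, 'n) tvec \<Rightarrow> ('m, 'n) tvec \<Rightarrow> real" where
  "cartan_tensor L p v w1 w2 w3 =
     1 / 4 * deriv (\<lambda>s3. deriv (\<lambda>s2. deriv (\<lambda>s1.
       L (p, v + s1 *\<^sub>R w1 + s2 *\<^sub>R w2 + s3 *\<^sub>R w3)) 0) 0) 0"

definition pseudo_finsler ::
    "('m::{t2_space, second_countable_topology}, 'n::finite) chart set \<Rightarrow>
     ('m \<times> ('m, 'n) tvec) set \<Rightarrow> ('m \<times> ('m, 'n) tvec \<Rightarrow> real) \<Rightarrow> bool" where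
  "pseudo_finsler \<A> A L \<longleftrightarrow>
     smooth_manifold \<A> \<and>
     open_in_tangent_bundle \<A> A \<and>
     (\<forall>(p, v)\<in>A. v \<noteq> 0) \<and>
     (\<forall>(p, v)\<in>A. \<forall>r>0. (p, r *\<^sub>R v) \<in> A) \<and>
     smooth_on_tangent_bundle \<A> A L \<and>
     (\<forall>(p, v)\<in>A. \<forall>r>0. L (p, r *\<^sub>R v) = r\<^sup>2 * L (p, v)) \<and>
     (\<forall>(p, v)\<in>A. \<forall>u\<in>tangent_space \<A> p.
        (\<forall>w\<in>tangent_space \<A> p. fund_tensor L p v u w = 0) \<longrightarrow> u = 0)"

definition admissible :: "('m, 'n::finite) chart set \<Rightarrow> ('m \<times> ('m, 'n) tvec) set \<Rightarrow>
    'm set \<Rightarrow> ('m \<Rightarrow> ('m, 'n) tvec) \<Rightarrow> bool" where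
  "admissible \<A> A \<Omega> V \<longleftrightarrow> V \<in> vector_fields \<A> \<Omega> \<and> (\<forall>x\<in>\<Omega>. (x, V x) \<in> A)"

text \<open>\<open>chern_connection \<A> L \<Omega> V D\<close> says that \<open>D\<close> is the connection \<open>\<nabla>\<^sup>V\<close> on \<open>\<Omega>\<close>. For
  admissible \<open>V\<close> this determines \<open>D\<close> on vector fields on \<open>\<Omega>\<close>.\<close>

definition chern_connection :: "('m, 'n::finite) chart set \<Rightarrow>
    ('m \<times> ('m, 'n) tvec \<Rightarrow> real) \<Rightarrow> 'm set \<Rightarrow> ('m \<Rightarrow> ('m, 'n) tvec) \<Rightarrow>
    ('m, 'n) field_op \<Rightarrow> bool" where
  "chern_connection \<A> L \<Omega> V D \<longleftrightarrow>
     affine_connection \<A> \<Omega> D \<and>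
     (\<forall>X\<in>vector_fields \<A> \<Omega>. \<forall>Y\<in>vector_fields \<A> \<Omega>. \<forall>x\<in>\<Omega>.
        D X Y x - D Y X x = lie_bracket \<A> \<Omega> X Y x) \<and>
     (\<forall>X\<in>vector_fields \<A> \<Omega>. \<forall>Y\<in>vector_fields \<A> \<Omega>. \<forall>Z\<in>vector_fields \<A> \<Omega>. \<forall>x\<in>\<Omega>.
        deriv_along \<A> X (\<lambda>x. fund_tensor L x (V x) (Y x) (Z x)) x =
          fund_tensor L x (V x) (D X Y x) (Z x) + fund_tensor L x (V x) (Y x) (D X Z x) +
          2 * cartan_tensor L x (V x) (D X V x) (Y x) (Z x))"


section \<open>Christoffel symbols, geodesics and flag curvature\<close>

text \<open>\<open>christoffel \<A> A L c p v k i j\<close> is \<open>\<Gamma>\<^sup>k\<^sub>i\<^sub>j(v)\<close> in the chart \<open>c\<close>: the common value at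
  \<open>p\<close> of the \<open>k\<close>-th component of \<open>\<nabla>\<^sup>V\<^bsub>\<partial>\<^sub>i\<^esub> \<partial>\<^sub>j\<close>, for all admissible \<open>V\<close> near \<open>p\<close>
  with \<open>V p = v\<close>.\<close>

definition christoffel :: "('m::topological_space, 'n::finite) chart set \<Rightarrow>
    ('m \<times> ('m, 'n) tvec) set \<Rightarrow> ('m \<times> ('m, 'n) tvec \<Rightarrow> real) \<Rightarrow> ('m, 'n) chart \<Rightarrow>
    'm \<Rightarrow> ('m, 'n) tvec \<Rightarrow> 'n \<Rightarrow> 'n \<Rightarrow> 'n \<Rightarrow> real" where
  "christoffel \<A> A L c p v k i j = (THE r. \<forall>\<Omega> V D.
     open \<Omega> \<and> p \<in> \<Omega> \<and> \<Omega> \<subseteq> dom_of c \<and> admissible \<A> A \<Omega> V \<and> V p = v \<and>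
     chern_connection \<A> L \<Omega> V D \<longrightarrow>
     comp (D (coord_field \<A> \<Omega> c i) (coord_field \<A> \<Omega> c j) p) c $ k = r)"

text \<open>The Christoffel symbols as functions of the induced coordinates \<open>(x, y)\<close>.\<close>

definition Gam :: "('m::topological_space, 'n::finite) chart set \<Rightarrow>
    ('m \<times> ('m, 'n) tvec) set \<Rightarrow> ('m \<times> ('m, 'n) tvec \<Rightarrow> real) \<Rightarrow> ('m, 'n) chart \<Rightarrow>
    real ^ 'n \<Rightarrow> real ^ 'n \<Rightarrow> 'n \<Rightarrow> 'n \<Rightarrow> 'n \<Rightarrow> real" where
  "Gam \<A> A L c x y k i j =
     christoffel \<A> A L c (inv_coords c x) (tvec_of \<A> c (inv_coords c x) y) k i j"

definition nonlin_coeff :: "('m::topological_space, 'n::finite) chart set \<Rightarrow>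
    ('m \<times> ('m, 'n) tvec) set \<Rightarrow> ('m \<times> ('m, 'n) tvec \<Rightarrow> real) \<Rightarrow> ('m, 'n) chart \<Rightarrow>
    real ^ 'n \<Rightarrow> real ^ 'n \<Rightarrow> 'n \<Rightarrow> 'n \<Rightarrow> real" where
  "nonlin_coeff \<A> A L c x y p k = (\<Sum>i\<in>UNIV. y $ i * Gam \<A> A L c x y p k i)"

definition partial :: "'n::finite \<Rightarrow> (real ^ 'n \<Rightarrow> real) \<Rightarrow> real ^ 'n \<Rightarrow> real" where
  "partial k f x = deriv (\<lambda>t. f (x + t *\<^sub>R axis k 1)) 0"

text \<open>The argument order in \<open>hh_coeff \<A> A L c x y i j k l\<close> is that of
  \<open>R\<^sub>j\<^sup>i\<^sub>k\<^sub>l\<close> with the upper index first.\<close>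

definition hh_coeff :: "('m::topological_space, 'n::finite) chart set \<Rightarrow>
    ('m \<times> ('m, 'n) tvec) set \<Rightarrow> ('m \<times> ('m, 'n) tvec \<Rightarrow> real) \<Rightarrow> ('m, 'n) chart \<Rightarrow>
    real ^ 'n \<Rightarrow> real ^ 'n \<Rightarrow> 'n \<Rightarrow> 'n \<Rightarrow> 'n \<Rightarrow> 'n \<Rightarrow> real" where
  "hh_coeff \<A> A L c x y i j k l =
     (let G = Gam \<A> A L c; N = nonlin_coeff \<A> A L c x y in
       partial k (\<lambda>x. G x y i j l) x - (\<Sum>p\<in>UNIV. N p k * partial p (\<lambda>y. G x y i j l) y)
       - partial l (\<lambda>x. G x y i j k) x + (\<Sum>p\<in>UNIV. N p l * partial p (\<lambda>y. G x y i j k) y)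
       + (\<Sum>h\<in>UNIV. G x y i h k * G x y h j l) - (\<Sum>h\<in>UNIV. G x y i h l * G x y h j k))"

text \<open>\<open>hh_curvature \<A> A L c p v X Y Z\<close> is \<open>R\<^sub>v(X, Y)Z\<close>, computed in the chart \<open>c\<close>
  around the base point \<open>p\<close> of \<open>v\<close>.\<close>

definition hh_curvature :: "('m::topological_space, 'n::finite) chart set \<Rightarrow>
    ('m \<times> ('m, 'n) tvec) set \<Rightarrow> ('m \<times> ('m, 'n) tvec \<Rightarrow> real) \<Rightarrow> ('m, 'n) chart \<Rightarrow>
    'm \<Rightarrow> ('m, 'n) tvec \<Rightarrow> ('m, 'n) tvec \<Rightarrow> ('m, 'n) tvec \<Rightarrow> ('m, 'n) tvec \<Rightarrow> ('m, 'n) tvec" where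
  "hh_curvature \<A> A L c p v X Y Z = tvec_of \<A> c p (\<chi> i. \<Sum>j\<in>UNIV. \<Sum>k\<in>UNIV. \<Sum>l\<in>UNIV.
     comp Z c $ j * comp X c $ k * comp Y c $ l *
     hh_coeff \<A> A L c (coords c p) (comp v c) i j k l)"

definition flag_curvature :: "('m::topological_space, 'n::finite) chart set \<Rightarrow>
    ('m \<times> ('m, 'n) tvec) set \<Rightarrow> ('m \<times> ('m, 'n) tvec \<Rightarrow> real) \<Rightarrow> ('m, 'n) chart \<Rightarrow>
    'm \<Rightarrow> ('m, 'n) tvec \<Rightarrow> ('m, 'n) tvec \<Rightarrow> real" where
  "flag_curvature \<A> A L c p v u =
     fund_tensor L p v (hh_curvature \<A> A L c p v u v v) u /
     (L (p, v) * fund_tensor L p v u u - (fund_tensor L p v v u)\<^sup>2)"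

definition smooth_curve :: "('m::topological_space, 'n::finite) chart set \<Rightarrow> real set \<Rightarrow>
    (real \<Rightarrow> 'm) \<Rightarrow> bool" where
  "smooth_curve \<A> I \<gamma> \<longleftrightarrow> continuous_on I \<gamma> \<and>
     (\<forall>c\<in>\<A>. smooth_on {t\<in>I. \<gamma> t \<in> dom_of c} (coords c \<circ> \<gamma>))"

definition velocity ::
    "('m, 'n::finite) chart set \<Rightarrow> (real \<Rightarrow> 'm) \<Rightarrow> real \<Rightarrow> ('m, 'n) tvec" where
  "velocity \<A> \<gamma> t = Tvec (\<lambda>c. if c \<in> charts_at \<A> (\<gamma> t)
     then vector_derivative (coords c \<circ> \<gamma>) (at t) else 0)"

text \<open>The components in the chart \<open>c\<close> of \<open>D\<^sub>\<gamma> X\<close> with reference vector \<open>\<gamma>'\<close>, for a vector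
  field \<open>X\<close> along \<open>\<gamma>\<close>.\<close>

definition cov_deriv_curve :: "('m::topological_space, 'n::finite) chart set \<Rightarrow>
    ('m \<times> ('m, 'n) tvec) set \<Rightarrow> ('m \<times> ('m, 'n) tvec \<Rightarrow> real) \<Rightarrow> ('m, 'n) chart \<Rightarrow>
    (real \<Rightarrow> 'm) \<Rightarrow> (real \<Rightarrow> ('m, 'n) tvec) \<Rightarrow> real \<Rightarrow> real ^ 'n" where
  "cov_deriv_curve \<A> A L c \<gamma> X t = (\<chi> k.
     deriv (\<lambda>s. comp (X s) c $ k) t +
     (\<Sum>i\<in>UNIV. \<Sum>j\<in>UNIV. comp (X t) c $ i * comp (velocity \<A> \<gamma> t) c $ j *
        christoffel \<A> A L c (\<gamma> t) (velocity \<A> \<gamma> t) k i j))"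

definition geodesic :: "('m::topological_space, 'n::finite) chart set \<Rightarrow>
    ('m \<times> ('m, 'n) tvec) set \<Rightarrow> ('m \<times> ('m, 'n) tvec \<Rightarrow> real) \<Rightarrow> real set \<Rightarrow>
    (real \<Rightarrow> 'm) \<Rightarrow> bool" where
  "geodesic \<A> A L I \<gamma> \<longleftrightarrow> smooth_curve \<A> I \<gamma> \<and>
     (\<forall>t\<in>I. (\<gamma> t, velocity \<A> \<gamma> t) \<in> A) \<and>
     (\<forall>t\<in>I. \<forall>c\<in>charts_at \<A> (\<gamma> t). cov_deriv_curve \<A> A L c \<gamma> (velocity \<A> \<gamma>) t = 0)"

end

theory Submission
  imports Defs
begin

text \<open>In a chart the Chern connection with reference field \<open>V\<close> is \<open>dY(X) + \<Gamma>(x, V)(X, Y)\<close>, so that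
  \<open>R\<^sup>V(X, Y)Z\<close> differs from the \<open>hh\<close>-curvature by vertical derivatives of \<open>\<Gamma>\<close> in the directions
  \<open>\<nabla>\<^sup>V\<^bsub>X\<^esub> V\<close> and \<open>\<nabla>\<^sup>V\<^bsub>Y\<^esub> V\<close>. For \<open>R\<^sup>V(V, U)V\<close> both corrections vanish at \<open>p\<close>: \<open>V\<close> extends a geodesic, so
  \<open>\<nabla>\<^sup>V\<^bsub>V\<^esub> V = 0\<close> there, and the vertical derivative of \<open>\<Gamma>\<close> contracted twice with \<open>y\<close> vanishes,
  because the vertical derivative of the spray \<open>\<Gamma>(y, y)\<close> is \<open>2\<Gamma>(\<cdot>, y)\<close>. Finally
  \<open>g\<^sub>V(R\<^sup>V(X, Y)V, Z) = - g\<^sub>V(V, R\<^sup>V(X, Y)Z)\<close>: the Cartan tensor terms in the commutator of two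
  covariant derivatives of \<open>g\<^sub>V\<close> cancel as soon as one argument is \<open>V\<close>.

  The connection on \<open>\<Omega>\<close> is identified with the coordinate formula pointwise: the difference tensor of
  two torsion-free almost metric connections is zero by algebra alone, provided that the vector fields
  on \<open>\<Omega>\<close> take all values at the given point, which bump functions ensure.\<close>

section \<open>Calculus of smooth maps\<close>

text \<open>In \<open>R\<^sup>V(V, U)U'\<close> itself the vertical correction contracts \<Gamma>
  with \<open>v\<close> only once, and \<open>U'\<close> is an arbitrary extension of
  \<open>u\<close>. Exchanging the last slot for \<open>V\<close> cures both: \<Gamma> is then
  contracted twice, and \<open>U'\<close> enters only through its value at \<open>p\<close>.
  Antisymmetry in the first two slots then cancels the sign and gives the order
  \<open>R(u, v)v\<close> of the definition.

  The equations for \<Gamma> are implicit, because almost compatibility contains the Cartan tensor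
  at the covariant derivative of \<open>V\<close>. They decouple since the Cartan tensor vanishes on
  the flagpole: two arguments \<open>y\<close> determine the spray, one argument \<open>y\<close>
  then determines the nonlinear connection, and Koszul's formula finally gives \<Gamma>. The
  uniqueness argument climbs the same ladder.

  The Christoffel symbols are a definite description over all local Chern connections, so that
  uniqueness and existence both enter. The given \<Omega> need not lie in one chart, where
  coordinate fields would serve as test fields; hence the comparison at a single point with cut-off
  fields.\<close>

lemma fd_eqI: "(f has_derivative f') (at x) \<Longrightarrow> frechet_derivative f (at x) = f'"
  using frechet_derivative_at by metis

lemma fd_works: "f differentiable (at x) \<Longrightarrow>
    (f has_derivative (\<lambda>h. frechet_derivative f (at x) h)) (at x)"
  by (simp add: frechet_derivative_works)

text \<open>\<open>frechet_derivative\<close> is a choice from the set of all derivatives, so that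
  germs with the same derivatives share its value, differentiable or not.\<close>

lemma fd_cong:
  assumes "open S" "x \<in> S" "\<And>y. y \<in> S \<Longrightarrow> f y = g y"
  shows "frechet_derivative f (at x) = frechet_derivative g (at x)"
proof -
  have "(f has_derivative f') (at x) \<longleftrightarrow> (g has_derivative f') (at x)" for f'
    using has_derivative_transform_within_open[of f f' x UNIV S g]
      has_derivative_transform_within_open[of g f' x UNIV S f] assms by auto
  then show ?thesis
    unfolding frechet_derivative_def by simp
qed

lemma differentiable_cong_open:
  assumes "open S" "x \<in> S" "\<And>y. y \<in> S \<Longrightarrow> f y = g y"
  shows "f differentiable (at x) \<longleftrightarrow> g differentiable (at x)"
  using has_derivative_transform_within_open[of f _ x UNIV S g]
      has_derivative_transform_within_open[of g _ x UNIV S f] assms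
  unfolding differentiable_def by auto

section \<open>Closure properties of the classes \<open>Ck_on\<close>\<close>

lemma Ck_on_cong:
  assumes "open S"
  shows "(\<And>y. y \<in> S \<Longrightarrow> f y = g y) \<Longrightarrow> Ck_on k S f \<longleftrightarrow> Ck_on k S g"
proof (induction k arbitrary: f g)
  case 0
  then show ?case by (simp cong: continuous_on_cong)
next
  case (Suc k)
  have "frechet_derivative f (at x) = frechet_derivative g (at x)" if "x \<in> S" for x
    using fd_cong[OF assms that] Suc.prems by blast
  then have "Ck_on k S (\<lambda>x. frechet_derivative f (at x) h)
      \<longleftrightarrow> Ck_on k S (\<lambda>x. frechet_derivative g (at x) h)" for h
    by (intro Suc.IH) simp
  then show ?case
    using differentiable_cong_open[OF assms _ Suc.prems] by auto
qed

lemma Ck_on_SucD: "Ck_on (Suc k) S f \<Longrightarrow> Ck_on k S f"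
proof (induction k arbitrary: f)
  case 0
  then show ?case
    by (auto intro!: continuous_at_imp_continuous_on differentiable_imp_continuous_within)
next
  case (Suc k)
  then show ?case by (metis Ck_on.simps(2))
qed

lemma Ck_on_subset: "Ck_on k S f \<Longrightarrow> T \<subseteq> S \<Longrightarrow> Ck_on k T f"
  by (induction k arbitrary: f) (auto intro: continuous_on_subset)

text \<open>Two-sided derivatives at each point make \<open>Ck_on\<close> a local property; this
  later glues smoothness that is established in different charts.\<close>

lemma Ck_on_local:
  "(\<And>x. x \<in> S \<Longrightarrow> \<exists>T. open T \<and> x \<in> T \<and> Ck_on k T f) \<Longrightarrow> Ck_on k S f"
proof (induction k arbitrary: f)
  case 0
  show ?case unfolding Ck_on.simps
  proof (rule continuous_at_imp_continuous_on, rule ballI)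
    fix x assume "x \<in> S"
    then obtain T where "open T" "x \<in> T" "continuous_on T f"
      using 0 by auto
    then show "isCont f x"
      by (simp add: continuous_on_eq_continuous_at)
  qed
next
  case (Suc k)
  have "Ck_on k S (\<lambda>x. frechet_derivative f (at x) h)" for h
    by (rule Suc.IH) (use Suc.prems in fastforce)
  then show ?case
    using Suc.prems by fastforce
qed

lemma Ck_on_const: "Ck_on k S (\<lambda>x. c)"
proof (induction k arbitrary: c)
  case (Suc k)
  then show ?case by (auto simp: frechet_derivative_const)
qed auto

lemma Ck_on_linear:
  assumes "bounded_linear f"
  shows "Ck_on k S f"
proof (cases k)
  case 0
  then show ?thesis
    using assms by (simp add: bounded_linear.continuous_on linear_continuous_on)
next
  case (Suc j)
  have "(f has_derivative f) (at x)" for x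
    using assms by (rule bounded_linear_imp_has_derivative)
  then have "frechet_derivative f (at x) = f" for x
    by (rule fd_eqI)
  then show ?thesis
    using Suc assms by (simp add: Ck_on_const bounded_linear_imp_differentiable)
qed

lemma Ck_on_add: "open S \<Longrightarrow> Ck_on k S f \<Longrightarrow> Ck_on k S g \<Longrightarrow> Ck_on k S (\<lambda>x. f x + g x)"
proof (induction k arbitrary: f g)
  case (Suc k)
  have "frechet_derivative (\<lambda>x. f x + g x) (at x) h
      = frechet_derivative f (at x) h + frechet_derivative g (at x) h" if "x \<in> S" for x h
    using that Suc.prems by (subst fd_eqI[OF has_derivative_add[OF fd_works fd_works]]) auto
  then have "Ck_on k S (\<lambda>x. frechet_derivative (\<lambda>x. f x + g x) (at x) h)
    \<longleftrightarrow> Ck_on k S (\<lambda>x. frechet_derivative f (at x) h + frechet_derivative g (at x) h)" for h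
    by (intro Ck_on_cong Suc.prems) auto
  then show ?case
    using Suc by auto
qed (auto intro: continuous_intros)

text \<open>One induction serves all products: by the Leibniz rule the derivative is a sum of two
  terms of the same bilinear shape.\<close>

lemma Ck_on_bilinear:
  assumes "bounded_bilinear B" "open S"
  shows "Ck_on k S f \<Longrightarrow> Ck_on k S g \<Longrightarrow> Ck_on k S (\<lambda>x. B (f x) (g x))"
proof (induction k arbitrary: f g)
  case 0
  then show ?case
    using bounded_bilinear.continuous_on[OF assms(1)] by auto
next
  case (Suc k)
  interpret bounded_bilinear B by fact
  have d: "((\<lambda>x. B (f x) (g x)) has_derivative (\<lambda>h. B (f x) (frechet_derivative g (at x) h)
        + B (frechet_derivative f (at x) h) (g x))) (at x)" if "x \<in> S" for x
    using that Suc.prems by (intro FDERIV fd_works) auto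
  have "Ck_on k S (\<lambda>x. frechet_derivative (\<lambda>x. B (f x) (g x)) (at x) h)
    \<longleftrightarrow> Ck_on k S (\<lambda>x. B (f x) (frechet_derivative g (at x) h)
        + B (frechet_derivative f (at x) h) (g x))" for h
    by (intro Ck_on_cong assms) (simp add: fd_eqI[OF d])
  moreover have "Ck_on k S f" "Ck_on k S g"
    using Suc.prems Ck_on_SucD by blast+
  moreover have "(\<lambda>x. B (f x) (g x)) differentiable (at x)" if "x \<in> S" for x
    using d[OF that] by (rule differentiableI)
  ultimately show ?case
    using Suc by (auto intro!: Ck_on_add assms(2))
qed

lemma Ck_on_sum:
  "open S \<Longrightarrow> (\<And>i. i \<in> I \<Longrightarrow> Ck_on k S (f i)) \<Longrightarrow> Ck_on k S (\<lambda>x. \<Sum>i\<in>I. f i x)"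
  by (induction I rule: infinite_finite_induct) (auto intro: Ck_on_const Ck_on_add)

text \<open>Reduces a linear map applied to a moving vector to finitely many fixed directions, the
  form in which \<open>Ck_on\<close> speaks of derivatives.\<close>

lemma linear_eq_sum_Basis:
  assumes "linear f"
  shows "f h = (\<Sum>b\<in>Basis. (h \<bullet> b) *\<^sub>R f b)"
  by (subst euclidean_representation[of h, symmetric])
     (simp only: linear_sum[OF assms] linear_cmul[OF assms])

lemma Ck_on_compose:
  assumes "open S" "open T" "\<And>x. x \<in> S \<Longrightarrow> f x \<in> T"
  shows "Ck_on k S f \<Longrightarrow> Ck_on k T g \<Longrightarrow> Ck_on k S (\<lambda>x. g (f x))"
proof (induction k arbitrary: g)
  case 0
  then show ?case
    using assms(3) by (auto intro: continuous_on_compose2)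
next
  case (Suc k)
  have d: "((\<lambda>x. g (f x)) has_derivative
      (\<lambda>h. frechet_derivative g (at (f x)) (frechet_derivative f (at x) h))) (at x)" if "x \<in> S" for x
    using that Suc.prems assms(3)
    by (intro has_derivative_compose[of f _ x UNIV g]) (auto intro!: fd_works)
  \<comment> \<open>In the chain rule the direction in which \<open>g\<close> is differentiated
    moves with the point; the basis expansion replaces it by fixed directions, to which the
    induction hypothesis applies.\<close>
  have e: "frechet_derivative g (at (f x)) (frechet_derivative f (at x) h)
     = (\<Sum>b\<in>Basis. (frechet_derivative f (at x) h \<bullet> b) *\<^sub>R frechet_derivative g (at (f x)) b)"
    if "x \<in> S" for x h
    by (rule linear_eq_sum_Basis) (use that Suc.prems assms(3) in \<open>auto intro: linear_frechet_derivative\<close>)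
  have "Ck_on k S (\<lambda>x. frechet_derivative (\<lambda>x. g (f x)) (at x) h)
    \<longleftrightarrow> Ck_on k S (\<lambda>x. \<Sum>b\<in>Basis. (frechet_derivative f (at x) h \<bullet> b) *\<^sub>R
          frechet_derivative g (at (f x)) b)" for h
    by (intro Ck_on_cong assms) (simp add: fd_eqI[OF d] e)
  moreover have "Ck_on k S (\<lambda>x. \<Sum>b\<in>Basis. (frechet_derivative f (at x) h \<bullet> b) *\<^sub>R
          frechet_derivative g (at (f x)) b)" for h
    using Suc.prems assms Ck_on_SucD[OF Suc.prems(1)]
    by (intro Ck_on_sum Ck_on_bilinear[OF bounded_bilinear_scaleR]
          Ck_on_bilinear[OF bounded_bilinear_inner] Ck_on_const Suc.IH) auto
  moreover have "(\<lambda>x. g (f x)) differentiable (at x)" if "x \<in> S" for x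
    using d[OF that] by (rule differentiableI)
  ultimately show ?case by simp
qed

text \<open>The derivative of \<open>inverse\<close> is a polynomial in \<open>inverse\<close>, so
  the induction closes on itself.\<close>

lemma Ck_on_inverse: "Ck_on k (- {0 :: real}) inverse"
proof (induction k)
  case (Suc k)
  have d: "(inverse has_derivative (\<lambda>h. - (inverse x * h * inverse x))) (at x)" if "x \<noteq> 0" for x :: real
    using that by (rule has_derivative_inverse')
  have "Ck_on k (- {0 :: real}) (\<lambda>x. frechet_derivative inverse (at x) h)
     \<longleftrightarrow> Ck_on k (- {0 :: real}) (\<lambda>x. (- h) * (inverse x * inverse x))" for h
    by (intro Ck_on_cong) (auto simp: fd_eqI[OF d])
  moreover have "Ck_on k (- {0 :: real}) (\<lambda>x. (- h) * (inverse x * inverse x))" for h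
    using Suc by (intro Ck_on_bilinear[OF bounded_bilinear_mult] Ck_on_const) auto
  moreover have "inverse differentiable (at x)" if "x \<noteq> 0" for x :: real
    using d[OF that] by (rule differentiableI)
  ultimately show ?case by simp
qed (auto intro: continuous_intros)

section \<open>Smooth maps\<close>

lemma smooth_on_cong:
  "open S \<Longrightarrow> (\<And>y. y \<in> S \<Longrightarrow> f y = g y) \<Longrightarrow> smooth_on S f \<longleftrightarrow> smooth_on S g"
  by (simp add: smooth_on_def Ck_on_cong[of S f g])

lemma smooth_on_subset: "smooth_on S f \<Longrightarrow> T \<subseteq> S \<Longrightarrow> smooth_on T f"
  by (auto simp: smooth_on_def intro: Ck_on_subset)

lemma smooth_on_local:
  "(\<And>x. x \<in> S \<Longrightarrow> \<exists>T. open T \<and> x \<in> T \<and> smooth_on T f) \<Longrightarrow> smooth_on S f"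
  unfolding smooth_on_def by (intro allI Ck_on_local) blast

lemma smooth_on_differentiable: "smooth_on S f \<Longrightarrow> x \<in> S \<Longrightarrow> f differentiable (at x)"
  unfolding smooth_on_def by (metis Ck_on.simps(2))

lemma smooth_on_has_derivative: "smooth_on S f \<Longrightarrow> x \<in> S \<Longrightarrow>
    (f has_derivative (\<lambda>h. frechet_derivative f (at x) h)) (at x)"
  by (simp add: smooth_on_differentiable fd_works)

lemma smooth_on_continuous_on: "smooth_on S f \<Longrightarrow> continuous_on S f"
  unfolding smooth_on_def by (metis Ck_on.simps(1))

lemma smooth_on_fd: "smooth_on S f \<Longrightarrow> smooth_on S (\<lambda>x. frechet_derivative f (at x) h)"
  unfolding smooth_on_def by (metis Ck_on.simps(2))

lemma smooth_on_const: "smooth_on S (\<lambda>x. c)"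
  by (simp add: smooth_on_def Ck_on_const)

lemma smooth_on_linear: "bounded_linear f \<Longrightarrow> smooth_on S f"
  by (simp add: smooth_on_def Ck_on_linear)

lemma smooth_on_ident: "smooth_on S (\<lambda>x. x)"
  by (intro smooth_on_linear bounded_linear_ident)

lemma smooth_on_add: "open S \<Longrightarrow> smooth_on S f \<Longrightarrow> smooth_on S g \<Longrightarrow> smooth_on S (\<lambda>x. f x + g x)"
  by (simp add: smooth_on_def Ck_on_add)

lemma smooth_on_bilinear: "bounded_bilinear B \<Longrightarrow> open S \<Longrightarrow> smooth_on S f \<Longrightarrow> smooth_on S g \<Longrightarrow>
    smooth_on S (\<lambda>x. B (f x) (g x))"
  by (simp add: smooth_on_def Ck_on_bilinear)

lemmas smooth_on_mult = smooth_on_bilinear[OF bounded_bilinear_mult]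
lemmas smooth_on_scaleR = smooth_on_bilinear[OF bounded_bilinear_scaleR]
lemmas smooth_on_inner = smooth_on_bilinear[OF bounded_bilinear_inner]

lemma smooth_on_minus: "open S \<Longrightarrow> smooth_on S f \<Longrightarrow> smooth_on S (\<lambda>x. - f x)"
  using smooth_on_scaleR[of S "\<lambda>x. -1" f] by (simp add: smooth_on_const)

lemma smooth_on_diff: "open S \<Longrightarrow> smooth_on S f \<Longrightarrow> smooth_on S g \<Longrightarrow> smooth_on S (\<lambda>x. f x - g x)"
  using smooth_on_add[of S f "\<lambda>x. - g x"] by (simp add: smooth_on_minus)

lemma smooth_on_sum:
  "open S \<Longrightarrow> (\<And>i. i \<in> I \<Longrightarrow> smooth_on S (f i)) \<Longrightarrow> smooth_on S (\<lambda>x. \<Sum>i\<in>I. f i x)"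
  by (simp add: smooth_on_def Ck_on_sum)

lemma smooth_on_prod:
  fixes f :: "'i \<Rightarrow> 'a::euclidean_space \<Rightarrow> real"
  shows "open S \<Longrightarrow> (\<And>i. i \<in> I \<Longrightarrow> smooth_on S (f i)) \<Longrightarrow> smooth_on S (\<lambda>x. \<Prod>i\<in>I. f i x)"
  by (induction I rule: infinite_finite_induct) (auto intro: smooth_on_const smooth_on_mult)

lemma smooth_on_compose:
  "open S \<Longrightarrow> open T \<Longrightarrow> (\<And>x. x \<in> S \<Longrightarrow> f x \<in> T) \<Longrightarrow> smooth_on S f \<Longrightarrow> smooth_on T g \<Longrightarrow>
    smooth_on S (\<lambda>x. g (f x))"
  unfolding smooth_on_def using Ck_on_compose by blast

lemma smooth_on_compose_linear:
  "bounded_linear g \<Longrightarrow> open S \<Longrightarrow> smooth_on S f \<Longrightarrow> smooth_on S (\<lambda>x. g (f x))"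
  by (rule smooth_on_compose[of S UNIV]) (auto intro: smooth_on_linear)

lemma smooth_on_inverse:
  fixes f :: "'a::euclidean_space \<Rightarrow> real"
  assumes "open S" "smooth_on S f" "\<And>x. x \<in> S \<Longrightarrow> f x \<noteq> 0"
  shows "smooth_on S (\<lambda>x. inverse (f x))"
  by (rule smooth_on_compose[of S "- {0}" f inverse])
     (use assms Ck_on_inverse in \<open>auto simp: smooth_on_def\<close>)

lemma smooth_on_divide:
  fixes f g :: "'a::euclidean_space \<Rightarrow> real"
  assumes "open S" "smooth_on S f" "smooth_on S g" "\<And>x. x \<in> S \<Longrightarrow> g x \<noteq> 0"
  shows "smooth_on S (\<lambda>x. f x / g x)"
  unfolding divide_inverse by (intro smooth_on_mult smooth_on_inverse assms)

lemma smooth_on_Pair: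
  assumes "open S" "smooth_on S f" "smooth_on S g"
  shows "smooth_on S (\<lambda>x. (f x, g x))"
proof -
  have "smooth_on S (\<lambda>x. (f x, 0) + (0, g x))"
    by (intro smooth_on_add assms smooth_on_compose_linear[where g = "\<lambda>y. (y, 0)"]
         smooth_on_compose_linear[where g = "\<lambda>y. (0, y)"])
       (auto intro: bounded_linear_Pair bounded_linear_ident bounded_linear_zero)
  then show ?thesis by simp
qed

lemma smooth_on_vec_nth: "open S \<Longrightarrow> smooth_on S f \<Longrightarrow> smooth_on S (\<lambda>x. f x $ i)"
  by (rule smooth_on_compose_linear[OF bounded_linear_vec_nth])

lemma vec_eq_sum_axis: "(x :: real ^ 'n) = (\<Sum>i\<in>UNIV. (x $ i) *\<^sub>R axis i 1)"
  by (simp add: vec_eq_iff axis_def if_distrib cong: if_cong)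

lemma smooth_on_vec:
  fixes f :: "'a::euclidean_space \<Rightarrow> real ^ 'n::finite"
  assumes "open S" "\<And>i. smooth_on S (\<lambda>x. f x $ i)"
  shows "smooth_on S f"
proof -
  have "smooth_on S (\<lambda>x. \<Sum>i\<in>UNIV. (f x $ i) *\<^sub>R axis i 1)"
    by (intro smooth_on_sum smooth_on_scaleR smooth_on_const assms)
  then show ?thesis
    using vec_eq_sum_axis by (metis (no_types, lifting) ext)
qed

lemma smooth_on_det:
  fixes M :: "'a::euclidean_space \<Rightarrow> real ^ 'n ^ 'n"
  assumes "open S" "\<And>i j. smooth_on S (\<lambda>x. M x $ i $ j)"
  shows "smooth_on S (\<lambda>x. det (M x))"
  unfolding det_def
  by (intro smooth_on_sum smooth_on_mult smooth_on_prod smooth_on_const assms)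

section \<open>Families of linear maps depending on a base point\<close>

lemma linear_fd: "smooth_on S f \<Longrightarrow> x \<in> S \<Longrightarrow> linear (frechet_derivative f (at x))"
  by (simp add: linear_frechet_derivative smooth_on_differentiable)

lemma smooth_on_linear_family:
  fixes F :: "'a::euclidean_space \<Rightarrow> 'b::euclidean_space \<Rightarrow> 'c::euclidean_space"
  assumes "open S" "\<And>x. x \<in> S \<Longrightarrow> linear (F x)" "\<And>b. smooth_on S (\<lambda>x. F x b)" "smooth_on S A"
  shows "smooth_on S (\<lambda>x. F x (A x))"
proof -
  have "smooth_on S (\<lambda>x. \<Sum>b\<in>Basis. (A x \<bullet> b) *\<^sub>R F x b)"
    by (intro smooth_on_sum smooth_on_scaleR smooth_on_inner smooth_on_const assms)
  then show ?thesis
    by (subst smooth_on_cong[OF assms(1) linear_eq_sum_Basis[OF assms(2)]])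
qed

text \<open>A product rule for evaluation: differentiate once with the vector frozen and once with
  the family frozen. Applied one argument at a time, it differentiates the metric, \<open>N\<close>
  and \<Gamma> on moving vectors.\<close>

lemma has_derivative_linear_family:
  fixes F :: "'a::euclidean_space \<Rightarrow> 'b::euclidean_space \<Rightarrow> 'c::euclidean_space"
  assumes "open S" "x \<in> S" and lin: "\<And>y. y \<in> S \<Longrightarrow> linear (F y)"
    and diff: "\<And>b. (\<lambda>y. F y b) differentiable (at x)" and A: "(A has_derivative A') (at x)"
  shows "((\<lambda>y. F y (A y)) has_derivative
    (\<lambda>k. frechet_derivative (\<lambda>y. F y (A x)) (at x) k + F x (A' k))) (at x)"
proof -
  note F = fd_works[OF diff]
  have 0: "((\<lambda>y. \<Sum>b\<in>Basis. (a \<bullet> b) *\<^sub>R F y b) has_derivative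
     (\<lambda>k. \<Sum>b\<in>Basis. (a \<bullet> b) *\<^sub>R frechet_derivative (\<lambda>y. F y b) (at x) k)) (at x)" for a
    by (intro has_derivative_sum) (auto intro!: derivative_eq_intros F)
  have 1: "frechet_derivative (\<lambda>y. F y a) (at x) k
      = (\<Sum>b\<in>Basis. (a \<bullet> b) *\<^sub>R frechet_derivative (\<lambda>y. F y b) (at x) k)" for a k
    using fd_cong[where f = "\<lambda>y. F y a" and g = "\<lambda>y. \<Sum>b\<in>Basis. (a \<bullet> b) *\<^sub>R F y b",
      OF assms(1,2) linear_eq_sum_Basis[OF lin]] fd_eqI[OF 0[of a]] by simp
  have "((\<lambda>y. \<Sum>b\<in>Basis. (A y \<bullet> b) *\<^sub>R F y b) has_derivative
     (\<lambda>k. \<Sum>b\<in>Basis. (A x \<bullet> b) *\<^sub>R frechet_derivative (\<lambda>y. F y b) (at x) k + (A' k \<bullet> b) *\<^sub>R F x b)) (at x)"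
    by (intro has_derivative_sum) (auto intro!: derivative_eq_intros F A)
  also have "(\<lambda>k. \<Sum>b\<in>Basis. (A x \<bullet> b) *\<^sub>R frechet_derivative (\<lambda>y. F y b) (at x) k + (A' k \<bullet> b) *\<^sub>R F x b)
    = (\<lambda>k. frechet_derivative (\<lambda>y. F y (A x)) (at x) k + F x (A' k))"
    by (simp add: sum.distrib 1[of "A x"] linear_eq_sum_Basis[OF lin[OF assms(2)], of "A' _"])
  finally show ?thesis
    by (rule has_derivative_transform_within_open[OF _ assms(1,2)])
       (auto intro!: linear_eq_sum_Basis[OF lin, symmetric])
qed

lemma smooth_on_fd_field:
  assumes "open S" "smooth_on S f" "smooth_on S A"
  shows "smooth_on S (\<lambda>x. frechet_derivative f (at x) (A x))"
  by (rule smooth_on_linear_family[where F = "\<lambda>x. frechet_derivative f (at x)"])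
     (use assms in \<open>auto intro: linear_fd smooth_on_fd\<close>)

lemma has_derivative_fd_field:
  assumes "open S" "smooth_on S f" "x \<in> S" "(A has_derivative A') (at x)"
  shows "((\<lambda>x. frechet_derivative f (at x) (A x)) has_derivative
    (\<lambda>k. frechet_derivative (\<lambda>y. frechet_derivative f (at y) (A x)) (at x) k +
      frechet_derivative f (at x) (A' k))) (at x)"
  by (rule has_derivative_linear_family[where F = "\<lambda>x. frechet_derivative f (at x)", OF assms(1,3)])
     (use assms in \<open>auto intro: linear_fd smooth_on_fd smooth_on_differentiable\<close>)

section \<open>Symmetry of second derivatives\<close>

lemma has_real_derivative_line:
  fixes f :: "'a::euclidean_space \<Rightarrow> real"
  assumes "f differentiable (at (z + t *\<^sub>R h))"
  shows "((\<lambda>t. f (z + t *\<^sub>R h)) has_real_derivative frechet_derivative f (at (z + t *\<^sub>R h)) h) (at t)"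
proof -
  have l: "((\<lambda>t. z + t *\<^sub>R h) has_derivative (\<lambda>s. s *\<^sub>R h)) (at t)"
    by (auto intro!: derivative_eq_intros)
  have "((\<lambda>t. f (z + t *\<^sub>R h)) has_derivative
      (\<lambda>s. frechet_derivative f (at (z + t *\<^sub>R h)) (s *\<^sub>R h))) (at t)"
    using has_derivative_compose[OF l fd_works[OF assms]] .
  moreover have "frechet_derivative f (at (z + t *\<^sub>R h)) (s *\<^sub>R h)
      = frechet_derivative f (at (z + t *\<^sub>R h)) h * s" for s
    using linear_frechet_derivative[OF assms] by (simp add: linear_cmul)
  ultimately show ?thesis
    by (simp add: has_field_derivative_def)
qed

lemma deriv_line:
  fixes f :: "'a::euclidean_space \<Rightarrow> real"
  assumes "f differentiable (at z)"
  shows "deriv (\<lambda>t. f (z + t *\<^sub>R h)) 0 = frechet_derivative f (at z) h"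
  using has_real_derivative_line[of f z 0 h] assms by (simp add: DERIV_imp_deriv)

text \<open>The second difference over a parallelogram is symmetric in \<open>h\<close> and
  \<open>k\<close>. The mean value theorem in direction \<open>h\<close>, for the difference of two
  parallel segments, and then in direction \<open>k\<close> turns it into a mixed derivative at an
  inner point.\<close>

lemma second_difference_mvt:
  fixes f :: "'a::euclidean_space \<Rightarrow> real"
  assumes "smooth_on S f" "t > 0" "\<And>r s. 0 \<le> r \<Longrightarrow> r \<le> t \<Longrightarrow> 0 \<le> s \<Longrightarrow> s \<le> t \<Longrightarrow> z + r *\<^sub>R h + s *\<^sub>R k \<in> S"
  shows "\<exists>r s. 0 < r \<and> r < t \<and> 0 < s \<and> s < t \<and>
    f (z + t *\<^sub>R h + t *\<^sub>R k) - f (z + t *\<^sub>R h) - f (z + t *\<^sub>R k) + f z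
     = t * t * frechet_derivative (\<lambda>w. frechet_derivative f (at w) h) (at (z + r *\<^sub>R h + s *\<^sub>R k)) k"
proof -
  let ?D = "\<lambda>w. frechet_derivative f (at w) h"
  let ?P = "\<lambda>r. f ((z + t *\<^sub>R k) + r *\<^sub>R h) - f (z + r *\<^sub>R h)"
  have S1: "(z + t *\<^sub>R k) + r *\<^sub>R h \<in> S" "z + r *\<^sub>R h \<in> S" if "0 \<le> r" "r \<le> t" for r
    using assms(3)[of r t] assms(3)[of r 0] that assms(2) by (auto simp: algebra_simps)
  have "\<exists>r>0. r < t \<and> ?P t - ?P 0 = (t - 0) * (?D ((z + t *\<^sub>R k) + r *\<^sub>R h) - ?D (z + r *\<^sub>R h))"
    by (rule MVT2) (use assms(2) S1 in \<open>auto intro!: DERIV_diff has_real_derivative_line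
      smooth_on_differentiable[OF assms(1)]\<close>)
  then obtain r where r: "0 < r" "r < t"
    "?P t - ?P 0 = t * (?D ((z + t *\<^sub>R k) + r *\<^sub>R h) - ?D (z + r *\<^sub>R h))" by auto
  have "\<exists>s>0. s < t \<and> ?D ((z + r *\<^sub>R h) + t *\<^sub>R k) - ?D ((z + r *\<^sub>R h) + 0 *\<^sub>R k)
     = (t - 0) * frechet_derivative ?D (at ((z + r *\<^sub>R h) + s *\<^sub>R k)) k"
    by (rule MVT2) (use assms(2,3) r in \<open>auto intro!: has_real_derivative_line
      smooth_on_differentiable[OF smooth_on_fd[OF assms(1)]]\<close>)
  then obtain s where s: "0 < s" "s < t" "?D ((z + r *\<^sub>R h) + t *\<^sub>R k) - ?D (z + r *\<^sub>R h)
     = t * frechet_derivative ?D (at ((z + r *\<^sub>R h) + s *\<^sub>R k)) k" by auto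
  have "f (z + t *\<^sub>R h + t *\<^sub>R k) - f (z + t *\<^sub>R h) - f (z + t *\<^sub>R k) + f z = ?P t - ?P 0"
    by (simp add: algebra_simps)
  also have "\<dots> = t * (?D ((z + r *\<^sub>R h) + t *\<^sub>R k) - ?D (z + r *\<^sub>R h))"
    using r(3) by (simp add: add.commute add.left_commute)
  finally show ?thesis
    using s r by auto
qed

lemma fd_fd_commute_real:
  fixes f :: "'a::euclidean_space \<Rightarrow> real"
  assumes "open S" "smooth_on S f" "z \<in> S"
  shows "frechet_derivative (\<lambda>w. frechet_derivative f (at w) h) (at z) k
       = frechet_derivative (\<lambda>w. frechet_derivative f (at w) k) (at z) h"
proof (rule ccontr)
  let ?F = "\<lambda>w. frechet_derivative (\<lambda>w. frechet_derivative f (at w) h) (at w) k"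
  let ?G = "\<lambda>w. frechet_derivative (\<lambda>w. frechet_derivative f (at w) k) (at w) h"
  assume "?F z \<noteq> ?G z"
  \<comment> \<open>Half the gap: two errors below \<open>e\<close> cannot bridge it.\<close>
  define e where "e = \<bar>?F z - ?G z\<bar> / 2"
  have e: "e > 0" using \<open>?F z \<noteq> ?G z\<close> by (simp add: e_def)
  have "continuous_on S ?F" "continuous_on S ?G"
    by (intro smooth_on_fd smooth_on_continuous_on assms)+
  then have "isCont ?F z" "isCont ?G z"
    using assms by (simp_all add: continuous_on_eq_continuous_at)
  then obtain d1 d2 where d: "d1 > 0" "\<And>w. dist w z < d1 \<Longrightarrow> dist (?F w) (?F z) < e"
     "d2 > 0" "\<And>w. dist w z < d2 \<Longrightarrow> dist (?G w) (?G z) < e"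
    using e unfolding continuous_at_eps_delta by metis
  obtain d3 where d3: "d3 > 0" "ball z d3 \<subseteq> S"
    using assms open_contains_ball by blast
  define m where "m = min d1 (min d2 d3)"
  have m: "m > 0" using d d3 by (simp add: m_def)
  \<comment> \<open>Small enough for the whole parallelogram to lie in the ball of radius
    \<open>m\<close>; the summand 1 keeps the denominator positive when \<open>h\<close> and
    \<open>k\<close> vanish.\<close>
  define t where "t = m / (2 * (norm h + norm k + 1))"
  have t: "t > 0" using m by (simp add: t_def add_nonneg_pos)
  have near: "dist (z + r *\<^sub>R h + s *\<^sub>R k) z < m" if "0 \<le> r" "r \<le> t" "0 \<le> s" "s \<le> t" for r s
  proof -
    have "norm (r *\<^sub>R h + s *\<^sub>R k) \<le> r * norm h + s * norm k"
      using norm_triangle_ineq[of "r *\<^sub>R h" "s *\<^sub>R k"] that by simp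
    also have "\<dots> \<le> t * norm h + t * norm k"
      using that by (intro add_mono mult_right_mono) auto
    also have "\<dots> \<le> t * (norm h + norm k + 1)"
      using t by (simp add: algebra_simps)
    also have "\<dots> = m / 2"
      unfolding t_def using norm_ge_zero[of h] norm_ge_zero[of k]
      by (simp add: divide_simps; linarith)
    also have "\<dots> < m" using m by simp
    finally show ?thesis by (simp add: dist_norm algebra_simps)
  qed
  have S: "z + r *\<^sub>R h + s *\<^sub>R k \<in> S" if "0 \<le> r" "r \<le> t" "0 \<le> s" "s \<le> t" for r s
    using near[OF that] d3 by (auto simp: m_def dist_commute)
  have S': "z + r *\<^sub>R k + s *\<^sub>R h \<in> S" if "0 \<le> r" "r \<le> t" "0 \<le> s" "s \<le> t" for r s
    using S[of s r] that by (simp add: algebra_simps)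
  obtain r s where rs: "0 < r" "r < t" "0 < s" "s < t"
    "f (z + t *\<^sub>R h + t *\<^sub>R k) - f (z + t *\<^sub>R h) - f (z + t *\<^sub>R k) + f z
      = t * t * ?F (z + r *\<^sub>R h + s *\<^sub>R k)"
    using second_difference_mvt[OF assms(2) t S] by blast
  obtain r' s' where rs': "0 < r'" "r' < t" "0 < s'" "s' < t"
    "f (z + t *\<^sub>R k + t *\<^sub>R h) - f (z + t *\<^sub>R k) - f (z + t *\<^sub>R h) + f z
      = t * t * ?G (z + r' *\<^sub>R k + s' *\<^sub>R h)"
    using second_difference_mvt[OF assms(2) t S'] by blast
  have "z + t *\<^sub>R k + t *\<^sub>R h = z + t *\<^sub>R h + t *\<^sub>R k"
    by simp
  then have "t * t * ?F (z + r *\<^sub>R h + s *\<^sub>R k) = t * t * ?G (z + r' *\<^sub>R k + s' *\<^sub>R h)"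
    using rs(5) rs'(5) by (simp only:)
  then have "?F (z + r *\<^sub>R h + s *\<^sub>R k) = ?G (z + r' *\<^sub>R k + s' *\<^sub>R h)"
    using t by simp
  moreover have "dist (?F (z + r *\<^sub>R h + s *\<^sub>R k)) (?F z) < e"
    using d(2) near[of r s] rs by (simp add: m_def)
  moreover have "z + r' *\<^sub>R k + s' *\<^sub>R h = z + s' *\<^sub>R h + r' *\<^sub>R k"
    by simp
  moreover have "dist (?G (z + s' *\<^sub>R h + r' *\<^sub>R k)) (?G z) < e"
    using d(4) near[of s' r'] rs' by (simp add: m_def)
  ultimately have "\<bar>?F z - ?G z\<bar> < 2 * e"
    by (simp only:) (simp add: dist_real_def)
  then show False by (simp add: e_def)
qed

lemma fd_inner:
  assumes "f differentiable (at x)"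
  shows "frechet_derivative f (at x) h \<bullet> b = frechet_derivative (\<lambda>x. f x \<bullet> b) (at x) h"
proof -
  have "((\<lambda>x. f x \<bullet> b) has_derivative (\<lambda>h. frechet_derivative f (at x) h \<bullet> b)) (at x)"
    by (intro has_derivative_inner_left fd_works assms)
  then show ?thesis by (simp add: fd_eqI)
qed

lemma fd_fd_commute:
  assumes "open S" "smooth_on S f" "z \<in> S"
  shows "frechet_derivative (\<lambda>w. frechet_derivative f (at w) h) (at z) k
       = frechet_derivative (\<lambda>w. frechet_derivative f (at w) k) (at z) h"
proof (rule euclidean_eqI)
  fix b :: 'b assume "b \<in> Basis"
  have *: "frechet_derivative (\<lambda>w. frechet_derivative f (at w) h) (at z) k \<bullet> b
    = frechet_derivative (\<lambda>w. frechet_derivative (\<lambda>x. f x \<bullet> b) (at w) h) (at z) k" for h k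
  proof -
    have "frechet_derivative (\<lambda>w. frechet_derivative f (at w) h) (at z) k \<bullet> b
      = frechet_derivative (\<lambda>w. frechet_derivative f (at w) h \<bullet> b) (at z) k"
      by (intro fd_inner smooth_on_differentiable[OF smooth_on_fd[OF assms(2)] assms(3)])
    also have "\<dots> = frechet_derivative (\<lambda>w. frechet_derivative (\<lambda>x. f x \<bullet> b) (at w) h) (at z) k"
      by (rule arg_cong[of _ _ "\<lambda>f. f k"], rule fd_cong[OF assms(1,3)])
         (auto intro!: fd_inner smooth_on_differentiable[OF assms(2)])
    finally show ?thesis .
  qed
  show "frechet_derivative (\<lambda>w. frechet_derivative f (at w) h) (at z) k \<bullet> b
    = frechet_derivative (\<lambda>w. frechet_derivative f (at w) k) (at z) h \<bullet> b"
    unfolding * by (rule fd_fd_commute_real[OF assms(1) _ assms(3)])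
      (intro smooth_on_inner smooth_on_const assms)
qed

text \<open>Differentiation in the base point with the argument frozen keeps linearity in that
  argument; this makes the base derivative of the metric and the derivatives of \<Gamma> multilinear
  in their remaining slots.\<close>

lemma linear_fd_family:
  assumes "open S" "x \<in> S" "\<And>y. y \<in> S \<Longrightarrow> linear (F y)"
    "\<And>b. (\<lambda>y. F y b) differentiable (at x)"
  shows "linear (\<lambda>b. frechet_derivative (\<lambda>y. F y b) (at x) k)"
proof
  fix a b r
  have "((\<lambda>y. F y a + F y b) has_derivative (\<lambda>k. frechet_derivative (\<lambda>y. F y a) (at x) k
     + frechet_derivative (\<lambda>y. F y b) (at x) k)) (at x)"
    by (intro has_derivative_add fd_works assms)
  moreover have "frechet_derivative (\<lambda>y. F y (a + b)) (at x) = frechet_derivative (\<lambda>y. F y a + F y b) (at x)"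
    by (rule fd_cong[OF assms(1,2)]) (simp add: assms(3) linear_add)
  ultimately show "frechet_derivative (\<lambda>y. F y (a + b)) (at x) k =
      frechet_derivative (\<lambda>y. F y a) (at x) k + frechet_derivative (\<lambda>y. F y b) (at x) k"
    by (simp add: fd_eqI)
  have "((\<lambda>y. r *\<^sub>R F y a) has_derivative (\<lambda>k. r *\<^sub>R frechet_derivative (\<lambda>y. F y a) (at x) k)) (at x)"
    by (intro has_derivative_scaleR_right fd_works assms)
  moreover have "frechet_derivative (\<lambda>y. F y (r *\<^sub>R a)) (at x) = frechet_derivative (\<lambda>y. r *\<^sub>R F y a) (at x)"
    by (rule fd_cong[OF assms(1,2)]) (simp add: assms(3) linear_scale)
  ultimately show "frechet_derivative (\<lambda>y. F y (r *\<^sub>R a)) (at x) k =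
      r *\<^sub>R frechet_derivative (\<lambda>y. F y a) (at x) k"
    by (simp add: fd_eqI)
qed

section \<open>Linear maps on basis vectors; iterated derivatives along lines\<close>

lemma linear_eq_axis:
  assumes "linear f" "linear h" "\<And>i. f (axis i 1) = h (axis i (1 :: real))"
  shows "f a = (h (a :: real ^ 'k::finite) :: 'c::real_vector)"
  by (subst (1 2) vec_eq_sum_axis[of a])
     (simp only: linear_sum[OF assms(1)] linear_sum[OF assms(2)] linear_cmul[OF assms(1)]
        linear_cmul[OF assms(2)] assms(3))

lemma linearI_real:
  fixes f :: "'k::real_vector \<Rightarrow> real"
  assumes "\<And>a b. f (a + b) = f a + f b" "\<And>r a. f (r *\<^sub>R a) = r * f a"
  shows "linear f"
  using assms by (intro linearI) auto

lemma linear_inl: "linear (\<lambda>b. (b, 0))" and linear_inr: "linear (\<lambda>b. (0, b))"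
  by (auto intro!: linearI)

lemma linear_mult_left: "linear f \<Longrightarrow> linear (\<lambda>x. c * f x :: real)"
  by (simp add: linear_iff algebra_simps)

text \<open>The inner derivative is known to be a Frechet derivative only at points of
  \<open>S\<close>, hence only for \<open>t\<close> near 0; the outer \<open>deriv\<close> depends
  on no more than this germ.\<close>

lemma deriv_deriv:
  fixes f :: "'a::euclidean_space \<Rightarrow> real"
  assumes "open S" "smooth_on S f" "z \<in> S"
  shows "deriv (\<lambda>t. deriv (\<lambda>s. f (z + t *\<^sub>R h + s *\<^sub>R k)) 0) 0
    = frechet_derivative (\<lambda>w. frechet_derivative f (at w) k) (at z) h"
proof -
  have "((\<lambda>t. z + t *\<^sub>R h) \<longlongrightarrow> z + 0 *\<^sub>R h) (nhds 0)"
    by (intro tendsto_intros) (auto simp: filterlim_ident)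
  then have "\<forall>\<^sub>F t in nhds 0. z + t *\<^sub>R h \<in> S"
    using assms topological_tendstoD by fastforce
  then have "\<forall>\<^sub>F t in nhds 0. deriv (\<lambda>s. f (z + t *\<^sub>R h + s *\<^sub>R k)) 0 = frechet_derivative f (at (z + t *\<^sub>R h)) k"
    by eventually_elim (intro deriv_line smooth_on_differentiable[OF assms(2)])
  from deriv_cong_ev[OF this refl] show ?thesis
    using deriv_line[OF smooth_on_differentiable[OF smooth_on_fd[OF assms(2)] assms(3)]] by simp
qed

lemma deriv_deriv_deriv:
  fixes f :: "'a::euclidean_space \<Rightarrow> real"
  assumes "open S" "smooth_on S f" "z \<in> S"
  shows "deriv (\<lambda>r. deriv (\<lambda>t. deriv (\<lambda>s. f (z + s *\<^sub>R k + t *\<^sub>R h + r *\<^sub>R j)) 0) 0) 0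
    = frechet_derivative (\<lambda>w. frechet_derivative (\<lambda>w. frechet_derivative f (at w) k) (at w) h) (at z) j"
proof -
  have "((\<lambda>t. z + t *\<^sub>R j) \<longlongrightarrow> z + 0 *\<^sub>R j) (nhds 0)"
    by (intro tendsto_intros) (auto simp: filterlim_ident)
  then have "\<forall>\<^sub>F t in nhds 0. z + t *\<^sub>R j \<in> S"
    using assms topological_tendstoD by fastforce
  then have "\<forall>\<^sub>F r in nhds 0. deriv (\<lambda>t. deriv (\<lambda>s. f (z + s *\<^sub>R k + t *\<^sub>R h + r *\<^sub>R j)) 0) 0
     = frechet_derivative (\<lambda>w. frechet_derivative f (at w) k) (at (z + r *\<^sub>R j)) h"
  proof eventually_elim
    case (elim r)
    \<comment> \<open>The outermost increment is absorbed into the base point, which leaves two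
      derivatives.\<close>
    have "z + s *\<^sub>R k + t *\<^sub>R h + r *\<^sub>R j = z + r *\<^sub>R j + t *\<^sub>R h + s *\<^sub>R k" for s t
      by (simp add: algebra_simps)
    then show ?case
      by (simp only: deriv_deriv[OF assms(1,2) elim])
  qed
  from deriv_cong_ev[OF this refl] show ?thesis
    using deriv_line[OF smooth_on_differentiable[OF smooth_on_fd[OF smooth_on_fd[OF assms(2)]] assms(3)]] by simp
qed

text \<open>Translates the partial derivatives in \<open>hh_coeff\<close>, taken in \<open>x\<close>
  or in \<open>y\<close> alone, into derivatives of one map in base and vertical directions. The
  Christoffel symbols agree with a smooth map only on \<open>S\<close>, so germs are
  compared.\<close>

lemma partial_fd:
  fixes f :: "(real ^ 'n) \<times> (real ^ 'n) \<Rightarrow> real ^ 'n"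
  assumes S: "open S" "(\<xi>, y) \<in> S" and f: "smooth_on S f" and eq: "\<And>z. z \<in> S \<Longrightarrow> h (fst z) (snd z) = f z $ i"
  shows "partial k (\<lambda>x. h x y) \<xi> = frechet_derivative f (at (\<xi>, y)) (axis k 1, 0) $ i"
    "partial k (h \<xi>) y = frechet_derivative f (at (\<xi>, y)) (0, axis k 1) $ i"
proof -
  have fi: "smooth_on S (\<lambda>z. f z $ i)"
    by (rule smooth_on_vec_nth[OF S(1) f])
  have fdi: "frechet_derivative (\<lambda>z. f z $ i) (at (\<xi>, y)) a = frechet_derivative f (at (\<xi>, y)) a $ i" for a
    using fd_eqI[OF bounded_linear.has_derivative[OF bounded_linear_vec_nth smooth_on_has_derivative[OF f S(2)]], of i]
    by simp
  have near: "\<forall>\<^sub>F t in nhds 0. (\<xi>, y) + t *\<^sub>R a \<in> S" for a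
  proof -
    have "((\<lambda>t. (\<xi>, y) + t *\<^sub>R a) \<longlongrightarrow> (\<xi>, y) + 0 *\<^sub>R a) (nhds 0)"
      by (intro tendsto_intros) (auto simp: filterlim_ident)
    then show ?thesis
      using S topological_tendstoD by fastforce
  qed
  have "\<forall>\<^sub>F t in nhds 0. h (\<xi> + t *\<^sub>R axis k 1) y = f ((\<xi>, y) + t *\<^sub>R (axis k 1, 0)) $ i"
    using near[of "(axis k 1, 0)"] by eventually_elim (use eq in force)
  from deriv_cong_ev[OF this refl]
  show "partial k (\<lambda>x. h x y) \<xi> = frechet_derivative f (at (\<xi>, y)) (axis k 1, 0) $ i"
    unfolding partial_def using deriv_line[OF smooth_on_differentiable[OF fi S(2)]] fdi by metis
  have "\<forall>\<^sub>F t in nhds 0. h \<xi> (y + t *\<^sub>R axis k 1) = f ((\<xi>, y) + t *\<^sub>R (0, axis k 1)) $ i"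
    using near[of "(0, axis k 1)"] by eventually_elim (use eq in force)
  from deriv_cong_ev[OF this refl]
  show "partial k (h \<xi>) y = frechet_derivative f (at (\<xi>, y)) (0, axis k 1) $ i"
    unfolding partial_def using deriv_line[OF smooth_on_differentiable[OF fi S(2)]] fdi by metis
qed

lemma linear_sum_nth:
  fixes f :: "real ^ 'n \<Rightarrow> real ^ 'n"
  assumes "linear f"
  shows "(\<Sum>h\<in>UNIV. a $ h * f (axis h 1) $ i) = f a $ i"
proof -
  have "f a = (\<Sum>h\<in>UNIV. a $ h *\<^sub>R f (axis h 1))"
    by (subst vec_eq_sum_axis[of a]) (simp add: linear_sum[OF assms] linear_scale[OF assms])
  then show ?thesis by simp
qed

section \<open>Finsler geometry in coordinates\<close>

text \<open>\<open>z = (x, y)\<close> ranges over the coordinates of the tangent bundle; \<open>l\<close> is the metric in these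
  coordinates.\<close>

locale finsler_coords =
  fixes W :: "((real ^ 'n::finite) \<times> (real ^ 'n)) set" and l :: "(real ^ 'n) \<times> (real ^ 'n) \<Rightarrow> real"
  assumes openW: "open W" and smooth_l: "smooth_on W l"
    and cone: "\<And>x y r. (x, y) \<in> W \<Longrightarrow> r > 0 \<Longrightarrow> (x, r *\<^sub>R y) \<in> W"
    and hom: "\<And>x y r. (x, y) \<in> W \<Longrightarrow> r > 0 \<Longrightarrow> l (x, r *\<^sub>R y) = r\<^sup>2 * l (x, y)"
    and nondeg: "\<And>z a. z \<in> W \<Longrightarrow>
      (\<And>b. frechet_derivative (\<lambda>w. frechet_derivative l (at w) (0, a)) (at z) (0, b) = 0) \<Longrightarrow> a = 0"
begin

definition g where
  "g z a b = 1 / 2 * frechet_derivative (\<lambda>w. frechet_derivative l (at w) (0, a)) (at z) (0, b)"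

definition C where
  "C z a b c = 1 / 2 * frechet_derivative (\<lambda>w. g w a b) (at z) (0, c)"

text \<open>The base derivative of the metric coefficients with fibre coordinates held fixed: the
  classical ingredient of Koszul's formula.\<close>

definition Q where
  "Q z i j k = frechet_derivative (\<lambda>w. g w j k) (at z) (i, 0)"

lemma linear_g2: "z \<in> W \<Longrightarrow> linear (g z a)"
proof -
  assume z: "z \<in> W"
  have "linear (\<lambda>b. frechet_derivative (\<lambda>w. frechet_derivative l (at w) (0, a)) (at z) (0, b))"
    using linear_compose[OF linear_inr linear_fd[OF smooth_on_fd[OF smooth_l] z]]
    by (simp add: o_def)
  then show ?thesis
    unfolding g_def by (rule linear_mult_left)
qed

lemma g_sym: "z \<in> W \<Longrightarrow> g z a b = g z b a"
  unfolding g_def using fd_fd_commute[OF openW smooth_l] by simp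

lemma linear_g1: "z \<in> W \<Longrightarrow> linear (\<lambda>a. g z a b)"
  using linear_g2[of z b] g_sym[of z _ b] by (metis (no_types, lifting) ext)

lemma smooth_g: "smooth_on W (\<lambda>z. g z a b)"
  unfolding g_def by (intro smooth_on_mult smooth_on_const smooth_on_fd smooth_l openW)

lemma smooth_C: "smooth_on W (\<lambda>z. C z a b c)"
  unfolding C_def by (intro smooth_on_mult smooth_on_const smooth_on_fd smooth_g openW)

lemma smooth_Q: "smooth_on W (\<lambda>z. Q z a b c)"
  unfolding Q_def by (intro smooth_on_fd smooth_g)

lemma g_has_derivative: "z \<in> W \<Longrightarrow>
  ((\<lambda>w. g w a b) has_derivative (\<lambda>k. Q z (fst k) a b + 2 * C z a b (snd k))) (at z)"
proof -
  assume z: "z \<in> W"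
  have "frechet_derivative (\<lambda>w. g w a b) (at z) k = Q z (fst k) a b + 2 * C z a b (snd k)" for k
  proof -
    have "frechet_derivative (\<lambda>w. g w a b) (at z) ((fst k, 0) + (0, snd k))
        = Q z (fst k) a b + 2 * C z a b (snd k)"
      by (subst linear_add[OF linear_fd[OF smooth_g z]]) (simp add: Q_def C_def)
    then show ?thesis by simp
  qed
  then show ?thesis
    using smooth_on_has_derivative[OF smooth_g[of a b] z] by simp
qed

lemma g_differentiable: "z \<in> W \<Longrightarrow> (\<lambda>w. g w a b) differentiable (at z)"
  using smooth_on_differentiable[OF smooth_g] .

lemma C_sym12: "z \<in> W \<Longrightarrow> C z a b c = C z b a c"
  unfolding C_def using fd_cong[OF openW, of z "\<lambda>w. g w a b" "\<lambda>w. g w b a"] g_sym by simp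

lemma Q_sym: "z \<in> W \<Longrightarrow> Q z c a b = Q z c b a"
  unfolding Q_def using fd_cong[OF openW, of z "\<lambda>w. g w a b" "\<lambda>w. g w b a"] g_sym by simp

lemma fd_g: "z \<in> W \<Longrightarrow> frechet_derivative (\<lambda>w. g w a b) (at z) k = 1 / 2 *
   frechet_derivative (\<lambda>w. frechet_derivative (\<lambda>w. frechet_derivative l (at w) (0, a)) (at w) (0, b)) (at z) k"
proof -
  assume z: "z \<in> W"
  let ?f = "\<lambda>w. frechet_derivative (\<lambda>w. frechet_derivative l (at w) (0, a)) (at w) (0, b)"
  have "((\<lambda>w. 1 / 2 * ?f w) has_derivative (\<lambda>k. 1 / 2 * frechet_derivative ?f (at z) k)) (at z)"
    by (intro has_derivative_mult_right smooth_on_has_derivative[OF _ z] smooth_on_fd smooth_l)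
  then show ?thesis
    unfolding g_def by (simp add: fd_eqI)
qed

lemma C_sym23: "z \<in> W \<Longrightarrow> C z a b c = C z a c b"
  by (simp add: C_def fd_g fd_fd_commute[OF openW smooth_on_fd[OF smooth_l]])

lemma linear_C3: "z \<in> W \<Longrightarrow> linear (\<lambda>c. C z a b c)"
proof -
  assume z: "z \<in> W"
  have "linear (\<lambda>c. frechet_derivative (\<lambda>w. g w a b) (at z) (0, c))"
    using linear_compose[OF linear_inr linear_fd[OF smooth_g z]]
    by (simp add: o_def)
  then show ?thesis
    unfolding C_def by (rule linear_mult_left)
qed

lemma linear_C2: "z \<in> W \<Longrightarrow> linear (\<lambda>b. C z a b c)"
  using linear_C3[of z a c] C_sym23[of z a c] by simp

lemma linear_C1: "z \<in> W \<Longrightarrow> linear (\<lambda>a. C z a b c)"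
  using linear_C2[of z b c] C_sym12[of z b _ c] by simp

lemma linear_Q1: "z \<in> W \<Longrightarrow> linear (\<lambda>a. Q z a b c)"
  using linear_compose[OF linear_inl linear_fd[OF smooth_g]]
  by (simp add: Q_def o_def)

lemma linear_Q3: "z \<in> W \<Longrightarrow> linear (\<lambda>c. Q z a b c)"
  unfolding Q_def
  by (rule linear_fd_family[OF openW, where F = "\<lambda>w. g w b"]) (auto intro: linear_g2 g_differentiable)

lemma linear_Q2: "z \<in> W \<Longrightarrow> linear (\<lambda>b. Q z a b c)"
  using linear_Q3[of z a c] Q_sym[of z a c] by simp

lemma nondegenerate: "z \<in> W \<Longrightarrow> (\<And>b. g z a b = g z a' b) \<Longrightarrow> a = a'"
proof -
  assume z: "z \<in> W" and eq: "\<And>b. g z a b = g z a' b"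
  have "g z (a - a') b = 0" for b
    using eq[of b] by (simp add: linear_diff[OF linear_g1[OF z]])
  then have "a - a' = 0"
    by (intro nondeg[OF z]) (simp add: g_def)
  then show ?thesis by simp
qed

subsection \<open>Consequences of homogeneity\<close>

lemma euler: "z \<in> W \<Longrightarrow> frechet_derivative l (at z) (0, snd z) = 2 * l z"
proof -
  assume z: "z \<in> W"
  obtain x y where xy: "z = (x, y)" by fastforce
  have d: "((\<lambda>t. l (z + t *\<^sub>R (0, y))) has_real_derivative frechet_derivative l (at z) (0, y)) (at 0)"
    using has_real_derivative_line[of l z 0 "(0, y)"] smooth_on_differentiable[OF smooth_l z]
    by (simp flip: zero_prod_def)
  \<comment> \<open>Homogeneity along the ray through \<open>y\<close>, with factor
    \<open>1 + t\<close>; positivity of the factor explains the half line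
    \<open>{-1<..}\<close>.\<close>
  have "((\<lambda>t. (1 + t)\<^sup>2 * l z) has_real_derivative 2 * l z) (at 0)"
    by (auto intro!: derivative_eq_intros)
  then have "((\<lambda>t. l (z + t *\<^sub>R (0, y))) has_real_derivative 2 * l z) (at 0)"
  proof (rule has_field_derivative_transform_within_open[where S = "{-1<..}"])
    fix t :: real assume "t \<in> {-1<..}"
    then show "(1 + t)\<^sup>2 * l z = l (z + t *\<^sub>R (0, y))"
      using hom[of x y "1 + t"] z by (simp add: xy scaleR_left_distrib)
  qed auto
  then show ?thesis
    using d DERIV_unique xy by force
qed

text \<open>Euler's relation differentiated in a direction \<open>k\<close> of the tangent bundle.
  Vertical \<open>k\<close> gives \<open>g_y\<close>, base directions give
  \<open>fd_l_base\<close>.\<close>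

lemma fd_euler: "z \<in> W \<Longrightarrow>
  frechet_derivative (\<lambda>w. frechet_derivative l (at w) (0, snd z)) (at z) k
    + frechet_derivative l (at z) (0, snd k) = 2 * frechet_derivative l (at z) k"
proof -
  assume z: "z \<in> W"
  have "((\<lambda>w. frechet_derivative l (at w) (0, snd w)) has_derivative
    (\<lambda>k. frechet_derivative (\<lambda>w. frechet_derivative l (at w) (0, snd z)) (at z) k
      + frechet_derivative l (at z) (0, snd k))) (at z)"
    by (rule has_derivative_fd_field[OF openW smooth_l z]) (auto intro!: derivative_eq_intros)
  moreover have "((\<lambda>w. 2 * l w) has_derivative (\<lambda>k. 2 * frechet_derivative l (at z) k)) (at z)"
    by (intro has_derivative_mult_right smooth_on_has_derivative[OF smooth_l z])
  moreover have "frechet_derivative (\<lambda>w. frechet_derivative l (at w) (0, snd w)) (at z)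
      = frechet_derivative (\<lambda>w. 2 * l w) (at z)"
    by (rule fd_cong[OF openW z]) (rule euler)
  ultimately show ?thesis
    by (metis (no_types, lifting) fd_eqI)
qed

lemma g_y: "z \<in> W \<Longrightarrow> g z (snd z) b = 1 / 2 * frechet_derivative l (at z) (0, b)"
  using fd_euler[of z "(0, b)"] by (simp add: g_def)

lemma fd_l_base: "z \<in> W \<Longrightarrow>
   frechet_derivative (\<lambda>w. frechet_derivative l (at w) (0, snd z)) (at z) (a, 0)
     = 2 * frechet_derivative l (at z) (a, 0)"
  using fd_euler[of z "(a, 0)"] linear_0[OF linear_fd[OF smooth_l]]
  by (simp flip: zero_prod_def)

lemma g_field_has_derivative:
  assumes z: "z \<in> W" and A: "(A has_derivative A') (at z)"
  shows "((\<lambda>w. g w (A w) b) has_derivative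
    (\<lambda>k. Q z (fst k) (A z) b + 2 * C z (A z) b (snd k) + g z (A' k) b)) (at z)"
  using has_derivative_linear_family[OF openW z, where F = "\<lambda>w a. g w a b", OF linear_g1 g_differentiable[OF z] A]
  by (simp add: fd_eqI[OF g_has_derivative[OF z]])

text \<open>The identity \<open>g_y\<close> differentiated once more: vertical directions give
  \<open>C_y\<close>, base directions give \<open>Q_y\<close>.\<close>

lemma fd_g_y: "z \<in> W \<Longrightarrow> Q z (fst k) (snd z) b + 2 * C z (snd z) b (snd k) + g z (snd k) b
    = 1 / 2 * frechet_derivative (\<lambda>w. frechet_derivative l (at w) (0, b)) (at z) k"
proof -
  assume z: "z \<in> W"
  have "((\<lambda>w. g w (snd w) b) has_derivative
    (\<lambda>k. Q z (fst k) (snd z) b + 2 * C z (snd z) b (snd k) + g z (snd k) b)) (at z)"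
    by (rule g_field_has_derivative[OF z]) (auto intro!: derivative_eq_intros)
  moreover have "((\<lambda>w. 1 / 2 * frechet_derivative l (at w) (0, b)) has_derivative
     (\<lambda>k. 1 / 2 * frechet_derivative (\<lambda>w. frechet_derivative l (at w) (0, b)) (at z) k)) (at z)"
    by (intro has_derivative_mult_right smooth_on_has_derivative[OF _ z] smooth_on_fd smooth_l)
  moreover have "frechet_derivative (\<lambda>w. g w (snd w) b) (at z)
      = frechet_derivative (\<lambda>w. 1 / 2 * frechet_derivative l (at w) (0, b)) (at z)"
    by (rule fd_cong[OF openW z]) (rule g_y)
  ultimately show ?thesis
    by (metis (no_types, lifting) fd_eqI)
qed

text \<open>In a vertical direction the right-hand side of \<open>fd_g_y\<close> is \<open>g\<close>
  itself, which leaves twice the Cartan term equal to 0. This decouples the equations for spray,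
  \<open>N\<close> and \<Gamma>.\<close>

lemma C_y: "z \<in> W \<Longrightarrow> C z (snd z) b c = 0"
  using fd_g_y[of z "(0, c)" b] g_sym[of z c b] linear_0[OF linear_Q1[of z]]
  by (simp add: g_def[of z b c])

lemma C_y2: "z \<in> W \<Longrightarrow> C z b (snd z) c = 0"
  using C_y C_sym12 by simp

lemma Q_y: "z \<in> W \<Longrightarrow> Q z a (snd z) b
    = 1 / 2 * frechet_derivative (\<lambda>w. frechet_derivative l (at w) (0, b)) (at z) (a, 0)"
  using fd_g_y[of z "(a, 0)" b] linear_0[OF linear_C3[of z]] linear_0[OF linear_g1[of z]]
  by simp

subsection \<open>Christoffel symbols\<close>

text \<open>Cramer's rule, so that smoothness is evident.\<close>

definition sharp :: "(real ^ 'n) \<times> (real ^ 'n) \<Rightarrow> (real ^ 'n \<Rightarrow> real) \<Rightarrow> real ^ 'n" where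
  "sharp z f = (\<chi> k. det (\<chi> i j. if j = k then f (axis i 1) else g z (axis j 1) (axis i 1)) /
      det (\<chi> i j. g z (axis j 1) (axis i 1)))"

lemma gram_mult: "z \<in> W \<Longrightarrow> ((\<chi> i j. g z (axis j 1) (axis i 1)) *v a) $ i = g z a (axis i 1)"
  by (subst (2) vec_eq_sum_axis[of a])
     (simp add: matrix_vector_mult_def linear_sum[OF linear_g1] linear_scale[OF linear_g1] mult.commute)

text \<open>A kernel vector of the Gram matrix pairs to 0 with every basis vector, so nondegeneracy
  kills it.\<close>

lemma gram_det: "z \<in> W \<Longrightarrow> det (\<chi> i j. g z (axis j 1) (axis i 1)) \<noteq> 0"
proof -
  assume z: "z \<in> W"
  have "a = 0" if "(\<chi> i j. g z (axis j 1) (axis i 1)) *v a = 0" for a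
  proof (rule nondegenerate[OF z])
    fix b
    have "g z a (axis i 1) = 0" for i
      using gram_mult[OF z, of a i] that by simp
    then show "g z a b = g z 0 b"
      using linear_eq_axis[OF linear_g2[OF z] linear_g2[OF z], of a 0 b]
      by (simp add: linear_0[OF linear_g1[OF z]])
  qed
  then show ?thesis
    unfolding invertible_det_nz[symmetric] invertible_left_inverse matrix_left_invertible_ker by blast
qed

lemma g_sharp:
  assumes z: "z \<in> W" and f: "linear f"
  shows "g z (sharp z f) b = f b"
proof (rule linear_eq_axis[OF linear_g2[OF z] f])
  fix i
  let ?G = "\<chi> i j. g z (axis j 1) (axis i 1)"
  have "?G *v sharp z f = (\<chi> i. f (axis i 1))"
    unfolding cramer[OF gram_det[OF z]] by (simp add: sharp_def cong: if_cong)
  then show "g z (sharp z f) (axis i 1) = f (axis i 1)"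
    using gram_mult[OF z, of "sharp z f" i] by simp
qed

lemma smooth_sharp:
  assumes "\<And>b. smooth_on W (\<lambda>z. f z b)"
  shows "smooth_on W (\<lambda>z. sharp z (f z))"
proof (rule smooth_on_vec[OF openW])
  fix k
  have "smooth_on W (\<lambda>x. (\<chi> i j. if j = k then f x (axis i 1) else g x (axis j 1) (axis i 1)) $ i $ j)" for i j
    using assms by (cases "j = k") (auto simp: smooth_g)
  then show "smooth_on W (\<lambda>x. sharp x (f x) $ k)"
    unfolding sharp_def vec_lambda_beta
    by (intro smooth_on_divide smooth_on_det openW gram_det) (auto simp: smooth_g)
qed

text \<open>Twice the usual spray coefficients \<open>G\<^sup>i\<close>: Koszul's formula with both
  arguments \<open>y\<close>, where every Cartan term vanishes. It is written through
  \<open>l\<close>, the form that \<open>fd_S\<close> differentiates.\<close>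

definition S where
  "S z = sharp z (\<lambda>b. 1 / 2 * frechet_derivative (\<lambda>w. frechet_derivative l (at w) (0, b)) (at z) (snd z, 0)
      - 1 / 2 * frechet_derivative l (at z) (b, 0))"

text \<open>Koszul's formula with one argument \<open>y\<close>. The only surviving Cartan term
  contains \<open>N z y\<close>, for which the known spray is substituted.\<close>

definition N where
  "N z a = sharp z (\<lambda>b. 1 / 2 * (Q z a (snd z) b + Q z (snd z) a b - Q z b a (snd z)) - C z a b (S z))"

text \<open>Koszul's formula with each \<open>Q\<close> corrected by a Cartan term in
  \<open>N\<close>, that is, with horizontal derivatives of the metric.\<close>

definition Gm where
  "Gm z a b = sharp z (\<lambda>c. 1 / 2 * ((Q z a b c - 2 * C z b c (N z a)) + (Q z b a c - 2 * C z a c (N z b))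
      - (Q z c a b - 2 * C z a b (N z c))))"

lemma g_S: "z \<in> W \<Longrightarrow> g z (S z) b =
    1 / 2 * frechet_derivative (\<lambda>w. frechet_derivative l (at w) (0, b)) (at z) (snd z, 0)
      - 1 / 2 * frechet_derivative l (at z) (b, 0)"
proof -
  assume z: "z \<in> W"
  have "linear (\<lambda>b. Q z (snd z) (snd z) b - 1 / 2 * Q z b (snd z) (snd z))"
    using linear_compose_sub[OF linear_Q3[OF z] linear_mult_left[OF linear_Q1[OF z], where c = "1/2"]]
    by simp
  then show ?thesis
    unfolding S_def by (intro g_sharp[OF z]) (simp add: Q_y[OF z] fd_l_base[OF z])
qed

lemmas lin_simps = linear_add[OF linear_g1] linear_add[OF linear_g2] linear_add[OF linear_C1]
  linear_add[OF linear_C2] linear_add[OF linear_C3] linear_add[OF linear_Q1]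
  linear_add[OF linear_Q2] linear_add[OF linear_Q3]
  linear_scale[OF linear_g1] linear_scale[OF linear_g2] linear_scale[OF linear_C1]
  linear_scale[OF linear_C2] linear_scale[OF linear_C3] linear_scale[OF linear_Q1]
  linear_scale[OF linear_Q2] linear_scale[OF linear_Q3]

lemma g_N: "z \<in> W \<Longrightarrow> g z (N z a) b =
    1 / 2 * (Q z a (snd z) b + Q z (snd z) a b - Q z b a (snd z)) - C z a b (S z)"
  unfolding N_def by (rule g_sharp, assumption, rule linearI_real) (simp_all add: lin_simps algebra_simps)

lemma linear_N: "z \<in> W \<Longrightarrow> linear (N z)"
  by (rule linearI; rule nondegenerate, assumption) (simp_all add: g_N lin_simps algebra_simps)

lemma N_y: "z \<in> W \<Longrightarrow> N z (snd z) = S z"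
  by (rule nondegenerate, assumption) (simp add: g_N g_S C_y Q_y fd_l_base)

lemma g_Gm: "z \<in> W \<Longrightarrow> g z (Gm z a b) c =
   1 / 2 * ((Q z a b c - 2 * C z b c (N z a)) + (Q z b a c - 2 * C z a c (N z b))
      - (Q z c a b - 2 * C z a b (N z c)))"
  unfolding Gm_def
  by (rule g_sharp, assumption, rule linearI_real)
     (simp_all add: lin_simps linear_add[OF linear_N] linear_scale[OF linear_N] algebra_simps)

lemma Gm_sym: "z \<in> W \<Longrightarrow> Gm z a b = Gm z b a"
  by (rule nondegenerate, assumption) (simp add: g_Gm Q_sym[of z _ a b] C_sym12[of z a b])

lemma linear_Gm1: "z \<in> W \<Longrightarrow> linear (\<lambda>a. Gm z a b)"
  by (rule linearI; rule nondegenerate, assumption)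
     (simp_all add: g_Gm lin_simps linear_add[OF linear_N] linear_scale[OF linear_N] algebra_simps)

lemma linear_Gm2: "z \<in> W \<Longrightarrow> linear (Gm z a)"
  using linear_Gm1[of z a] Gm_sym[of z a] by (metis (no_types, lifting) ext)

text \<open>\<open>N\<close> was fixed before \<Gamma>. That it is \<Gamma> contracted with
  \<open>y\<close> closes the circle and turns \<open>compat\<close> into almost compatibility in
  coordinates.\<close>

lemma Gm_y: "z \<in> W \<Longrightarrow> Gm z a (snd z) = N z a"
  by (rule nondegenerate, assumption) (simp add: g_Gm g_N C_y C_y2 N_y)

lemma compat: "z \<in> W \<Longrightarrow> Q z a b c = g z (Gm z a b) c + g z b (Gm z a c) + 2 * C z b c (N z a)"
  by (simp add: g_sym[of z b] g_Gm Q_sym[of z _ c b] C_sym12[of z c b] field_simps)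

lemma smooth_S: "smooth_on W S"
  unfolding S_def
  by (intro smooth_sharp smooth_on_diff smooth_on_mult smooth_on_const smooth_on_fd_field
     smooth_on_fd smooth_l openW smooth_on_Pair smooth_on_compose_linear[OF bounded_linear_snd] smooth_on_ident)

lemma smooth_C_field: "smooth_on W A \<Longrightarrow> smooth_on W (\<lambda>z. C z a b (A z))"
  by (rule smooth_on_linear_family[OF openW linear_C3 smooth_C])

lemma smooth_N: "smooth_on W (\<lambda>z. N z a)"
proof -
  have snd: "smooth_on W snd"
    by (intro smooth_on_linear bounded_linear_snd)
  show ?thesis
    unfolding N_def
    by (intro smooth_sharp smooth_on_diff smooth_on_add smooth_on_mult smooth_on_const smooth_C_field smooth_S
      smooth_on_linear_family[where F = "\<lambda>z y. Q z a y _", OF openW linear_Q2 smooth_Q snd]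
      smooth_on_linear_family[where F = "\<lambda>z y. Q z y a _", OF openW linear_Q1 smooth_Q snd]
      smooth_on_linear_family[where F = "\<lambda>z y. Q z _ a y", OF openW linear_Q3 smooth_Q snd]
      openW)
qed

lemma smooth_Gm: "smooth_on W (\<lambda>z. Gm z a b)"
  unfolding Gm_def
  by (intro smooth_sharp smooth_on_diff smooth_on_add smooth_on_mult smooth_on_const smooth_C_field smooth_N
      smooth_Q openW)

lemma Gm_differentiable: "z \<in> W \<Longrightarrow> (\<lambda>w. Gm w a b) differentiable (at z)"
  using smooth_on_differentiable[OF smooth_Gm] .

text \<open>Differentiate the defining equation of \<open>S\<close> against a fixed
  \<open>b\<close>. Mixed derivatives of \<open>l\<close> become base derivatives of the metric, and
  the derivative of \<open>g\<close> contributes \<open>2 C(S, b, h)\<close>, twice the Cartan term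
  in the definition of \<open>N\<close>.\<close>

lemma fd_S: "z \<in> W \<Longrightarrow> frechet_derivative S (at z) (0, h) = 2 *\<^sub>R N z h"
proof (rule nondegenerate)
  fix b
  assume z: "z \<in> W"
  let ?L = "\<lambda>b w. frechet_derivative l (at w) b"
  have snd: "((\<lambda>w. (snd w, 0)) has_derivative (\<lambda>k. (snd k, 0))) (at z)"
    by (auto intro!: derivative_eq_intros)
  have "((\<lambda>w. g w (S w) b) has_derivative
    (\<lambda>k. Q z (fst k) (S z) b + 2 * C z (S z) b (snd k) + g z (frechet_derivative S (at z) k) b)) (at z)"
    by (rule g_field_has_derivative[OF z smooth_on_has_derivative[OF smooth_S z]])
  moreover have "((\<lambda>w. 1 / 2 * frechet_derivative (?L (0, b)) (at w) (snd w, 0) - 1 / 2 * ?L (b, 0) w)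
     has_derivative (\<lambda>k. 1 / 2 * (frechet_derivative (\<lambda>w. frechet_derivative (?L (0, b)) (at w) (snd z, 0)) (at z) k
         + frechet_derivative (?L (0, b)) (at z) (snd k, 0))
       - 1 / 2 * frechet_derivative (?L (b, 0)) (at z) k)) (at z)"
    by (intro has_derivative_diff has_derivative_mult_right has_derivative_fd_field[OF openW _ z snd]
       smooth_on_has_derivative[OF _ z] smooth_on_fd smooth_l)
  moreover have "frechet_derivative (\<lambda>w. g w (S w) b) (at z)
    = frechet_derivative (\<lambda>w. 1 / 2 * frechet_derivative (?L (0, b)) (at w) (snd w, 0) - 1 / 2 * ?L (b, 0) w) (at z)"
    by (rule fd_cong[OF openW z]) (rule g_S)
  ultimately have "Q z 0 (S z) b + 2 * C z (S z) b h + g z (frechet_derivative S (at z) (0, h)) b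
     = 1 / 2 * (frechet_derivative (\<lambda>w. frechet_derivative (?L (0, b)) (at w) (snd z, 0)) (at z) (0, h)
         + frechet_derivative (?L (0, b)) (at z) (h, 0)) - 1 / 2 * frechet_derivative (?L (b, 0)) (at z) (0, h)"
    by (simp add: fd_eqI fun_eq_iff split: prod.splits)
  moreover have "frechet_derivative (\<lambda>w. frechet_derivative (?L (0, b)) (at w) (snd z, 0)) (at z) (0, h)
      = 2 * Q z (snd z) b h"
    unfolding Q_def fd_g[OF z] by (simp add: fd_fd_commute[OF openW smooth_on_fd[OF smooth_l] z])
  moreover have "frechet_derivative (?L (0, b)) (at z) (h, 0) = 2 * Q z h (snd z) b"
    by (simp add: Q_y[OF z])
  moreover have "frechet_derivative (?L (b, 0)) (at z) (0, h) = 2 * Q z b (snd z) h"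
    by (simp add: Q_y[OF z] fd_fd_commute[OF openW smooth_l z])
  moreover have "C z (S z) b h = C z h b (S z)"
    using C_sym12[OF z] C_sym23[OF z] by metis
  ultimately show "g z (frechet_derivative S (at z) (0, h)) b = g z (2 *\<^sub>R N z h) b"
    using Q_sym[OF z, of "snd z" b h] Q_sym[OF z, of b "snd z" h] linear_0[OF linear_Q1[OF z]]
    by (simp add: linear_scale[OF linear_g1[OF z]] g_N[OF z] field_simps)
qed

text \<open>Since \<open>\<Gamma>(y, y)\<close> is the spray \<open>S\<close>, whose vertical derivative is \<open>2N = 2\<Gamma>(\<cdot>, y)\<close>.\<close>

lemma fd_Gm_yy:
  assumes z: "z \<in> W"
  shows "frechet_derivative (\<lambda>w. Gm w (snd z) (snd z)) (at z) (0, h) = 0"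
proof -
  have "((\<lambda>w. Gm w (snd z) (snd w)) has_derivative
     (\<lambda>k. frechet_derivative (\<lambda>w. Gm w (snd z) (snd z)) (at z) k + Gm z (snd z) (snd k))) (at z)"
    by (rule has_derivative_linear_family[OF openW z linear_Gm2 Gm_differentiable[OF z]])
       (auto intro!: derivative_eq_intros)
  then have "((\<lambda>w. N w (snd z)) has_derivative
     (\<lambda>k. frechet_derivative (\<lambda>w. Gm w (snd z) (snd z)) (at z) k + Gm z (snd z) (snd k))) (at z)"
    by (rule has_derivative_transform_within_open[OF _ openW z]) (rule Gm_y)
  note 1 = fd_eqI[OF this]
  have "((\<lambda>w. N w (snd w)) has_derivative
     (\<lambda>k. frechet_derivative (\<lambda>w. N w (snd z)) (at z) k + N z (snd k))) (at z)"
    by (rule has_derivative_linear_family[OF openW z linear_N smooth_on_differentiable[OF smooth_N z]])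
       (auto intro!: derivative_eq_intros)
  then have "(S has_derivative
     (\<lambda>k. frechet_derivative (\<lambda>w. N w (snd z)) (at z) k + N z (snd k))) (at z)"
    by (rule has_derivative_transform_within_open[OF _ openW z]) (rule N_y)
  \<comment> \<open>Hence the derivative of \<open>N\<close> with its argument frozen is
    \<open>N z h\<close>, and this already equals the term \<open>\<Gamma>(y, h)\<close> of the
    first expansion, so that nothing is left for the derivative of \<open>\<Gamma>(y, y)\<close>
    with frozen arguments.\<close>
  from fd_eqI[OF this] have "2 *\<^sub>R N z h = frechet_derivative (\<lambda>w. N w (snd z)) (at z) (0, h) + N z h"
    using fd_S[OF z, of h] by simp
  then show ?thesis
    using 1 Gm_y[OF z, of h] Gm_sym[OF z, of h] by (simp add: scaleR_2)
qed

subsection \<open>Covariant derivative and curvature with a reference field\<close>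

definition cov where
  "cov V Y \<xi> a = frechet_derivative Y (at \<xi>) a + Gm (\<xi>, V \<xi>) a (Y \<xi>)"

definition Rm where
  "Rm V X Y Z \<xi> = cov V (\<lambda>\<xi>. cov V Z \<xi> (Y \<xi>)) \<xi> (X \<xi>) - cov V (\<lambda>\<xi>. cov V Z \<xi> (X \<xi>)) \<xi> (Y \<xi>)
     - cov V Z \<xi> (frechet_derivative Y (at \<xi>) (X \<xi>) - frechet_derivative X (at \<xi>) (Y \<xi>))"

text \<open>The derivatives combine in pairs to horizontal ones, in directions
  \<open>(a, - N z a)\<close> and \<open>(b, - N z b)\<close>. The expression is visibly
  antisymmetric in \<open>a\<close> and \<open>b\<close>, which \<open>curvature_eq_flag\<close>
  uses.\<close>

definition hh where
  "hh z a b c = frechet_derivative (\<lambda>w. Gm w b c) (at z) (a, 0)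
     - frechet_derivative (\<lambda>w. Gm w b c) (at z) (0, N z a)
     - frechet_derivative (\<lambda>w. Gm w a c) (at z) (b, 0)
     + frechet_derivative (\<lambda>w. Gm w a c) (at z) (0, N z b)
     + Gm z a (Gm z b c) - Gm z b (Gm z a c)"

lemma linear_cov: "V differentiable (at \<xi>) \<Longrightarrow> Y differentiable (at \<xi>) \<Longrightarrow> (\<xi>, V \<xi>) \<in> W \<Longrightarrow> linear (cov V Y \<xi>)"
  unfolding cov_def by (intro linear_compose_add linear_frechet_derivative linear_Gm1)

text \<open>The point \<open>(\<xi>, V \<xi>)\<close> moves in base and fibre. \<open>compat\<close>
  trades the base derivative for \<Gamma> and a Cartan term in \<open>N a\<close>; the fibre
  derivative adds a Cartan term in the derivative of \<open>V\<close>, and the two make up the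
  covariant derivative of \<open>V\<close>.\<close>

lemma metric_has_derivative:
  assumes "open T" "\<xi> \<in> T" "\<And>\<xi>. \<xi> \<in> T \<Longrightarrow> (\<xi>, V \<xi>) \<in> W"
    and d: "V differentiable (at \<xi>)" "Y differentiable (at \<xi>)" "Z differentiable (at \<xi>)"
  shows "((\<lambda>\<xi>. g (\<xi>, V \<xi>) (Y \<xi>) (Z \<xi>)) has_derivative (\<lambda>a.
      g (\<xi>, V \<xi>) (cov V Y \<xi> a) (Z \<xi>) + g (\<xi>, V \<xi>) (Y \<xi>) (cov V Z \<xi> a)
      + 2 * C (\<xi>, V \<xi>) (cov V V \<xi> a) (Y \<xi>) (Z \<xi>))) (at \<xi>)"
proof -
  let ?z = "(\<xi>, V \<xi>)"
  have z: "?z \<in> W" using assms by blast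
  have zd: "((\<lambda>\<xi>. (\<xi>, V \<xi>)) has_derivative (\<lambda>a. (a, frechet_derivative V (at \<xi>) a))) (at \<xi>)"
    by (intro has_derivative_Pair has_derivative_ident fd_works d)
  have 0: "((\<lambda>\<xi>. g (\<xi>, V \<xi>) b c) has_derivative
     (\<lambda>a. Q ?z a b c + 2 * C ?z b c (frechet_derivative V (at \<xi>) a))) (at \<xi>)" for b c
    using has_derivative_compose[OF zd g_has_derivative[OF z, of b c]] by simp
  have 1: "((\<lambda>\<xi>. g (\<xi>, V \<xi>) (Y \<xi>) c) has_derivative
     (\<lambda>a. Q ?z a (Y \<xi>) c + 2 * C ?z (Y \<xi>) c (frechet_derivative V (at \<xi>) a)
        + g ?z (frechet_derivative Y (at \<xi>) a) c)) (at \<xi>)" for c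
    using has_derivative_linear_family[OF assms(1,2), where F = "\<lambda>\<xi> b. g (\<xi>, V \<xi>) b c" and A = Y,
        OF linear_g1[OF assms(3)] differentiableI[OF 0] fd_works[OF d(2)]]
    by (simp add: fd_eqI[OF 0])
  have "((\<lambda>\<xi>. g (\<xi>, V \<xi>) (Y \<xi>) (Z \<xi>)) has_derivative
     (\<lambda>a. Q ?z a (Y \<xi>) (Z \<xi>) + 2 * C ?z (Y \<xi>) (Z \<xi>) (frechet_derivative V (at \<xi>) a)
        + g ?z (frechet_derivative Y (at \<xi>) a) (Z \<xi>) + g ?z (Y \<xi>) (frechet_derivative Z (at \<xi>) a))) (at \<xi>)"
    using has_derivative_linear_family[OF assms(1,2), where F = "\<lambda>\<xi> c. g (\<xi>, V \<xi>) (Y \<xi>) c" and A = Z,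
        OF linear_g2[OF assms(3)] differentiableI[OF 1] fd_works[OF d(3)]]
    by (simp add: fd_eqI[OF 1])
  moreover have "Q ?z a (Y \<xi>) (Z \<xi>) + 2 * C ?z (Y \<xi>) (Z \<xi>) (frechet_derivative V (at \<xi>) a)
        + g ?z (frechet_derivative Y (at \<xi>) a) (Z \<xi>) + g ?z (Y \<xi>) (frechet_derivative Z (at \<xi>) a)
      = g ?z (cov V Y \<xi> a) (Z \<xi>) + g ?z (Y \<xi>) (cov V Z \<xi> a) + 2 * C ?z (cov V V \<xi> a) (Y \<xi>) (Z \<xi>)" for a
  proof -
    have "C ?z (cov V V \<xi> a) (Y \<xi>) (Z \<xi>) = C ?z (Y \<xi>) (Z \<xi>) (cov V V \<xi> a)"
      using C_sym12[OF z] C_sym23[OF z] by metis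
    then show ?thesis
      using Gm_y[OF z, of a] by (simp add: cov_def compat[OF z] lin_simps[OF z] algebra_simps)
  qed
  ultimately show ?thesis by simp
qed

lemma smooth_on_Gm_field:
  assumes "open T" "\<And>\<xi>. \<xi> \<in> T \<Longrightarrow> (\<xi>, V \<xi>) \<in> W" "smooth_on T V" "smooth_on T X" "smooth_on T Y"
  shows "smooth_on T (\<lambda>\<xi>. Gm (\<xi>, V \<xi>) (X \<xi>) (Y \<xi>))"
proof -
  have 0: "smooth_on T (\<lambda>\<xi>. Gm (\<xi>, V \<xi>) a b)" for a b
    by (rule smooth_on_compose[OF assms(1) openW _ _ smooth_Gm])
       (use assms in \<open>auto intro: smooth_on_Pair smooth_on_ident\<close>)
  have 1: "smooth_on T (\<lambda>\<xi>. Gm (\<xi>, V \<xi>) (X \<xi>) b)" for b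
    by (rule smooth_on_linear_family[where F = "\<lambda>\<xi> a. Gm (\<xi>, V \<xi>) a b",
         OF assms(1) linear_Gm1[OF assms(2)] _ assms(4)]) (auto intro: 0)
  show ?thesis
    by (rule smooth_on_linear_family[where F = "\<lambda>\<xi> b. Gm (\<xi>, V \<xi>) (X \<xi>) b",
         OF assms(1) linear_Gm2[OF assms(2)] _ assms(5)]) (auto intro: 1)
qed

lemma smooth_on_cov:
  assumes "open T" "\<And>\<xi>. \<xi> \<in> T \<Longrightarrow> (\<xi>, V \<xi>) \<in> W" "smooth_on T V" "smooth_on T X" "smooth_on T Y"
  shows "smooth_on T (\<lambda>\<xi>. cov V Y \<xi> (X \<xi>))"
  unfolding cov_def by (intro smooth_on_add smooth_on_fd_field smooth_on_Gm_field assms)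

text \<open>Second derivatives of the scalar \<open>g(V, Z)\<close> commute. Its first derivative
  has no Cartan term, since one argument is \<open>V\<close>; the second has only
  \<open>C(\<nabla>V, \<nabla>V, Z)\<close>, which is symmetric in the two directions, as are the
  mixed products. Antisymmetrising leaves the curvatures. The left-hand side sees \<open>Z\<close>
  only at \<xi>.\<close>

lemma curvature_antisym:
  assumes T: "open T" "\<xi> \<in> T" and adm: "\<And>\<xi>. \<xi> \<in> T \<Longrightarrow> (\<xi>, V \<xi>) \<in> W"
    and sm: "smooth_on T V" "smooth_on T X" "smooth_on T Y" "smooth_on T Z"
  shows "g (\<xi>, V \<xi>) (Rm V X Y V \<xi>) (Z \<xi>) = - g (\<xi>, V \<xi>) (V \<xi>) (Rm V X Y Z \<xi>)"
proof -
  let ?g = "\<lambda>\<xi>. g (\<xi>, V \<xi>)"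
  let ?z = "(\<xi>, V \<xi>)"
  have z: "?z \<in> W" using T adm by blast
  note df = smooth_on_differentiable[OF _ T(2)]
  define h where "h = (\<lambda>\<xi>. ?g \<xi> (V \<xi>) (Z \<xi>))"
  have smh: "smooth_on T h"
  proof -
    have 0: "smooth_on T (\<lambda>\<xi>. ?g \<xi> a b)" for a b
      by (rule smooth_on_compose[OF T(1) openW _ _ smooth_g])
         (use T adm sm in \<open>auto intro: smooth_on_Pair smooth_on_ident\<close>)
    have 1: "smooth_on T (\<lambda>\<xi>. ?g \<xi> (V \<xi>) b)" for b
      by (rule smooth_on_linear_family[where F = "\<lambda>\<xi> a. g (\<xi>, V \<xi>) a b",
           OF T(1) linear_g1[OF adm] _ sm(1)]) (auto intro: 0)
    show ?thesis unfolding h_def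
      by (rule smooth_on_linear_family[where F = "\<lambda>\<xi> b. g (\<xi>, V \<xi>) (V \<xi>) b",
           OF T(1) linear_g2[OF adm] _ sm(4)]) (auto intro: 1)
  qed
  have fdh: "frechet_derivative h (at \<eta>) a = ?g \<eta> (cov V V \<eta> a) (Z \<eta>) + ?g \<eta> (V \<eta>) (cov V Z \<eta> a)"
    if "\<eta> \<in> T" for \<eta> a
    unfolding h_def
    using fd_eqI[OF metric_has_derivative[OF T(1) that adm smooth_on_differentiable[OF sm(1) that]
        smooth_on_differentiable[OF sm(1) that] smooth_on_differentiable[OF sm(4) that]]]
      C_y2[OF adm[OF that]] by simp
  \<comment> \<open>The first-order terms on the left stem from the moving direction
    \<open>Y\<close>; after antisymmetrising they form the bracket term of the curvature.\<close>
  have second: "frechet_derivative (\<lambda>w. frechet_derivative h (at w) (Y \<xi>)) (at \<xi>) (X \<xi>)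
      + ?g \<xi> (cov V V \<xi> (frechet_derivative Y (at \<xi>) (X \<xi>))) (Z \<xi>)
      + ?g \<xi> (V \<xi>) (cov V Z \<xi> (frechet_derivative Y (at \<xi>) (X \<xi>)))
     = ?g \<xi> (cov V (\<lambda>\<xi>. cov V V \<xi> (Y \<xi>)) \<xi> (X \<xi>)) (Z \<xi>)
     + ?g \<xi> (cov V V \<xi> (Y \<xi>)) (cov V Z \<xi> (X \<xi>))
     + ?g \<xi> (cov V V \<xi> (X \<xi>)) (cov V Z \<xi> (Y \<xi>))
     + ?g \<xi> (V \<xi>) (cov V (\<lambda>\<xi>. cov V Z \<xi> (Y \<xi>)) \<xi> (X \<xi>))
     + 2 * C ?z (cov V V \<xi> (X \<xi>)) (cov V V \<xi> (Y \<xi>)) (Z \<xi>)"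
    if sX: "smooth_on T X" and sY: "smooth_on T Y" for X Y
  proof -
    let ?VY = "\<lambda>\<xi>. cov V V \<xi> (Y \<xi>)" and ?ZY = "\<lambda>\<xi>. cov V Z \<xi> (Y \<xi>)"
    have smVY: "smooth_on T ?VY" "smooth_on T ?ZY"
      using T adm sm sY by (auto intro: smooth_on_cov)
    have "((\<lambda>\<eta>. frechet_derivative h (at \<eta>) (Y \<eta>)) has_derivative
      (\<lambda>k. frechet_derivative (\<lambda>w. frechet_derivative h (at w) (Y \<xi>)) (at \<xi>) k
         + frechet_derivative h (at \<xi>) (frechet_derivative Y (at \<xi>) k))) (at \<xi>)"
      by (intro has_derivative_fd_field[OF T(1) smh T(2)] smooth_on_has_derivative[OF sY T(2)])
    note 1 = fd_eqI[OF this]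
    have "((\<lambda>\<eta>. ?g \<eta> (?VY \<eta>) (Z \<eta>) + ?g \<eta> (V \<eta>) (?ZY \<eta>)) has_derivative
      (\<lambda>a. (?g \<xi> (cov V ?VY \<xi> a) (Z \<xi>) + ?g \<xi> (?VY \<xi>) (cov V Z \<xi> a) + 2 * C ?z (cov V V \<xi> a) (?VY \<xi>) (Z \<xi>))
        + (?g \<xi> (cov V V \<xi> a) (?ZY \<xi>) + ?g \<xi> (V \<xi>) (cov V ?ZY \<xi> a) + 2 * C ?z (cov V V \<xi> a) (V \<xi>) (?ZY \<xi>)))) (at \<xi>)"
      using sm smVY df by (intro has_derivative_add metric_has_derivative[OF T adm]) auto
    note 2 = fd_eqI[OF this]
    have "frechet_derivative (\<lambda>\<eta>. frechet_derivative h (at \<eta>) (Y \<eta>)) (at \<xi>)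
      = frechet_derivative (\<lambda>\<eta>. ?g \<eta> (?VY \<eta>) (Z \<eta>) + ?g \<eta> (V \<eta>) (?ZY \<eta>)) (at \<xi>)"
      by (rule fd_cong[OF T]) (rule fdh)
    from fun_cong[OF this, of "X \<xi>"] show ?thesis
      unfolding 1 2 fdh[OF T(2)] using C_y2[OF z] by simp
  qed
  have comm: "frechet_derivative (\<lambda>w. frechet_derivative h (at w) (Y \<xi>)) (at \<xi>) (X \<xi>)
     = frechet_derivative (\<lambda>w. frechet_derivative h (at w) (X \<xi>)) (at \<xi>) (Y \<xi>)"
    by (rule fd_fd_commute[OF T(1) smh T(2)])
  have C: "C ?z (cov V V \<xi> (X \<xi>)) (cov V V \<xi> (Y \<xi>)) (Z \<xi>) = C ?z (cov V V \<xi> (Y \<xi>)) (cov V V \<xi> (X \<xi>)) (Z \<xi>)"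
    by (rule C_sym12[OF z])
  have lin: "linear (cov V V \<xi>)" "linear (cov V Z \<xi>)"
    using linear_cov z sm df by auto
  show ?thesis
    using second[OF sm(2,3)] second[OF sm(3,2)] comm C
    unfolding Rm_def by (simp add: linear_diff[OF lin(1)] linear_diff[OF lin(2)]
      linear_diff[OF linear_g1[OF z]] linear_diff[OF linear_g2[OF z]])
qed

text \<open>Since the fibre coordinate follows \<open>V\<close>, the coefficients of \<Gamma> are
  differentiated in the direction \<open>(a, dV a)\<close>; the other terms come from moving
  arguments.\<close>

lemma cov_cov:
  assumes T: "open T" "\<xi> \<in> T" and adm: "\<And>\<xi>. \<xi> \<in> T \<Longrightarrow> (\<xi>, V \<xi>) \<in> W"
    and sm: "smooth_on T V" "smooth_on T Y" "smooth_on T Z"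
  shows "cov V (\<lambda>\<xi>. cov V Z \<xi> (Y \<xi>)) \<xi> a =
    frechet_derivative (\<lambda>w. frechet_derivative Z (at w) (Y \<xi>)) (at \<xi>) a
    + frechet_derivative Z (at \<xi>) (frechet_derivative Y (at \<xi>) a)
    + frechet_derivative (\<lambda>w. Gm w (Y \<xi>) (Z \<xi>)) (at (\<xi>, V \<xi>)) (a, frechet_derivative V (at \<xi>) a)
    + Gm (\<xi>, V \<xi>) (frechet_derivative Y (at \<xi>) a) (Z \<xi>)
    + Gm (\<xi>, V \<xi>) (Y \<xi>) (frechet_derivative Z (at \<xi>) a)
    + Gm (\<xi>, V \<xi>) a (frechet_derivative Z (at \<xi>) (Y \<xi>))
    + Gm (\<xi>, V \<xi>) a (Gm (\<xi>, V \<xi>) (Y \<xi>) (Z \<xi>))"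
proof -
  let ?z = "(\<xi>, V \<xi>)"
  let ?D = "\<lambda>X. frechet_derivative X (at \<xi>)"
  have z: "?z \<in> W" using T adm by blast
  note hd = smooth_on_has_derivative[OF _ T(2)]
  have zd: "((\<lambda>\<xi>. (\<xi>, V \<xi>)) has_derivative (\<lambda>a. (a, ?D V a))) (at \<xi>)"
    by (intro has_derivative_Pair has_derivative_ident hd sm)
  have 0: "((\<lambda>\<xi>. Gm (\<xi>, V \<xi>) b c) has_derivative
     (\<lambda>a. frechet_derivative (\<lambda>w. Gm w b c) (at ?z) (a, ?D V a))) (at \<xi>)" for b c
    using has_derivative_compose[OF zd smooth_on_has_derivative[OF smooth_Gm z]] .
  have 1: "((\<lambda>\<xi>. Gm (\<xi>, V \<xi>) (Y \<xi>) c) has_derivative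
     (\<lambda>a. frechet_derivative (\<lambda>w. Gm w (Y \<xi>) c) (at ?z) (a, ?D V a) + Gm ?z (?D Y a) c)) (at \<xi>)" for c
    using has_derivative_linear_family[OF T, where F = "\<lambda>\<xi> b. Gm (\<xi>, V \<xi>) b c" and A = Y,
        OF linear_Gm1[OF adm] differentiableI[OF 0] hd[OF sm(2)]]
    by (simp add: fd_eqI[OF 0])
  have 2: "((\<lambda>\<xi>. Gm (\<xi>, V \<xi>) (Y \<xi>) (Z \<xi>)) has_derivative
     (\<lambda>a. frechet_derivative (\<lambda>w. Gm w (Y \<xi>) (Z \<xi>)) (at ?z) (a, ?D V a)
        + Gm ?z (?D Y a) (Z \<xi>) + Gm ?z (Y \<xi>) (?D Z a))) (at \<xi>)"
    using has_derivative_linear_family[OF T, where F = "\<lambda>\<xi> c. Gm (\<xi>, V \<xi>) (Y \<xi>) c" and A = Z,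
        OF linear_Gm2[OF adm] differentiableI[OF 1] hd[OF sm(3)]]
    by (simp add: fd_eqI[OF 1])
  have "((\<lambda>\<xi>. cov V Z \<xi> (Y \<xi>)) has_derivative (\<lambda>a.
      (frechet_derivative (\<lambda>w. frechet_derivative Z (at w) (Y \<xi>)) (at \<xi>) a + ?D Z (?D Y a))
      + (frechet_derivative (\<lambda>w. Gm w (Y \<xi>) (Z \<xi>)) (at ?z) (a, ?D V a)
        + Gm ?z (?D Y a) (Z \<xi>) + Gm ?z (Y \<xi>) (?D Z a)))) (at \<xi>)"
    unfolding cov_def
    by (intro has_derivative_add 2 has_derivative_fd_field[OF T(1) sm(3) T(2)] hd sm)
  note fd_eqI[OF this]
  then show ?thesis
    unfolding cov_def[of V "\<lambda>\<xi>. cov V Z \<xi> (Y \<xi>)"]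
    by (simp only:) (simp add: cov_def[of V Z] linear_add[OF linear_Gm2[OF z]])
qed

section \<open>Comparison with the \<open>hh\<close>-curvature\<close>

lemma linear_fd_Gm: "z \<in> W \<Longrightarrow> linear (frechet_derivative (\<lambda>w. Gm w a b) (at z))"
  by (rule linear_fd[OF smooth_Gm])

lemma Rm_eq_hh:
  assumes T: "open T" "\<xi> \<in> T" and adm: "\<And>\<xi>. \<xi> \<in> T \<Longrightarrow> (\<xi>, V \<xi>) \<in> W"
    and sm: "smooth_on T V" "smooth_on T X" "smooth_on T Y" "smooth_on T Z"
  shows "Rm V X Y Z \<xi> = hh (\<xi>, V \<xi>) (X \<xi>) (Y \<xi>) (Z \<xi>)
    + frechet_derivative (\<lambda>w. Gm w (Y \<xi>) (Z \<xi>)) (at (\<xi>, V \<xi>)) (0, cov V V \<xi> (X \<xi>))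
    - frechet_derivative (\<lambda>w. Gm w (X \<xi>) (Z \<xi>)) (at (\<xi>, V \<xi>)) (0, cov V V \<xi> (Y \<xi>))"
proof -
  let ?z = "(\<xi>, V \<xi>)"
  have z: "?z \<in> W" using T adm by blast
  \<comment> \<open>By \<open>Gm_y\<close> the derivative of \<open>V\<close> is
    \<open>\<nabla>V - N\<close>: the section \<open>V\<close> moves along the horizontal lift of
    \<open>a\<close> plus a vertical vector. The horizontal part builds \<open>hh\<close>, the
    vertical part is the correction.\<close>
  have split: "frechet_derivative (\<lambda>w. Gm w b c) (at ?z) (a, frechet_derivative V (at \<xi>) a)
     = frechet_derivative (\<lambda>w. Gm w b c) (at ?z) (a, 0)
      + frechet_derivative (\<lambda>w. Gm w b c) (at ?z) (0, cov V V \<xi> a)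
      - frechet_derivative (\<lambda>w. Gm w b c) (at ?z) (0, N ?z a)" for a b c
  proof -
    have "(a, frechet_derivative V (at \<xi>) a) = (a, 0) + (0, cov V V \<xi> a) - (0, N ?z a)"
      using Gm_y[OF z, of a] by (simp add: cov_def)
    then show ?thesis
      by (simp only: linear_add[OF linear_fd_Gm[OF z]] linear_diff[OF linear_fd_Gm[OF z]])
  qed
  have comm: "frechet_derivative (\<lambda>w. frechet_derivative Z (at w) (Y \<xi>)) (at \<xi>) (X \<xi>)
     = frechet_derivative (\<lambda>w. frechet_derivative Z (at w) (X \<xi>)) (at \<xi>) (Y \<xi>)"
    by (rule fd_fd_commute[OF T(1) sm(4) T(2)])
  show ?thesis
    unfolding Rm_def
    by (simp only: cov_cov[OF T adm sm(1,3,4)] cov_cov[OF T adm sm(1,2,4)] split)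
       (simp add: hh_def cov_def[of V Z] comm linear_diff[OF linear_fd[OF sm(4) T(2)]]
      linear_diff[OF linear_Gm1[OF z]] linear_diff[OF linear_Gm2[OF z]] Gm_sym[OF z])
qed

theorem curvature_eq_flag:
  assumes T: "open T" "\<xi> \<in> T" and adm: "\<And>\<xi>. \<xi> \<in> T \<Longrightarrow> (\<xi>, V \<xi>) \<in> W"
    and sm: "smooth_on T V" "smooth_on T U" "smooth_on T U'"
    and geo: "cov V V \<xi> (V \<xi>) = 0" and eq: "U' \<xi> = U \<xi>"
  shows "g (\<xi>, V \<xi>) (Rm V V U U' \<xi>) (V \<xi>) = g (\<xi>, V \<xi>) (hh (\<xi>, V \<xi>) (U \<xi>) (V \<xi>) (V \<xi>)) (U \<xi>)"
proof -
  let ?z = "(\<xi>, V \<xi>)"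
  have z: "?z \<in> W" using T adm by blast
  \<comment> \<open>Of the two corrections, one vanishes by \<open>geo\<close>; in the other
    \<Gamma> is contracted twice with the flagpole, so \<open>fd_Gm_yy\<close> applies.\<close>
  have "Rm V V U V \<xi> = hh ?z (V \<xi>) (U \<xi>) (V \<xi>)"
    using Rm_eq_hh[OF T adm sm(1,1,2,1)] geo fd_Gm_yy[OF z, of "cov V V \<xi> (U \<xi>)"]
      linear_0[OF linear_fd_Gm[OF z]] by (simp flip: zero_prod_def)
  also have "\<dots> = - hh ?z (U \<xi>) (V \<xi>) (V \<xi>)"
    by (simp add: hh_def)
  finally have "g ?z (V \<xi>) (Rm V V U U' \<xi>) = g ?z (hh ?z (U \<xi>) (V \<xi>) (V \<xi>)) (U \<xi>)"
    using curvature_antisym[OF T adm sm(1,1,2,3)] eq by (simp add: linear_neg[OF linear_g1[OF z]])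
  then show ?thesis
    by (simp add: g_sym[OF z, of _ "V \<xi>"])
qed

text \<open>\<open>t\<close> is the difference of two torsion-free, almost metric connections.\<close>

lemma difference_zero:
  assumes z: "z \<in> W" and V: "V \<in> F" "e V = snd z" and surj: "\<And>w. \<exists>Z\<in>F. e Z = w"
    and sym: "\<And>X Y. X \<in> F \<Longrightarrow> Y \<in> F \<Longrightarrow> t X Y = t Y X"
    and metric: "\<And>X Y Z. X \<in> F \<Longrightarrow> Y \<in> F \<Longrightarrow> Z \<in> F \<Longrightarrow>
      g z (t X Y) (e Z) + g z (e Y) (t X Z) + 2 * C z (t X V) (e Y) (e Z) = 0"
    and X: "X \<in> F" and Y: "Y \<in> F"
  shows "t X Y = 0"
proof -
  have zeroI: "a = 0" if "\<And>Z. Z \<in> F \<Longrightarrow> g z a (e Z) = 0" for a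
  proof (rule nondegenerate[OF z])
    fix b
    show "g z a b = g z 0 b"
      using surj[of b] that linear_0[OF linear_g1[OF z]] by auto
  qed
  \<comment> \<open>Compatibility with both arguments \<open>V\<close>: the Cartan term vanishes and
    the two pairings coincide.\<close>
  have gy: "g z (e V) (t X V) = 0" if "X \<in> F" for X
    using metric[OF that V(1) V(1)] V(2) C_y2[OF z] g_sym[OF z, of "t X V"] by simp
  have b: "g z (t X V) (e Z) = - g z (e V) (t X Z)" if "X \<in> F" "Z \<in> F" for X Z
    using metric[OF that(1) V(1) that(2)] V(2) C_y2[OF z] by simp
  have VV: "t V V = 0"
    by (rule zeroI) (use b[OF V(1)] gy sym[OF V(1)] in simp)
  \<comment> \<open>As a form in \<open>X\<close> and \<open>Z\<close>,
    \<open>g z (t X V) (e Z)\<close> is symmetric by \<open>b\<close>, and skew by compatibility in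
    direction \<open>V\<close>, where \<open>VV\<close> removes the Cartan term.\<close>
  have XV: "t X V = 0" if X: "X \<in> F" for X
  proof (rule zeroI)
    fix Z assume Z: "Z \<in> F"
    have "g z (t V X) (e Z) + g z (e X) (t V Z) = 0"
      using metric[OF V(1) X Z] VV linear_0[OF linear_C1[OF z]] by simp
    moreover have "g z (t X V) (e Z) = g z (t Z V) (e X)"
      using b[OF X Z] b[OF Z X] sym[OF X Z] by simp
    ultimately show "g z (t X V) (e Z) = 0"
      using sym[OF V(1) X] sym[OF V(1) Z] g_sym[OF z, of "e X"] by simp
  qed
  \<comment> \<open>With the Cartan terms gone, the uniqueness argument for the Levi-Civita
    connection remains: symmetric in the first two slots and skew in the last two.\<close>
  have d: "g z (t X Y) (e Z) = - g z (t X Z) (e Y)" if "X \<in> F" "Y \<in> F" "Z \<in> F" for X Y Z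
    using metric[OF that] XV[OF that(1)] linear_0[OF linear_C1[OF z]] g_sym[OF z, of "e Y"] by simp
  show ?thesis
  proof (rule zeroI)
    fix Z assume Z: "Z \<in> F"
    show "g z (t X Y) (e Z) = 0"
      using d[OF X Y Z] d[OF Z X Y] d[OF Y Z X]
      unfolding sym[OF Y X] sym[OF Z X] sym[OF Z Y] by linarith
  qed
qed

section \<open>Multilinearity of the \<open>hh\<close>-curvature; rules for the covariant
  derivative\<close>

lemma linear_hh:
  assumes z: "z \<in> W"
  shows "linear (\<lambda>a. hh z a b c)" "linear (\<lambda>b. hh z a b c)" "linear (\<lambda>c. hh z a b c)"
proof -
  have fd1: "linear (\<lambda>a. frechet_derivative (\<lambda>w. Gm w a c) (at z) k)" for c k
    by (rule linear_fd_family[OF openW z, where F = "\<lambda>w a. Gm w a c"]) (auto intro: linear_Gm1 Gm_differentiable[OF z])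
  have fd2: "linear (\<lambda>c. frechet_derivative (\<lambda>w. Gm w a c) (at z) k)" for a k
    by (rule linear_fd_family[OF openW z, where F = "\<lambda>w c. Gm w a c"]) (auto intro: linear_Gm2 Gm_differentiable[OF z])
  have fdx: "linear (\<lambda>a. frechet_derivative (\<lambda>w. Gm w b c) (at z) (a, 0))" for b c
    using linear_compose[OF linear_inl linear_fd_Gm[OF z]] by (simp add: o_def)
  have fdN: "linear (\<lambda>a. frechet_derivative (\<lambda>w. Gm w b c) (at z) (0, N z a))" for b c
    using linear_compose[OF linear_compose[OF linear_N[OF z] linear_inr] linear_fd_Gm[OF z]] by (simp add: o_def)
  have G1: "linear (\<lambda>a. Gm z (f a) b)" if "linear f" for f :: "real ^ 'n \<Rightarrow> real ^ 'n" and b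
    using linear_compose[OF that linear_Gm1[OF z]] by (simp add: o_def)
  have G2: "linear (\<lambda>b. Gm z a (f b))" if "linear f" for f :: "real ^ 'n \<Rightarrow> real ^ 'n" and a
    using linear_compose[OF that linear_Gm2[OF z]] by (simp add: o_def)
  show "linear (\<lambda>a. hh z a b c)" "linear (\<lambda>b. hh z a b c)" "linear (\<lambda>c. hh z a b c)"
    unfolding hh_def
    by (intro linear_compose_add linear_compose_sub fd1 fd2 fdx fdN G2 linear_Gm1[OF z] linear_Gm2[OF z])+
qed

lemma hh_expand:
  assumes z: "z \<in> W"
  shows "hh z a b c = (\<Sum>j\<in>UNIV. \<Sum>k\<in>UNIV. \<Sum>m\<in>UNIV.
    (c $ j * a $ k * b $ m) *\<^sub>R hh z (axis k 1) (axis m 1) (axis j 1))"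
proof -
  have ex: "f x = (\<Sum>i\<in>UNIV. x $ i *\<^sub>R f (axis i 1))" if "linear f" for f :: "real ^ 'n \<Rightarrow> real ^ 'n" and x
    by (subst vec_eq_sum_axis[of x]) (simp add: linear_sum[OF that] linear_scale[OF that])
  show ?thesis
    by (subst ex[OF linear_hh(3)[OF z]], subst ex[OF linear_hh(1)[OF z]], subst ex[OF linear_hh(2)[OF z]])
       (simp add: scaleR_sum_right mult.assoc)
qed

lemma cov_add:
  assumes "Y differentiable (at \<xi>)" "Y' differentiable (at \<xi>)" "(\<xi>, V \<xi>) \<in> W"
  shows "cov V (\<lambda>\<xi>. Y \<xi> + Y' \<xi>) \<xi> a = cov V Y \<xi> a + cov V Y' \<xi> a"
  unfolding cov_def fd_eqI[OF has_derivative_add[OF fd_works[OF assms(1)] fd_works[OF assms(2)]]]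
  by (simp add: linear_add[OF linear_Gm2[OF assms(3)]])

lemma cov_scaleR:
  assumes "f differentiable (at \<xi>)" "Y differentiable (at \<xi>)" "(\<xi>, V \<xi>) \<in> W"
  shows "cov V (\<lambda>\<xi>. f \<xi> *\<^sub>R Y \<xi>) \<xi> a = f \<xi> *\<^sub>R cov V Y \<xi> a + frechet_derivative f (at \<xi>) a *\<^sub>R Y \<xi>"
  unfolding cov_def fd_eqI[OF has_derivative_scaleR[OF fd_works[OF assms(1)] fd_works[OF assms(2)]]]
  by (simp add: linear_scale[OF linear_Gm2[OF assms(3)]] algebra_simps)

lemma cov_commutator:
  assumes "(\<xi>, V \<xi>) \<in> W"
  shows "cov V Y \<xi> (X \<xi>) - cov V X \<xi> (Y \<xi>)
    = frechet_derivative Y (at \<xi>) (X \<xi>) - frechet_derivative X (at \<xi>) (Y \<xi>)"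
  using Gm_sym[OF assms, of "X \<xi>"] by (simp add: cov_def)

end

section \<open>Bump functions\<close>

text \<open>\<open>flat 0\<close> is the classical flat function. The powers of
  \<open>inverse t\<close> close the family under differentiation up to linear combinations, so that
  one induction proves smoothness for all \<open>k\<close> together.\<close>

definition flat :: "nat \<Rightarrow> real \<Rightarrow> real" where
  "flat k t = (if t > 0 then inverse t ^ k * exp (- inverse t) else 0)"

lemma flat_has_derivative:
  "(flat k has_real_derivative (flat (k + 2) t - real k * flat (k + 1) t)) (at t)"
proof (cases t "0 :: real" rule: linorder_cases)
  case less
  have "((\<lambda>_. 0 :: real) has_real_derivative 0) (at t)"
    by simp
  then have "(flat k has_real_derivative 0) (at t)"
    by (rule has_field_derivative_transform_within_open[where S = "{..<0}"])
       (use less in \<open>auto simp: flat_def\<close>)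
  then show ?thesis
    using less by (simp add: flat_def)
next
  case greater
  have "((\<lambda>t. inverse t ^ k * exp (- inverse t)) has_real_derivative
     (inverse t ^ (k + 2) * exp (- inverse t) - real k * (inverse t ^ (k + 1) * exp (- inverse t)))) (at t)"
  proof -
    have "((\<lambda>t. inverse t ^ k) has_real_derivative - (real k * inverse t ^ (k + 1))) (at t)"
    proof (cases k)
      case (Suc n)
      show ?thesis
        unfolding Suc
        using DERIV_power_Suc[OF DERIV_inverse[OF less_imp_neq[OF greater, symmetric]], of n]
        by (simp add: numeral_2_eq_2 algebra_simps)
    qed simp
    moreover have "((\<lambda>t. exp (- inverse t)) has_real_derivative inverse t ^ 2 * exp (- inverse t)) (at t)"
      using greater by (auto intro!: derivative_eq_intros simp: power2_eq_square)
    ultimately show ?thesis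
      by (rule DERIV_cong[OF DERIV_mult]) (simp add: power_add power2_eq_square algebra_simps)
  qed
  then have "(flat k has_real_derivative
     (inverse t ^ (k + 2) * exp (- inverse t) - real k * (inverse t ^ (k + 1) * exp (- inverse t)))) (at t)"
    by (rule has_field_derivative_transform_within_open[where S = "{0<..}"])
       (use greater in \<open>auto simp: flat_def\<close>)
  then show ?thesis
    using greater by (simp add: flat_def)
next
  case equal
  \<comment> \<open>With \<open>x = inverse h\<close> this is the difference quotient of
    \<open>flat k\<close> at 0 from the right.\<close>
  have "((\<lambda>x :: real. x ^ (k + 1) / exp x) \<longlongrightarrow> 0) at_top"
    by (rule tendsto_power_div_exp_0)
  then have "((\<lambda>h :: real. inverse h ^ (k + 1) / exp (inverse h)) \<longlongrightarrow> 0) (at_right 0)"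
    by (rule filterlim_compose) (rule filterlim_inverse_at_top_right)
  moreover have "eventually (\<lambda>h. inverse h ^ (k + 1) / exp (inverse h) = flat k h / h) (at_right (0 :: real))"
    unfolding eventually_at_right_field by (auto simp: flat_def exp_minus field_simps intro!: exI[of _ 1])
  ultimately have "((\<lambda>h. flat k h / h) \<longlongrightarrow> 0) (at_right 0)"
    by (rule Lim_transform_eventually)
  moreover have "((\<lambda>h. flat k h / h) \<longlongrightarrow> 0) (at_left 0)"
    by (rule tendsto_eventually) (auto simp: eventually_at_left_field flat_def intro!: exI[of _ "-1"])
  ultimately have "((\<lambda>h. flat k h / h) \<longlongrightarrow> 0) (at 0)"
    by (rule filterlim_split_at[rotated])
  then show ?thesis
    using equal by (simp add: DERIV_def flat_def[of k 0] flat_def[of "k + 2" 0] flat_def[of "Suc k" 0]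
      flat_def[of "Suc (Suc k)" 0])
qed

lemma Ck_on_flat: "Ck_on n UNIV (flat k)"
proof (induction n arbitrary: k)
  case 0
  show ?case
    using DERIV_isCont[OF flat_has_derivative] by (auto intro!: continuous_at_imp_continuous_on)
next
  case (Suc n)
  have d: "(flat k has_derivative (\<lambda>h. (flat (k + 2) t - real k * flat (k + 1) t) * h)) (at t)" for t
    using flat_has_derivative[of k t] by (simp add: has_field_derivative_def)
  have "Ck_on n UNIV (\<lambda>t. (flat (k + 2) t + (- real k) * flat (k + 1) t) * h)" for h
    by (intro Ck_on_bilinear[OF bounded_bilinear_mult] Ck_on_add Ck_on_const Suc open_UNIV)
  then show ?case
    using d by (auto simp: fd_eqI[OF d] intro: differentiableI)
qed

lemma bump_exists:
  fixes a :: "'a::euclidean_space"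
  assumes "r > 0"
  obtains \<phi> :: "'a \<Rightarrow> real" where "smooth_on UNIV \<phi>" "\<phi> a = 1" "\<And>x. x \<notin> cball a r \<Longrightarrow> \<phi> x = 0"
proof
  \<comment> \<open>The squared distance keeps the inner function smooth at the centre, where the
    norm is not; the denominator normalises the value there.\<close>
  let ?\<phi> = "\<lambda>x. flat 0 (r\<^sup>2 - (x - a) \<bullet> (x - a)) / flat 0 (r\<^sup>2)"
  have pos: "flat 0 (r\<^sup>2) \<noteq> 0"
    using assms by (simp add: flat_def)
  have "smooth_on UNIV (\<lambda>x. flat 0 (r\<^sup>2 - (x - a) \<bullet> (x - a)))"
    by (rule smooth_on_compose[of UNIV UNIV])
       (auto intro!: smooth_on_diff smooth_on_inner smooth_on_const smooth_on_ident
         simp: smooth_on_def[of _ "flat 0"] Ck_on_flat)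
  then show "smooth_on UNIV ?\<phi>"
    using pos by (intro smooth_on_divide smooth_on_const) auto
  show "?\<phi> a = 1"
    using pos by simp
  fix x assume "x \<notin> cball a r"
  then have "r\<^sup>2 < (norm (x - a))\<^sup>2"
    using assms by (intro power_strict_mono) (auto simp: dist_norm norm_minus_commute)
  then show "?\<phi> x = 0"
    by (simp add: flat_def power2_norm_eq_inner)
qed

section \<open>Tangent vectors and vector fields in charts\<close>

lemmas comp_simps [simp] = zero_tvec.rep_eq plus_tvec.rep_eq minus_tvec.rep_eq uminus_tvec.rep_eq
  scaleR_tvec.rep_eq

lemma tvec_eqI: "(\<And>c. comp v c = comp w c) \<Longrightarrow> v = w"
  by (metis comp_inject ext)

definition rep :: "('m, 'n::finite) chart \<Rightarrow> ('m \<Rightarrow> ('m, 'n) tvec) \<Rightarrow> real ^ 'n \<Rightarrow> real ^ 'n" where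
  "rep c X \<xi> = comp (X (inv_coords c \<xi>)) c"

locale manifold =
  fixes \<A> :: "('m::{t2_space, second_countable_topology}, 'n::finite) chart set"
  assumes manifold: "smooth_manifold \<A>"
begin

lemma chart: "c \<in> \<A> \<Longrightarrow> is_chart c"
  using manifold by (simp add: smooth_manifold_def)

lemma inv_coords_coords: "c \<in> \<A> \<Longrightarrow> x \<in> dom_of c \<Longrightarrow> inv_coords c (coords c x) = x"
  using chart homeomorphism_apply1 by (fastforce simp: is_chart_def)

lemma inv_coords_mem: "c \<in> \<A> \<Longrightarrow> S \<subseteq> dom_of c \<Longrightarrow> \<xi> \<in> coords c ` S \<Longrightarrow> inv_coords c \<xi> \<in> S"
  using inv_coords_coords by fastforce

lemma open_dom: "c \<in> \<A> \<Longrightarrow> open (dom_of c)"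
  using chart by (simp add: is_chart_def)

lemma open_coords_image: "c \<in> \<A> \<Longrightarrow> open S \<Longrightarrow> S \<subseteq> dom_of c \<Longrightarrow> open (coords c ` S)"
proof -
  assume c: "c \<in> \<A>" "open S" "S \<subseteq> dom_of c"
  have h: "homeomorphism (dom_of c) (coords c ` dom_of c) (coords c) (inv_coords c)"
    and o: "open (coords c ` dom_of c)"
    using chart[OF c(1)] by (auto simp: is_chart_def)
  have "openin (top_of_set (dom_of c)) S"
    using c open_dom by (simp add: openin_open_eq)
  from homeomorphism_imp_open_map[OF h this] show ?thesis
    using o openin_open_trans by blast
qed

lemma open_coords_image': "c \<in> \<A> \<Longrightarrow> open S \<Longrightarrow> open (coords c ` (dom_of c \<inter> S))"
  by (rule open_coords_image) (auto simp: open_dom)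

lemma continuous_inv_coords: "c \<in> \<A> \<Longrightarrow> continuous_on (coords c ` dom_of c) (inv_coords c)"
  using chart homeomorphism_cont2 by (fastforce simp: is_chart_def)

lemma continuous_coords: "c \<in> \<A> \<Longrightarrow> continuous_on (dom_of c) (coords c)"
  using chart homeomorphism_cont1 by (fastforce simp: is_chart_def)

lemma charts_at_iff: "c \<in> charts_at \<A> x \<longleftrightarrow> c \<in> \<A> \<and> x \<in> dom_of c"
  by (simp add: charts_at_def)

lemma chart_exists: "\<exists>c. c \<in> charts_at \<A> x"
proof -
  have "x \<in> (\<Union>c\<in>\<A>. dom_of c)"
    using manifold by (simp add: smooth_manifold_def)
  then show ?thesis
    by (auto simp: charts_at_iff)
qed

section \<open>Transition maps and tangent spaces\<close>

abbreviation trans where "trans c c' \<equiv> coords c' \<circ> inv_coords c"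

lemma smooth_trans: "c \<in> \<A> \<Longrightarrow> c' \<in> \<A> \<Longrightarrow> smooth_on (coords c ` (dom_of c \<inter> dom_of c')) (trans c c')"
  using manifold by (simp add: smooth_manifold_def smooth_transition_def)

lemma trans_has_derivative: "c \<in> charts_at \<A> x \<Longrightarrow> c' \<in> charts_at \<A> x \<Longrightarrow>
    (trans c c' has_derivative transition_deriv c c' x) (at (coords c x))"
  unfolding transition_deriv_def
  using smooth_on_has_derivative[OF smooth_trans[of c c'], of "coords c x"] by (auto simp: charts_at_iff)

lemma linear_transition: "c \<in> charts_at \<A> x \<Longrightarrow> c' \<in> charts_at \<A> x \<Longrightarrow> linear (transition_deriv c c' x)"
  using trans_has_derivative has_derivative_linear by blast

lemma trans_coords: "c \<in> charts_at \<A> x \<Longrightarrow> trans c c' (coords c x) = coords c' x"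
  by (simp add: charts_at_iff inv_coords_coords)

text \<open>The chain rule on the triple overlap; by it the family of components that
  \<open>tvec_of\<close> builds from one chart is a tangent vector.\<close>

lemma transition_cocycle:
  assumes "c \<in> charts_at \<A> x" "c' \<in> charts_at \<A> x" "c'' \<in> charts_at \<A> x"
  shows "transition_deriv c' c'' x (transition_deriv c c' x \<xi>) = transition_deriv c c'' x \<xi>"
proof -
  let ?S = "dom_of c \<inter> dom_of c' \<inter> dom_of c''"
  have "((\<lambda>\<xi>. trans c' c'' (trans c c' \<xi>)) has_derivative
      (\<lambda>\<xi>. transition_deriv c' c'' x (transition_deriv c c' x \<xi>))) (at (coords c x))"
    using has_derivative_compose[OF trans_has_derivative[OF assms(1,2)]] trans_has_derivative[OF assms(2,3)]
    by (simp only: trans_coords[OF assms(1)])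
  then have "(trans c c'' has_derivative
      (\<lambda>\<xi>. transition_deriv c' c'' x (transition_deriv c c' x \<xi>))) (at (coords c x))"
  proof (rule has_derivative_transform_within_open)
    show "open (coords c ` ?S)" "coords c x \<in> coords c ` ?S"
      using assms by (auto simp: charts_at_iff open_dom intro!: open_coords_image open_Int)
    fix \<eta> assume "\<eta> \<in> coords c ` ?S"
    then show "trans c' c'' (trans c c' \<eta>) = trans c c'' \<eta>"
      using assms by (auto simp: charts_at_iff inv_coords_coords)
  qed
  from fd_eqI[OF this] show ?thesis
    by (simp add: transition_deriv_def[of c c''])
qed

lemma transition_same: "c \<in> charts_at \<A> x \<Longrightarrow> transition_deriv c c x \<xi> = \<xi>"
proof -
  assume c: "c \<in> charts_at \<A> x"
  have "(trans c c has_derivative (\<lambda>h. h)) (at (coords c x))"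
    by (rule has_derivative_transform_within_open[OF has_derivative_ident, of "coords c ` dom_of c"])
       (use c in \<open>auto simp: charts_at_iff inv_coords_coords open_dom intro!: open_coords_image\<close>)
  then show ?thesis
    by (simp add: transition_deriv_def fd_eqI)
qed

lemma comp_tvec_of': "c' \<in> charts_at \<A> x \<Longrightarrow> comp (tvec_of \<A> c x \<xi>) c' = transition_deriv c c' x \<xi>"
  by (simp add: tvec_of_def Tvec_inverse)

lemma comp_tvec_of: "c \<in> charts_at \<A> x \<Longrightarrow> comp (tvec_of \<A> c x \<xi>) c = \<xi>"
  by (simp add: comp_tvec_of' transition_same)

lemma tangent_spaceI:
  "(\<And>c c'. c \<in> charts_at \<A> x \<Longrightarrow> c' \<in> charts_at \<A> x \<Longrightarrow>
      comp w c' = transition_deriv c c' x (comp w c)) \<Longrightarrow>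
    (\<And>c. c \<notin> charts_at \<A> x \<Longrightarrow> comp w c = 0) \<Longrightarrow> w \<in> tangent_space \<A> x"
  unfolding tangent_space_def by blast

lemma comp_transition: "w \<in> tangent_space \<A> x \<Longrightarrow> c \<in> charts_at \<A> x \<Longrightarrow> c' \<in> charts_at \<A> x \<Longrightarrow>
    comp w c' = transition_deriv c c' x (comp w c)"
  unfolding tangent_space_def by blast

lemma comp_outside: "w \<in> tangent_space \<A> x \<Longrightarrow> c \<notin> charts_at \<A> x \<Longrightarrow> comp w c = 0"
  unfolding tangent_space_def by blast

lemma tvec_of_in_tangent_space:
  assumes c: "c \<in> charts_at \<A> x"
  shows "tvec_of \<A> c x \<xi> \<in> tangent_space \<A> x"
proof (rule tangent_spaceI)
  fix c' c'' assume "c' \<in> charts_at \<A> x" "c'' \<in> charts_at \<A> x"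
  then show "comp (tvec_of \<A> c x \<xi>) c'' = transition_deriv c' c'' x (comp (tvec_of \<A> c x \<xi>) c')"
    using c by (simp only: comp_tvec_of' transition_cocycle)
next
  fix c' assume "c' \<notin> charts_at \<A> x"
  then show "comp (tvec_of \<A> c x \<xi>) c' = 0"
    by (simp add: tvec_of_def Tvec_inverse)
qed

text \<open>One chart determines the components in all charts around the point, and the others are 0
  by convention; so identities of tangent vectors may be checked in a single chart.\<close>

lemma tangent_eqI:
  assumes "v \<in> tangent_space \<A> x" "w \<in> tangent_space \<A> x" "c \<in> charts_at \<A> x" "comp v c = comp w c"
  shows "v = w"
proof (rule tvec_eqI)
  fix c'
  show "comp v c' = comp w c'"
  proof (cases "c' \<in> charts_at \<A> x")
    case True
    then show ?thesis
      using comp_transition[OF assms(1,3) True] comp_transition[OF assms(2,3) True] assms(4) by simp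
  next
    case False
    then show ?thesis
      using assms(1,2) comp_outside by simp
  qed
qed

lemma tvec_of_comp: "w \<in> tangent_space \<A> x \<Longrightarrow> c \<in> charts_at \<A> x \<Longrightarrow> tvec_of \<A> c x (comp w c) = w"
  by (rule tangent_eqI) (auto simp: tvec_of_in_tangent_space comp_tvec_of)

lemma tangent_space_add: "v \<in> tangent_space \<A> x \<Longrightarrow> w \<in> tangent_space \<A> x \<Longrightarrow> v + w \<in> tangent_space \<A> x"
proof (rule tangent_spaceI)
  fix c c' assume "v \<in> tangent_space \<A> x" "w \<in> tangent_space \<A> x"
    and c: "c \<in> charts_at \<A> x" "c' \<in> charts_at \<A> x"
  then have "comp v c' = transition_deriv c c' x (comp v c)" "comp w c' = transition_deriv c c' x (comp w c)"
    using comp_transition[OF _ c] by blast+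
  then show "comp (v + w) c' = transition_deriv c c' x (comp (v + w) c)"
    by (simp only: plus_tvec.rep_eq linear_add[OF linear_transition[OF c]])
qed (simp add: comp_outside)

lemma tangent_space_scaleR: "v \<in> tangent_space \<A> x \<Longrightarrow> r *\<^sub>R v \<in> tangent_space \<A> x"
proof (rule tangent_spaceI)
  fix c c' assume "v \<in> tangent_space \<A> x" and c: "c \<in> charts_at \<A> x" "c' \<in> charts_at \<A> x"
  then have "comp v c' = transition_deriv c c' x (comp v c)"
    using comp_transition[OF _ c] by blast
  then show "comp (r *\<^sub>R v) c' = transition_deriv c c' x (comp (r *\<^sub>R v) c)"
    by (simp only: scaleR_tvec.rep_eq linear_scale[OF linear_transition[OF c]])
qed (simp add: comp_outside)

lemma tangent_space_diff: "v \<in> tangent_space \<A> x \<Longrightarrow> w \<in> tangent_space \<A> x \<Longrightarrow> v - w \<in> tangent_space \<A> x"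
  using tangent_space_add[of v x "(-1) *\<^sub>R w"] tangent_space_scaleR[of w x "-1"] by simp

lemma tangent_space_zero: "0 \<in> tangent_space \<A> x"
  by (rule tangent_spaceI) (simp_all add: linear_0[OF linear_transition])

lemma tvec_of_add: "c \<in> charts_at \<A> x \<Longrightarrow> tvec_of \<A> c x (a + b) = tvec_of \<A> c x a + tvec_of \<A> c x b"
  by (rule tangent_eqI) (auto simp: tvec_of_in_tangent_space comp_tvec_of intro: tangent_space_add)

lemma tvec_of_scaleR: "c \<in> charts_at \<A> x \<Longrightarrow> tvec_of \<A> c x (r *\<^sub>R a) = r *\<^sub>R tvec_of \<A> c x a"
  by (rule tangent_eqI) (auto simp: tvec_of_in_tangent_space comp_tvec_of intro: tangent_space_scaleR)

subsection \<open>Vector fields\<close>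

lemma rep_coords: "c \<in> charts_at \<A> x \<Longrightarrow> rep c X (coords c x) = comp (X x) c"
  by (simp add: rep_def charts_at_iff inv_coords_coords)

lemma smooth_on_rep_change:
  assumes c: "c \<in> \<A>" "c' \<in> \<A>" and S: "open S" "S \<subseteq> dom_of c \<inter> dom_of c'"
    and X: "\<And>x. x \<in> S \<Longrightarrow> X x \<in> tangent_space \<A> x" and sm: "smooth_on (coords c ` S) (rep c X)"
  shows "smooth_on (coords c' ` S) (rep c' X)"
proof -
  have S': "S \<subseteq> dom_of c" "S \<subseteq> dom_of c'" using S by auto
  note o = open_coords_image[OF c(1) S(1) S'(1)] open_coords_image[OF c(2) S(1) S'(2)]
  have t: "smooth_on (coords c ` S) (trans c c')" "smooth_on (coords c' ` S) (trans c' c)"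
    by (rule smooth_on_subset[OF smooth_trans]; use c S in blast)+
  have "smooth_on (coords c ` S) (\<lambda>\<xi>. frechet_derivative (trans c c') (at \<xi>) (rep c X \<xi>))"
    by (intro smooth_on_fd_field o t sm)
  from smooth_on_compose[OF o(2,1) _ t(2) this]
  have "smooth_on (coords c' ` S)
     (\<lambda>\<eta>. frechet_derivative (trans c c') (at (trans c' c \<eta>)) (rep c X (trans c' c \<eta>)))"
    using S' inv_coords_mem[OF c(2) S'(2)] by auto
  then show ?thesis
  proof (subst smooth_on_cong[OF o(2)])
    fix \<eta> assume "\<eta> \<in> coords c' ` S"
    then obtain x where x: "x \<in> S" "\<eta> = coords c' x" by auto
    then have cx: "c \<in> charts_at \<A> x" "c' \<in> charts_at \<A> x"
      using c S' by (auto simp: charts_at_iff)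
    show "rep c' X \<eta> = frechet_derivative (trans c c') (at (trans c' c \<eta>)) (rep c X (trans c' c \<eta>))"
      using comp_transition[OF X[OF x(1)] cx]
      unfolding x(2) rep_coords[OF cx(2)] trans_coords[OF cx(2)] rep_coords[OF cx(1)]
      by (simp add: transition_deriv_def)
  qed
qed

lemma vector_fields_smooth: "X \<in> vector_fields \<A> \<Omega> \<Longrightarrow> c \<in> \<A> \<Longrightarrow> smooth_on (coords c ` (dom_of c \<inter> \<Omega>)) (rep c X)"
  by (simp add: vector_fields_def rep_def[abs_def])

lemma vector_fields_tangent: "X \<in> vector_fields \<A> \<Omega> \<Longrightarrow> x \<in> \<Omega> \<Longrightarrow> X x \<in> tangent_space \<A> x"
  by (simp add: vector_fields_def)

lemma vector_fields_zero: "X \<in> vector_fields \<A> \<Omega> \<Longrightarrow> x \<notin> \<Omega> \<Longrightarrow> X x = 0"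
  by (simp add: vector_fields_def)

text \<open>Smoothness in all charts follows from one suitable chart near each point, because
  components change by a smooth Jacobian.\<close>

lemma vector_fieldsI:
  assumes "\<And>x. x \<in> \<Omega> \<Longrightarrow> X x \<in> tangent_space \<A> x" "\<And>x. x \<notin> \<Omega> \<Longrightarrow> X x = 0"
    and loc: "\<And>x. x \<in> \<Omega> \<Longrightarrow> \<exists>c S. c \<in> \<A> \<and> open S \<and> x \<in> S \<and> S \<subseteq> dom_of c \<inter> \<Omega> \<and> smooth_on (coords c ` S) (rep c X)"
  shows "X \<in> vector_fields \<A> \<Omega>"
proof -
  have "smooth_on (coords c' ` (dom_of c' \<inter> \<Omega>)) (rep c' X)" if c': "c' \<in> \<A>" for c'
  proof (rule smooth_on_local)
    fix \<eta> assume "\<eta> \<in> coords c' ` (dom_of c' \<inter> \<Omega>)"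
    then obtain x where x: "x \<in> dom_of c'" "x \<in> \<Omega>" "\<eta> = coords c' x" by auto
    obtain c S where c: "c \<in> \<A>" "open S" "x \<in> S" "S \<subseteq> dom_of c \<inter> \<Omega>" "smooth_on (coords c ` S) (rep c X)"
      using loc[OF x(2)] by auto
    let ?S = "S \<inter> dom_of c'"
    have "smooth_on (coords c' ` ?S) (rep c' X)"
    proof (rule smooth_on_rep_change[OF c(1) c'])
      show "smooth_on (coords c ` ?S) (rep c X)"
        by (rule smooth_on_subset[OF c(5)]) blast
    qed (use c c' assms(1) in \<open>auto simp: open_dom\<close>)
    moreover have "open (coords c' ` ?S)"
      using c c' by (intro open_coords_image) (auto simp: open_dom)
    ultimately show "\<exists>T. open T \<and> \<eta> \<in> T \<and> smooth_on T (rep c' X)"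
      using x c(3) by blast
  qed
  then show ?thesis
    using assms by (simp add: vector_fields_def rep_def[abs_def])
qed

lemma vector_fieldsI_chart:
  assumes "c \<in> \<A>" "open \<Omega>" "\<Omega> \<subseteq> dom_of c" "\<And>x. x \<in> \<Omega> \<Longrightarrow> X x \<in> tangent_space \<A> x"
    "\<And>x. x \<notin> \<Omega> \<Longrightarrow> X x = 0" "smooth_on (coords c ` \<Omega>) (rep c X)"
  shows "X \<in> vector_fields \<A> \<Omega>"
proof (rule vector_fieldsI)
  fix x assume "x \<in> \<Omega>"
  then show "\<exists>c S. c \<in> \<A> \<and> open S \<and> x \<in> S \<and> S \<subseteq> dom_of c \<inter> \<Omega> \<and> smooth_on (coords c ` S) (rep c X)"
    using assms by (intro exI[of _ c] exI[of _ \<Omega>]) simp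
qed (use assms in auto)

lemma vector_fields_diff:
  assumes "open \<Omega>" "X \<in> vector_fields \<A> \<Omega>" "Y \<in> vector_fields \<A> \<Omega>"
  shows "(\<lambda>x. X x - Y x) \<in> vector_fields \<A> \<Omega>"
proof -
  have "smooth_on (coords c ` (dom_of c \<inter> \<Omega>)) (\<lambda>\<xi>. rep c X \<xi> - rep c Y \<xi>)" if "c \<in> \<A>" for c
    using that assms by (intro smooth_on_diff open_coords_image' vector_fields_smooth)
  then show ?thesis
    using assms by (simp add: vector_fields_def tangent_space_diff rep_def[abs_def])
qed

text \<open>Cut off a field with constant components. Its support lies in the compact set
  \<open>K\<close>, which is closed because the space is Hausdorff, so every point of \<Omega> has a
  neighbourhood in the chart or one off \<open>K\<close>, where the field is 0.\<close>

lemma vector_field_extension: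
  assumes "open \<Omega>" "p \<in> \<Omega>" "w \<in> tangent_space \<A> p"
  obtains Z where "Z \<in> vector_fields \<A> \<Omega>" "Z p = w"
proof -
  obtain c where c: "c \<in> charts_at \<A> p" using chart_exists by blast
  then have cA: "c \<in> \<A>" "p \<in> dom_of c" by (auto simp: charts_at_iff)
  let ?T = "coords c ` (dom_of c \<inter> \<Omega>)"
  have "open ?T" "coords c p \<in> ?T"
    using cA assms by (auto intro: open_coords_image')
  then obtain r where r: "r > 0" "cball (coords c p) r \<subseteq> ?T"
    using open_contains_cball by blast
  obtain \<phi> :: "real ^ 'n \<Rightarrow> real" where \<phi>: "smooth_on UNIV \<phi>" "\<phi> (coords c p) = 1"
    "\<And>x. x \<notin> cball (coords c p) r \<Longrightarrow> \<phi> x = 0"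
    using bump_exists[OF r(1)] by blast
  define K where "K = inv_coords c ` cball (coords c p) r"
  have "continuous_on (cball (coords c p) r) (inv_coords c)"
    using r(2) by (intro continuous_on_subset[OF continuous_inv_coords[OF cA(1)]]) auto
  then have "compact K"
    unfolding K_def by (rule compact_continuous_image) (rule compact_cball)
  then have K: "closed K" by (rule compact_imp_closed)
  have KT: "K \<subseteq> dom_of c \<inter> \<Omega>"
    unfolding K_def using r(2) inv_coords_mem[OF cA(1), of "dom_of c \<inter> \<Omega>"] by auto
  define Z where "Z x = (if x \<in> dom_of c \<inter> \<Omega> then tvec_of \<A> c x (\<phi> (coords c x) *\<^sub>R comp w c) else 0)" for x
  have Z0: "Z x = 0" if "x \<notin> K" for x
  proof (cases "x \<in> dom_of c \<inter> \<Omega>")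
    case True
    then have cx: "c \<in> charts_at \<A> x" using cA by (simp add: charts_at_iff)
    have "coords c x \<notin> cball (coords c p) r"
      using that True inv_coords_coords[OF cA(1)] unfolding K_def by (metis IntE image_eqI)
    then show ?thesis
      using True \<phi>(3) tvec_of_scaleR[OF cx, of 0] by (simp add: Z_def)
  next
    case False
    then show ?thesis by (auto simp: Z_def)
  qed
  have "Z \<in> vector_fields \<A> \<Omega>"
  proof (rule vector_fieldsI)
    fix x assume x: "x \<in> \<Omega>"
    show "Z x \<in> tangent_space \<A> x"
      using cA by (auto simp: Z_def tangent_space_zero charts_at_iff intro!: tvec_of_in_tangent_space)
    show "\<exists>c S. c \<in> \<A> \<and> open S \<and> x \<in> S \<and> S \<subseteq> dom_of c \<inter> \<Omega> \<and> smooth_on (coords c ` S) (rep c Z)"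
    proof (cases "x \<in> dom_of c")
      case True
      have "smooth_on ?T (\<lambda>\<xi>. \<phi> \<xi> *\<^sub>R comp w c)"
        using \<open>open ?T\<close> \<phi>(1) by (intro smooth_on_scaleR smooth_on_const) (auto intro: smooth_on_subset)
      then have "smooth_on ?T (rep c Z)"
      proof (subst smooth_on_cong[OF \<open>open ?T\<close>])
        fix \<xi> assume "\<xi> \<in> ?T"
        then obtain x where x: "x \<in> dom_of c \<inter> \<Omega>" "\<xi> = coords c x" by auto
        then have cx: "c \<in> charts_at \<A> x" using cA by (simp add: charts_at_iff)
        show "rep c Z \<xi> = \<phi> \<xi> *\<^sub>R comp w c"
          unfolding x(2) rep_coords[OF cx] using x by (simp add: Z_def comp_tvec_of[OF cx])
      qed
      then show ?thesis
        using True x cA assms(1) by (intro exI[of _ c] exI[of _ "dom_of c \<inter> \<Omega>"]) (auto simp: open_dom)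
    next
      case False
      obtain c' where c': "c' \<in> \<A>" "x \<in> dom_of c'"
        using chart_exists[of x] by (auto simp: charts_at_iff)
      let ?S = "dom_of c' \<inter> (\<Omega> - K)"
      have S: "open ?S"
        using c' assms(1) K by (auto simp: open_dom intro: open_Diff)
      have "rep c' Z \<xi> = 0" if "\<xi> \<in> coords c' ` ?S" for \<xi>
        using inv_coords_mem[OF c'(1) _ that] Z0 by (auto simp: rep_def)
      then have "smooth_on (coords c' ` ?S) (rep c' Z)"
        using smooth_on_cong[OF open_coords_image[OF c'(1) S], of "rep c' Z" "\<lambda>_. 0"]
        by (simp add: smooth_on_const)
      then show ?thesis
        using False x c' S KT by (intro exI[of _ c'] exI[of _ ?S]) auto
    qed
  qed (simp add: Z_def)
  moreover have "Z p = w"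
    using cA assms c \<phi>(2) by (simp add: Z_def tvec_of_comp)
  ultimately show thesis by (rule that)
qed

section \<open>Derivatives along fields and the Lie bracket\<close>

lemma deriv_along_eq:
  assumes c: "c \<in> charts_at \<A> x" and X: "X x \<in> tangent_space \<A> x"
    and f: "((f \<circ> inv_coords c) has_derivative f') (at (coords c x))"
  shows "deriv_along \<A> X f x = f' (comp (X x) c)"
proof -
  define c' where "c' = (SOME c. c \<in> charts_at \<A> x)"
  have c': "c' \<in> charts_at \<A> x"
    unfolding c'_def using chart_exists by (rule someI_ex)
  let ?S = "dom_of c \<inter> dom_of c'"
  \<comment> \<open>\<open>deriv_along\<close> works in an arbitrarily chosen chart
    \<open>c'\<close>; the chain rule on the overlap moves the computation to
    \<open>c\<close>.\<close>
  have "((\<lambda>\<xi>. (f \<circ> inv_coords c) (trans c' c \<xi>)) has_derivative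
      (\<lambda>\<xi>. f' (transition_deriv c' c x \<xi>))) (at (coords c' x))"
  proof (rule has_derivative_compose[OF trans_has_derivative[OF c' c]])
    show "((f \<circ> inv_coords c) has_derivative f') (at (trans c' c (coords c' x)))"
      unfolding trans_coords[OF c'] by (rule f)
  qed
  then have "((f \<circ> inv_coords c') has_derivative (\<lambda>\<xi>. f' (transition_deriv c' c x \<xi>))) (at (coords c' x))"
  proof (rule has_derivative_transform_within_open)
    show "open (coords c' ` ?S)" "coords c' x \<in> coords c' ` ?S"
      using c c' by (auto simp: charts_at_iff open_dom intro!: open_coords_image open_Int)
    fix \<eta> assume "\<eta> \<in> coords c' ` ?S"
    then show "(f \<circ> inv_coords c) (trans c' c \<eta>) = (f \<circ> inv_coords c') \<eta>"
      using c c' by (auto simp: charts_at_iff inv_coords_coords)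
  qed
  from fd_eqI[OF this] show ?thesis
    unfolding deriv_along_def Let_def c'_def[symmetric] comp_transition[OF X c' c] by simp
qed

lemma rep_has_derivative:
  assumes "open \<Omega>" "X \<in> vector_fields \<A> \<Omega>" "x \<in> \<Omega>" "c \<in> charts_at \<A> x"
  shows "(rep c X has_derivative (\<lambda>h. frechet_derivative (rep c X) (at (coords c x)) h)) (at (coords c x))"
  using assms by (intro smooth_on_has_derivative[OF vector_fields_smooth]) (auto simp: charts_at_iff)

lemma comp_lie_bracket:
  assumes "x \<in> \<Omega>" "c \<in> charts_at \<A> x"
  shows "comp (lie_bracket \<A> \<Omega> X Y x) c =
    frechet_derivative (rep c Y) (at (coords c x)) (comp (X x) c) -
    frechet_derivative (rep c X) (at (coords c x)) (comp (Y x) c)"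
  using assms by (simp add: lie_bracket_def Tvec_inverse rep_def[abs_def])

text \<open>The bracket is defined in each chart separately, so that tangency is a genuine claim. It
  allows the torsion of the connection constructed below to be checked in one chart.\<close>

lemma lie_bracket_tangent:
  assumes \<Omega>: "open \<Omega>" and X: "X \<in> vector_fields \<A> \<Omega>" and Y: "Y \<in> vector_fields \<A> \<Omega>" and x: "x \<in> \<Omega>"
  shows "lie_bracket \<A> \<Omega> X Y x \<in> tangent_space \<A> x"
proof -
  have "comp (lie_bracket \<A> \<Omega> X Y x) c' = transition_deriv c c' x (comp (lie_bracket \<A> \<Omega> X Y x) c)"
    if c: "c \<in> charts_at \<A> x" and c': "c' \<in> charts_at \<A> x" for c c'
  proof -
    let ?S = "dom_of c \<inter> dom_of c' \<inter> \<Omega>"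
    let ?D = "\<lambda>f. frechet_derivative f (at (coords c x))"
    let ?\<tau> = "trans c c'"
    have cA: "c \<in> \<A>" "c' \<in> \<A>" using c c' by (auto simp: charts_at_iff)
    have S: "open (coords c ` ?S)" "coords c x \<in> coords c ` ?S"
      using c c' x \<Omega> by (auto simp: charts_at_iff open_dom intro!: open_coords_image open_Int)
    have t: "smooth_on (coords c ` ?S) ?\<tau>"
      by (rule smooth_on_subset[OF smooth_trans[OF cA]]) auto
    text \<open>The chain rule for \<open>Z\<^sub>c\<^sub>' \<circ> \<tau> = D\<tau>(Z\<^sub>c)\<close>; the second derivative of \<open>\<tau>\<close> cancels in the
      bracket by symmetry.\<close>
    have key: "frechet_derivative (rep c' Z) (at (coords c' x)) (transition_deriv c c' x a)
        = ?D (\<lambda>\<eta>. frechet_derivative ?\<tau> (at \<eta>) (comp (Z x) c)) a + transition_deriv c c' x (?D (rep c Z) a)"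
      if Z: "Z \<in> vector_fields \<A> \<Omega>" for Z a
    proof -
      have "((\<lambda>\<xi>. rep c' Z (?\<tau> \<xi>)) has_derivative
        (\<lambda>a. frechet_derivative (rep c' Z) (at (coords c' x)) (transition_deriv c c' x a))) (at (coords c x))"
      proof (rule has_derivative_compose[OF trans_has_derivative[OF c c']])
        show "(rep c' Z has_derivative (\<lambda>a. frechet_derivative (rep c' Z) (at (coords c' x)) a))
            (at (trans c c' (coords c x)))"
          unfolding trans_coords[OF c] by (rule rep_has_derivative[OF \<Omega> Z x c'])
      qed
      note 1 = fd_eqI[OF this]
      have "((\<lambda>\<xi>. frechet_derivative ?\<tau> (at \<xi>) (rep c Z \<xi>)) has_derivative
        (\<lambda>a. ?D (\<lambda>\<eta>. frechet_derivative ?\<tau> (at \<eta>) (rep c Z (coords c x))) a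
           + ?D ?\<tau> (?D (rep c Z) a))) (at (coords c x))"
        by (rule has_derivative_fd_field[OF S(1) t S(2) rep_has_derivative[OF \<Omega> Z x c]])
      note 2 = fd_eqI[OF this]
      have "?D (\<lambda>\<xi>. rep c' Z (?\<tau> \<xi>)) = ?D (\<lambda>\<xi>. frechet_derivative ?\<tau> (at \<xi>) (rep c Z \<xi>))"
      proof (rule fd_cong[OF S])
        fix \<xi> assume "\<xi> \<in> coords c ` ?S"
        then obtain y where y: "y \<in> ?S" "\<xi> = coords c y" by auto
        then have cy: "c \<in> charts_at \<A> y" "c' \<in> charts_at \<A> y"
          using cA by (auto simp: charts_at_iff)
        show "rep c' Z (?\<tau> \<xi>) = frechet_derivative ?\<tau> (at \<xi>) (rep c Z \<xi>)"
          unfolding y(2) trans_coords[OF cy(1)] rep_coords[OF cy(1)] rep_coords[OF cy(2)]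
          using comp_transition[OF vector_fields_tangent[OF Z] cy] y(1) by (simp add: transition_deriv_def)
      qed
      from fun_cong[OF this, of a] show ?thesis
        unfolding 1 2 rep_coords[OF c] by (simp add: transition_deriv_def)
    qed
    have "?D (\<lambda>\<eta>. frechet_derivative ?\<tau> (at \<eta>) (comp (Y x) c)) (comp (X x) c)
       = ?D (\<lambda>\<eta>. frechet_derivative ?\<tau> (at \<eta>) (comp (X x) c)) (comp (Y x) c)"
      by (rule fd_fd_commute[OF S(1) t S(2)])
    then show ?thesis
      unfolding comp_lie_bracket[OF x c] comp_lie_bracket[OF x c'] linear_diff[OF linear_transition[OF c c']]
        comp_transition[OF vector_fields_tangent[OF X x] c c']
        comp_transition[OF vector_fields_tangent[OF Y x] c c'] key[OF X] key[OF Y]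
      by simp
  qed
  then show ?thesis
    by (rule tangent_spaceI) (simp_all add: lie_bracket_def Tvec_inverse)
qed

end

section \<open>The Chern connection in charts\<close>

locale finsler = manifold \<A> for \<A> :: "('m::{t2_space, second_countable_topology}, 'n::finite) chart set" +
  fixes A :: "('m \<times> ('m, 'n) tvec) set" and L :: "'m \<times> ('m, 'n) tvec \<Rightarrow> real"
  assumes finsler: "pseudo_finsler \<A> A L"
begin

lemma A_tangent: "(x, v) \<in> A \<Longrightarrow> v \<in> tangent_space \<A> x"
  using finsler by (auto simp: pseudo_finsler_def open_in_tangent_bundle_def tangent_bundle_def)

definition Wc where "Wc c = tcoords_image c A"
definition lc where "lc c = L \<circ> inv_tcoords \<A> c"

lemma inv_tcoords_coords: "c \<in> charts_at \<A> x \<Longrightarrow> v \<in> tangent_space \<A> x \<Longrightarrow>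
    inv_tcoords \<A> c (coords c x, comp v c) = (x, v)"
  by (simp add: inv_tcoords_def charts_at_iff inv_coords_coords tvec_of_comp)

lemma lc_coords: "c \<in> charts_at \<A> x \<Longrightarrow> v \<in> tangent_space \<A> x \<Longrightarrow> lc c (coords c x, comp v c) = L (x, v)"
  by (simp add: lc_def inv_tcoords_coords)

lemma Wc_cases:
  assumes "c \<in> \<A>" "(\<xi>, y) \<in> Wc c"
  obtains x v where "c \<in> charts_at \<A> x" "\<xi> = coords c x" "y = comp v c" "(x, v) \<in> A" "v \<in> tangent_space \<A> x"
  using assms A_tangent by (auto simp: Wc_def tcoords_image_def tcoords_def charts_at_iff)

lemma Wc_iff: "c \<in> charts_at \<A> x \<Longrightarrow> v \<in> tangent_space \<A> x \<Longrightarrow> (coords c x, comp v c) \<in> Wc c \<longleftrightarrow> (x, v) \<in> A"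
proof
  assume c: "c \<in> charts_at \<A> x" and v: "v \<in> tangent_space \<A> x"
  then have cA: "c \<in> \<A>" by (simp add: charts_at_iff)
  assume "(coords c x, comp v c) \<in> Wc c"
  then obtain x' v' where x': "c \<in> charts_at \<A> x'" "coords c x = coords c x'" "comp v c = comp v' c" "(x', v') \<in> A"
      "v' \<in> tangent_space \<A> x'"
    using Wc_cases[OF cA] by metis
  then have "x' = x"
    using c inv_coords_coords[OF cA] by (metis charts_at_iff)
  then show "(x, v) \<in> A"
    using x' tangent_eqI[OF v _ c] by metis
next
  assume "c \<in> charts_at \<A> x" "(x, v) \<in> A"
  then show "(coords c x, comp v c) \<in> Wc c"
    by (force simp: Wc_def tcoords_image_def tcoords_def charts_at_iff)
qed

lemma open_Wc: "c \<in> \<A> \<Longrightarrow> open (Wc c)"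
  using finsler by (simp add: Wc_def pseudo_finsler_def open_in_tangent_bundle_def)

lemma smooth_lc: "c \<in> \<A> \<Longrightarrow> smooth_on (Wc c) (lc c)"
  using finsler by (simp add: Wc_def lc_def pseudo_finsler_def smooth_on_tangent_bundle_def)

lemma fund_tensor_fd:
  assumes c: "c \<in> charts_at \<A> x" and v: "(x, v) \<in> A" and u: "u \<in> tangent_space \<A> x" and w: "w \<in> tangent_space \<A> x"
  shows "fund_tensor L x v u w = 1 / 2 *
    frechet_derivative (\<lambda>z. frechet_derivative (lc c) (at z) (0, comp w c)) (at (coords c x, comp v c)) (0, comp u c)"
proof -
  have cA: "c \<in> \<A>" using c by (simp add: charts_at_iff)
  have "L (x, v + t *\<^sub>R u + s *\<^sub>R w) = lc c ((coords c x, comp v c) + t *\<^sub>R (0, comp u c) + s *\<^sub>R (0, comp w c))" for s t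
    using lc_coords[OF c, of "v + t *\<^sub>R u + s *\<^sub>R w"] A_tangent[OF v] u w
    by (simp add: tangent_space_add tangent_space_scaleR)
  moreover have "(coords c x, comp v c) \<in> Wc c"
    using Wc_iff[OF c A_tangent[OF v]] v by simp
  ultimately show ?thesis
    by (simp only: fund_tensor_def deriv_deriv[OF open_Wc[OF cA] smooth_lc[OF cA]])
qed

lemma fund_tensor_nondegenerate:
  assumes "(x, v) \<in> A" "u \<in> tangent_space \<A> x" "\<And>w. w \<in> tangent_space \<A> x \<Longrightarrow> fund_tensor L x v u w = 0"
  shows "u = 0"
proof -
  have "\<forall>(p, v)\<in>A. \<forall>u\<in>tangent_space \<A> p.
        (\<forall>w\<in>tangent_space \<A> p. fund_tensor L p v u w = 0) \<longrightarrow> u = 0"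
    using finsler unfolding pseudo_finsler_def by (elim conjE)
  from bspec[OF this assms(1)] assms(2,3) show ?thesis by simp
qed

text \<open>Nondegeneracy is stated for tangent vectors; it transfers because \<open>tvec_of\<close>
  realises every vector of components.\<close>

lemma coords_locale:
  assumes c: "c \<in> \<A>"
  shows "finsler_coords (Wc c) (lc c)"
proof
  show "open (Wc c)" "smooth_on (Wc c) (lc c)" using c open_Wc smooth_lc by auto
  fix \<xi> y and r :: real assume z: "(\<xi>, y) \<in> Wc c" "r > 0"
  from Wc_cases[OF c z(1)] obtain x v where x: "c \<in> charts_at \<A> x" "\<xi> = coords c x" "y = comp v c" "(x, v) \<in> A"
     "v \<in> tangent_space \<A> x" by metis
  have "(x, r *\<^sub>R v) \<in> A" "L (x, r *\<^sub>R v) = r\<^sup>2 * L (x, v)"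
    using finsler x(4) z(2) unfolding pseudo_finsler_def by fast+
  then show "(\<xi>, r *\<^sub>R y) \<in> Wc c" "lc c (\<xi>, r *\<^sub>R y) = r\<^sup>2 * lc c (\<xi>, y)"
    using Wc_iff[OF x(1), of "r *\<^sub>R v"] lc_coords[OF x(1), of "r *\<^sub>R v"] lc_coords[OF x(1,5)]
    by (simp_all add: x tangent_space_scaleR)
next
  fix z a
  assume z: "z \<in> Wc c" and
    a: "\<And>b. frechet_derivative (\<lambda>w. frechet_derivative (lc c) (at w) (0, a)) (at z) (0, b) = 0"
  obtain \<xi> y where zy: "z = (\<xi>, y)" by fastforce
  from Wc_cases[OF c z[unfolded zy]] obtain x v where
    x: "c \<in> charts_at \<A> x" "\<xi> = coords c x" "y = comp v c" "(x, v) \<in> A" by metis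
  let ?a = "tvec_of \<A> c x a"
  have aT: "?a \<in> tangent_space \<A> x" and ac: "comp ?a c = a"
    using tvec_of_in_tangent_space[OF x(1)] comp_tvec_of[OF x(1)] by auto
  have "fund_tensor L x v ?a w = 0" if w: "w \<in> tangent_space \<A> x" for w
    unfolding fund_tensor_fd[OF x(1,4) aT w] ac
    using fd_fd_commute[OF open_Wc[OF c] smooth_lc[OF c] z, of "(0, comp w c)" "(0, a)"] a[of "comp w c"]
    unfolding zy x(2,3) by simp
  then have "?a = 0"
    by (rule fund_tensor_nondegenerate[OF x(4) aT])
  then show "a = 0"
    using ac by simp
qed

abbreviation gc where "gc c \<equiv> finsler_coords.g (lc c)"
abbreviation Cc where "Cc c \<equiv> finsler_coords.C (lc c)"
abbreviation covc where "covc c \<equiv> finsler_coords.cov (lc c)"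
abbreviation Gc where "Gc c \<equiv> finsler_coords.Gm (lc c)"

lemma fund_tensor_eq:
  assumes c: "c \<in> charts_at \<A> x" and v: "(x, v) \<in> A" and u: "u \<in> tangent_space \<A> x" and w: "w \<in> tangent_space \<A> x"
  shows "fund_tensor L x v u w = gc c (coords c x, comp v c) (comp u c) (comp w c)"
proof -
  have cA: "c \<in> \<A>" using c by (simp add: charts_at_iff)
  interpret finsler_coords "Wc c" "lc c" by (rule coords_locale[OF cA])
  have "(coords c x, comp v c) \<in> Wc c"
    using Wc_iff[OF c A_tangent[OF v]] v by simp
  \<comment> \<open>The inner derivative belongs to the second argument in
    \<open>fund_tensor\<close> but to the first in \<open>g\<close>.\<close>
  from g_sym[OF this, of "comp u c" "comp w c"] show ?thesis
    unfolding fund_tensor_fd[OF assms] by (simp add: g_def[of _ "comp w c"])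
qed

lemma cartan_tensor_eq:
  assumes c: "c \<in> charts_at \<A> x" and v: "(x, v) \<in> A" and "a \<in> tangent_space \<A> x" "b \<in> tangent_space \<A> x"
    "d \<in> tangent_space \<A> x"
  shows "cartan_tensor L x v a b d = Cc c (coords c x, comp v c) (comp a c) (comp b c) (comp d c)"
proof -
  have cA: "c \<in> \<A>" using c by (simp add: charts_at_iff)
  interpret finsler_coords "Wc c" "lc c" by (rule coords_locale[OF cA])
  have z: "(coords c x, comp v c) \<in> Wc c"
    using Wc_iff[OF c A_tangent[OF v]] v by simp
  have "L (x, v + q *\<^sub>R a + s *\<^sub>R b + t *\<^sub>R d)
    = lc c ((coords c x, comp v c) + q *\<^sub>R (0, comp a c) + s *\<^sub>R (0, comp b c) + t *\<^sub>R (0, comp d c))" for q s t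
    using lc_coords[OF c, of "v + q *\<^sub>R a + s *\<^sub>R b + t *\<^sub>R d"] A_tangent[OF v] assms
    by (simp add: tangent_space_add tangent_space_scaleR)
  then show ?thesis
    by (simp only: cartan_tensor_def C_def fd_g[OF z] deriv_deriv_deriv[OF openW smooth_l z])
qed

lemma admissible_coords:
  assumes "admissible \<A> A \<Omega> V" "c \<in> \<A>" "\<xi> \<in> coords c ` (dom_of c \<inter> \<Omega>)"
  shows "(\<xi>, rep c V \<xi>) \<in> Wc c"
proof -
  obtain x where x: "x \<in> dom_of c" "x \<in> \<Omega>" "\<xi> = coords c x" using assms by auto
  have cx: "c \<in> charts_at \<A> x" using x assms by (simp add: charts_at_iff)
  have "(x, V x) \<in> A" using assms x by (simp add: admissible_def)
  then show ?thesis
    unfolding x(3) rep_coords[OF cx] using Wc_iff[OF cx A_tangent] by blast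
qed

section \<open>Uniqueness and existence of the Chern connection in a chart\<close>

lemma deriv_along_metric:
  assumes \<Omega>: "open \<Omega>" and V: "admissible \<A> A \<Omega> V" and x: "x \<in> \<Omega>" "c \<in> charts_at \<A> x"
    and X: "X \<in> vector_fields \<A> \<Omega>" and Y: "Y \<in> vector_fields \<A> \<Omega>" and Z: "Z \<in> vector_fields \<A> \<Omega>"
  defines "\<xi> \<equiv> coords c x" and "z \<equiv> (coords c x, comp (V x) c)"
  shows "deriv_along \<A> X (\<lambda>x. fund_tensor L x (V x) (Y x) (Z x)) x =
     gc c z (covc c (rep c V) (rep c Y) \<xi> (comp (X x) c)) (comp (Z x) c)
     + gc c z (comp (Y x) c) (covc c (rep c V) (rep c Z) \<xi> (comp (X x) c))
     + 2 * Cc c z (covc c (rep c V) (rep c V) \<xi> (comp (X x) c)) (comp (Y x) c) (comp (Z x) c)"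
proof -
  have cA: "c \<in> \<A>" "x \<in> dom_of c" using x by (auto simp: charts_at_iff)
  interpret finsler_coords "Wc c" "lc c" by (rule coords_locale[OF cA(1)])
  let ?T = "coords c ` (dom_of c \<inter> \<Omega>)"
  have T: "open ?T" "\<xi> \<in> ?T"
    using x cA \<Omega> by (auto simp: \<xi>_def intro: open_coords_image')
  have VF: "V \<in> vector_fields \<A> \<Omega>" using V by (simp add: admissible_def)
  note df = smooth_on_differentiable[OF vector_fields_smooth[OF _ cA(1)] T(2)]
  have "((\<lambda>\<xi>. g (\<xi>, rep c V \<xi>) (rep c Y \<xi>) (rep c Z \<xi>)) has_derivative (\<lambda>a.
      g (\<xi>, rep c V \<xi>) (cov (rep c V) (rep c Y) \<xi> a) (rep c Z \<xi>) + g (\<xi>, rep c V \<xi>) (rep c Y \<xi>) (cov (rep c V) (rep c Z) \<xi> a)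
      + 2 * C (\<xi>, rep c V \<xi>) (cov (rep c V) (rep c V) \<xi> a) (rep c Y \<xi>) (rep c Z \<xi>))) (at \<xi>)"
    by (rule metric_has_derivative[OF T admissible_coords[OF V cA(1)]]) (auto intro: df VF Y Z)
  then have "(((\<lambda>x. fund_tensor L x (V x) (Y x) (Z x)) \<circ> inv_coords c) has_derivative (\<lambda>a.
      g (\<xi>, rep c V \<xi>) (cov (rep c V) (rep c Y) \<xi> a) (rep c Z \<xi>) + g (\<xi>, rep c V \<xi>) (rep c Y \<xi>) (cov (rep c V) (rep c Z) \<xi> a)
      + 2 * C (\<xi>, rep c V \<xi>) (cov (rep c V) (rep c V) \<xi> a) (rep c Y \<xi>) (rep c Z \<xi>))) (at \<xi>)"
  proof (rule has_derivative_transform_within_open[OF _ T])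
    fix \<eta> assume "\<eta> \<in> ?T"
    then obtain y where y: "y \<in> dom_of c" "y \<in> \<Omega>" "\<eta> = coords c y" by auto
    then have cy: "c \<in> charts_at \<A> y" using cA by (simp add: charts_at_iff)
    show "g (\<eta>, rep c V \<eta>) (rep c Y \<eta>) (rep c Z \<eta>) = ((\<lambda>x. fund_tensor L x (V x) (Y x) (Z x)) \<circ> inv_coords c) \<eta>"
      unfolding y(3) rep_coords[OF cy]
      using fund_tensor_eq[OF cy, of "V y"] V y Y Z vector_fields_tangent
      by (simp add: inv_coords_coords[OF cA(1)] admissible_def)
  qed
  from deriv_along_eq[where X = X, OF x(2) vector_fields_tangent[OF X x(1)] this[unfolded \<xi>_def]]
  show ?thesis
    unfolding z_def \<xi>_def rep_coords[OF x(2)] by simp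
qed

text \<open>A priori \<open>D\<close> acts on whole fields over \<Omega> and is not known to be
  local. Its difference to the coordinate formula is therefore treated as a function of fields;
  \<open>difference_zero\<close> asks only that their values at \<open>x\<close> exhaust the tangent
  space, and locality comes out as a consequence.\<close>

lemma conn_coords:
  assumes \<Omega>: "open \<Omega>" and V: "admissible \<A> A \<Omega> V" and D: "chern_connection \<A> L \<Omega> V D"
    and x: "x \<in> \<Omega>" "c \<in> charts_at \<A> x"
    and XY: "X \<in> vector_fields \<A> \<Omega>" "Y \<in> vector_fields \<A> \<Omega>"
  shows "comp (D X Y x) c = covc c (rep c V) (rep c Y) (coords c x) (comp (X x) c)"
proof -
  have cA: "c \<in> \<A>" using x by (auto simp: charts_at_iff)
  interpret finsler_coords "Wc c" "lc c" by (rule coords_locale[OF cA])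
  have VF: "V \<in> vector_fields \<A> \<Omega>" and VA: "(x, V x) \<in> A" using V x by (auto simp: admissible_def)
  let ?z = "(coords c x, comp (V x) c)"
  have z: "?z \<in> Wc c" using Wc_iff[OF x(2) A_tangent[OF VA]] VA by simp
  define co where "co X Y = cov (rep c V) (rep c Y) (coords c x) (comp (X x) c)" for X Y
  define t where "t X Y = comp (D X Y x) c - co X Y" for X Y
  have DVF: "D X Y \<in> vector_fields \<A> \<Omega>" if "X \<in> vector_fields \<A> \<Omega>" "Y \<in> vector_fields \<A> \<Omega>" for X Y
    using D that by (simp add: chern_connection_def affine_connection_def)
  have "t X Y = 0"
  proof (rule difference_zero[where F = "vector_fields \<A> \<Omega>" and e = "\<lambda>X. comp (X x) c", OF z VF])
    fix w
    obtain Z where "Z \<in> vector_fields \<A> \<Omega>" "Z x = tvec_of \<A> c x w"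
      using vector_field_extension[OF \<Omega> x(1) tvec_of_in_tangent_space[OF x(2)]] .
    then show "\<exists>Z\<in>vector_fields \<A> \<Omega>. comp (Z x) c = w"
      using comp_tvec_of[OF x(2)] by (intro bexI[of _ Z]) auto
  next
    fix X Y assume XY: "X \<in> vector_fields \<A> \<Omega>" "Y \<in> vector_fields \<A> \<Omega>"
    have "D X Y x - D Y X x = lie_bracket \<A> \<Omega> X Y x"
      using D XY x by (simp add: chern_connection_def)
    then have "comp (D X Y x) c - comp (D Y X x) c = comp (lie_bracket \<A> \<Omega> X Y x) c"
      by (metis minus_tvec.rep_eq)
    then show "t X Y = t Y X"
      unfolding comp_lie_bracket[OF x]
      by (simp add: t_def co_def cov_def rep_coords[OF x(2)] Gm_sym[OF z, of "comp (X x) c"] algebra_simps)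
  next
    fix X Y Z assume XYZ: "X \<in> vector_fields \<A> \<Omega>" "Y \<in> vector_fields \<A> \<Omega>" "Z \<in> vector_fields \<A> \<Omega>"
    have "deriv_along \<A> X (\<lambda>x. fund_tensor L x (V x) (Y x) (Z x)) x =
          fund_tensor L x (V x) (D X Y x) (Z x) + fund_tensor L x (V x) (Y x) (D X Z x) +
          2 * cartan_tensor L x (V x) (D X V x) (Y x) (Z x)"
      using D XYZ x by (simp add: chern_connection_def)
    also have "\<dots> = g ?z (comp (D X Y x) c) (comp (Z x) c) + g ?z (comp (Y x) c) (comp (D X Z x) c) +
          2 * C ?z (comp (D X V x) c) (comp (Y x) c) (comp (Z x) c)"
      by (simp add: fund_tensor_eq[OF x(2) VA] cartan_tensor_eq[OF x(2) VA] vector_fields_tangent[OF _ x(1)]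
          XYZ DVF VF)
    finally show "g ?z (t X Y) (comp (Z x) c) + g ?z (comp (Y x) c) (t X Z)
        + 2 * C ?z (t X V) (comp (Y x) c) (comp (Z x) c) = 0"
      unfolding deriv_along_metric[OF \<Omega> V x XYZ]
      by (simp add: t_def co_def linear_diff[OF linear_g1[OF z]] linear_diff[OF linear_g2[OF z]]
          linear_diff[OF linear_C1[OF z]])
  qed (auto simp: XY)
  then show ?thesis
    by (simp add: t_def co_def)
qed

text \<open>Existence is needed because \<open>christoffel\<close> is a definite description over all connections.\<close>

lemma chern_connection_exists:
  assumes c: "c \<in> charts_at \<A> x\<^sub>0" and v\<^sub>0: "(x\<^sub>0, v\<^sub>0) \<in> A"
  obtains \<Omega> V D where "open \<Omega>" "x\<^sub>0 \<in> \<Omega>" "\<Omega> \<subseteq> dom_of c" "admissible \<A> A \<Omega> V" "V x\<^sub>0 = v\<^sub>0"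
    "chern_connection \<A> L \<Omega> V D"
proof -
  have cA: "c \<in> \<A>" using c by (simp add: charts_at_iff)
  interpret finsler_coords "Wc c" "lc c" by (rule coords_locale[OF cA])
  define y where "y = comp v\<^sub>0 c"
  \<comment> \<open>The reference field will have constant components \<open>y\<close>; \<Omega> is
    where this vector lies in the domain of the metric.\<close>
  define \<Omega> where "\<Omega> = dom_of c \<inter> (\<lambda>x. (coords c x, y)) -` Wc c"
  define V where "V x = (if x \<in> \<Omega> then tvec_of \<A> c x y else 0)" for x
  have \<Omega>: "open \<Omega>" "\<Omega> \<subseteq> dom_of c"
    unfolding \<Omega>_def using continuous_coords[OF cA]
    by (auto intro!: continuous_open_preimage continuous_intros open_dom cA openW)
  have x\<^sub>0: "x\<^sub>0 \<in> \<Omega>"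
    using c v\<^sub>0 Wc_iff[OF c A_tangent[OF v\<^sub>0]] by (simp add: \<Omega>_def y_def charts_at_iff)
  have cx: "c \<in> charts_at \<A> x" if "x \<in> \<Omega>" for x
    using that \<Omega> cA by (auto simp: charts_at_iff)
  let ?T = "coords c ` \<Omega>"
  have T: "open ?T" by (rule open_coords_image[OF cA \<Omega>])
  have dom: "dom_of c \<inter> \<Omega> = \<Omega>" using \<Omega> by blast
  have repV: "rep c V \<xi> = y" if "\<xi> \<in> ?T" for \<xi>
    using that cx by (auto simp: rep_coords V_def comp_tvec_of)
  have smV: "smooth_on ?T (rep c V)"
    using smooth_on_cong[OF T, of "rep c V" "\<lambda>_. y"] repV by (simp add: smooth_on_const)
  have VF: "V \<in> vector_fields \<A> \<Omega>"
    by (rule vector_fieldsI_chart[OF cA \<Omega> _ _ smV]) (simp_all add: V_def tvec_of_in_tangent_space cx)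
  have VA: "(x, V x) \<in> A" if "x \<in> \<Omega>" for x
    using that Wc_iff[OF cx tvec_of_in_tangent_space[OF cx], OF that that, of y]
    by (simp add: V_def comp_tvec_of cx \<Omega>_def)
  have adm: "admissible \<A> A \<Omega> V"
    using VF VA by (simp add: admissible_def)
  have WT: "(\<xi>, rep c V \<xi>) \<in> Wc c" if "\<xi> \<in> ?T" for \<xi>
    using admissible_coords[OF adm cA] that dom by simp
  have Vx\<^sub>0: "V x\<^sub>0 = v\<^sub>0"
    using x\<^sub>0 tvec_of_comp[OF A_tangent[OF v\<^sub>0] c] by (simp add: V_def y_def)
  have sm: "smooth_on ?T (rep c X)" if "X \<in> vector_fields \<A> \<Omega>" for X
    using vector_fields_smooth[OF that cA] dom by simp
  note tang = vector_fields_tangent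
  define co where "co X Y x = cov (rep c V) (rep c Y) (coords c x) (comp (X x) c)" for X Y x
  \<comment> \<open>The value 0 outside \<Omega> matches the convention for vector fields, so that
    the axioms hold as equalities of functions on the whole manifold.\<close>
  define D where "D X Y x = (if x \<in> \<Omega> then tvec_of \<A> c x (co X Y x) else 0)" for X Y x
  have Dc: "comp (D X Y x) c = co X Y x" if "x \<in> \<Omega>" for X Y x
    using that by (simp add: D_def comp_tvec_of cx)
  have DT: "D X Y x \<in> tangent_space \<A> x" if "x \<in> \<Omega>" for X Y x
    using that by (simp add: D_def tvec_of_in_tangent_space cx)
  have DVF: "D X Y \<in> vector_fields \<A> \<Omega>" if X: "X \<in> vector_fields \<A> \<Omega>" and Y: "Y \<in> vector_fields \<A> \<Omega>" for X Y
  proof (rule vector_fieldsI_chart[OF cA \<Omega> DT])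
    have "rep c (D X Y) \<xi> = cov (rep c V) (rep c Y) \<xi> (rep c X \<xi>)" if "\<xi> \<in> ?T" for \<xi>
      using that Dc cx by (auto simp: rep_coords co_def)
    then show "smooth_on ?T (rep c (D X Y))"
      using smooth_on_cong[OF T, of "rep c (D X Y)"] smooth_on_cov[OF T WT smV sm[OF X] sm[OF Y]] by simp
  qed (simp_all add: D_def)
  have df: "rep c X differentiable (at (coords c x))" if "X \<in> vector_fields \<A> \<Omega>" "x \<in> \<Omega>" for X x
    using smooth_on_differentiable[OF sm[OF that(1)]] that(2) by blast
  have W: "(coords c x, rep c V (coords c x)) \<in> Wc c" if "x \<in> \<Omega>" for x
    using WT that by blast
  have lin: "linear (cov (rep c V) (rep c Y) (coords c x))" if "Y \<in> vector_fields \<A> \<Omega>" "x \<in> \<Omega>" for Y x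
    using linear_cov[OF df[OF VF] df W] that by blast
  have eqI: "v = w" if "x \<in> \<Omega>" "v \<in> tangent_space \<A> x" "w \<in> tangent_space \<A> x" "comp v c = comp w c" for v w x
    using tangent_eqI[OF that(2,3) cx[OF that(1)] that(4)] .
  have aff: "affine_connection \<A> \<Omega> D"
    unfolding affine_connection_def
  proof (intro conjI ballI allI impI)
    fix X X' Y assume X: "X \<in> vector_fields \<A> \<Omega>" "X' \<in> vector_fields \<A> \<Omega>" and Y: "Y \<in> vector_fields \<A> \<Omega>"
    show "D (\<lambda>x. X x + X' x) Y = (\<lambda>x. D X Y x + D X' Y x)"
    proof
      fix x
      show "D (\<lambda>x. X x + X' x) Y x = D X Y x + D X' Y x"
        using linear_add[OF lin[OF Y]] tvec_of_add[OF cx] by (cases "x \<in> \<Omega>") (simp_all add: D_def co_def)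
    qed
  next
    fix X Y f assume X: "X \<in> vector_fields \<A> \<Omega>" and Y: "Y \<in> vector_fields \<A> \<Omega>"
    show "D (\<lambda>x. f x *\<^sub>R X x) Y = (\<lambda>x. f x *\<^sub>R D X Y x)"
    proof
      fix x
      show "D (\<lambda>x. f x *\<^sub>R X x) Y x = f x *\<^sub>R D X Y x"
        using linear_scale[OF lin[OF Y]] tvec_of_scaleR[OF cx] by (cases "x \<in> \<Omega>") (simp_all add: D_def co_def)
    qed
  next
    fix X Y Y' assume X: "X \<in> vector_fields \<A> \<Omega>" and Y: "Y \<in> vector_fields \<A> \<Omega>" "Y' \<in> vector_fields \<A> \<Omega>"
    have r: "rep c (\<lambda>x. Y x + Y' x) = (\<lambda>\<xi>. rep c Y \<xi> + rep c Y' \<xi>)"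
      by (simp add: rep_def[abs_def])
    show "D X (\<lambda>x. Y x + Y' x) = (\<lambda>x. D X Y x + D X Y' x)"
    proof
      fix x
      show "D X (\<lambda>x. Y x + Y' x) x = D X Y x + D X Y' x"
        using cov_add[where V = "rep c V", OF df[OF Y(1)] df[OF Y(2)] W] tvec_of_add[OF cx]
        by (cases "x \<in> \<Omega>") (simp_all add: D_def co_def r)
    qed
  next
    fix X Y f assume X: "X \<in> vector_fields \<A> \<Omega>" and Y: "Y \<in> vector_fields \<A> \<Omega>" and f: "smooth_fun \<A> \<Omega> f"
    have r: "rep c (\<lambda>x. f x *\<^sub>R Y x) = (\<lambda>\<xi>. (f \<circ> inv_coords c) \<xi> *\<^sub>R rep c Y \<xi>)"
      by (simp add: rep_def[abs_def])
    show "D X (\<lambda>x. f x *\<^sub>R Y x) = (\<lambda>x. f x *\<^sub>R D X Y x + deriv_along \<A> X f x *\<^sub>R Y x)"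
    proof
      fix x
      show "D X (\<lambda>x. f x *\<^sub>R Y x) x = f x *\<^sub>R D X Y x + deriv_along \<A> X f x *\<^sub>R Y x"
      proof (cases "x \<in> \<Omega>")
        case True
        have "smooth_on ?T (f \<circ> inv_coords c)"
          using f cA dom by (auto simp: smooth_fun_def dest: bspec[of _ _ c])
        then have dff: "(f \<circ> inv_coords c) differentiable (at (coords c x))"
          using smooth_on_differentiable True by blast
        show ?thesis
        proof (rule eqI[OF True])
          show "comp (D X (\<lambda>x. f x *\<^sub>R Y x) x) c = comp (f x *\<^sub>R D X Y x + deriv_along \<A> X f x *\<^sub>R Y x) c"
            unfolding deriv_along_eq[where X = X, OF cx[OF True] tang[OF X True] fd_works[OF dff]]
            using True cov_scaleR[where V = "rep c V", OF dff df[OF Y True] W[OF True]] rep_coords[OF cx[OF True]]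
            by (simp add: Dc co_def r inv_coords_coords[OF cA] subsetD[OF \<Omega>(2)])
        qed (use True DT tang[OF Y] in \<open>auto intro!: tangent_space_add tangent_space_scaleR\<close>)
      next
        case False
        then show ?thesis by (simp add: D_def vector_fields_zero[OF Y])
      qed
    qed
  qed (rule DVF)
  have "chern_connection \<A> L \<Omega> V D"
    unfolding chern_connection_def
  proof (intro conjI ballI aff)
    fix X Y x assume XY: "X \<in> vector_fields \<A> \<Omega>" "Y \<in> vector_fields \<A> \<Omega>" and x: "x \<in> \<Omega>"
    show "D X Y x - D Y X x = lie_bracket \<A> \<Omega> X Y x"
    proof (rule eqI[OF x])
      show "comp (D X Y x - D Y X x) c = comp (lie_bracket \<A> \<Omega> X Y x) c"
        unfolding comp_lie_bracket[OF x cx[OF x]]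
        using cov_commutator[where V = "rep c V" and Y = "rep c Y" and X = "rep c X", OF W[OF x]] by (simp add: Dc x co_def rep_coords[OF cx[OF x]])
    qed (use DT x lie_bracket_tangent[OF \<Omega>(1) XY x] in \<open>auto intro: tangent_space_diff\<close>)
  next
    fix X Y Z x assume XYZ: "X \<in> vector_fields \<A> \<Omega>" "Y \<in> vector_fields \<A> \<Omega>" "Z \<in> vector_fields \<A> \<Omega>" and x: "x \<in> \<Omega>"
    show "deriv_along \<A> X (\<lambda>x. fund_tensor L x (V x) (Y x) (Z x)) x =
          fund_tensor L x (V x) (D X Y x) (Z x) + fund_tensor L x (V x) (Y x) (D X Z x) +
          2 * cartan_tensor L x (V x) (D X V x) (Y x) (Z x)"
      unfolding deriv_along_metric[OF \<Omega>(1) adm x cx[OF x] XYZ]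
      by (simp add: fund_tensor_eq[OF cx[OF x] VA[OF x]] cartan_tensor_eq[OF cx[OF x] VA[OF x]]
          DT tang[OF XYZ(2)] tang[OF XYZ(3)] x Dc co_def)
  qed
  then show thesis
    using that \<Omega> x\<^sub>0 adm Vx\<^sub>0 by blast
qed

section \<open>Christoffel symbols\<close>

lemma coord_field_rep:
  assumes c: "c \<in> \<A>" and \<Omega>: "open \<Omega>" "\<Omega> \<subseteq> dom_of c"
  shows "coord_field \<A> \<Omega> c i \<in> vector_fields \<A> \<Omega>" "\<xi> \<in> coords c ` \<Omega> \<Longrightarrow> rep c (coord_field \<A> \<Omega> c i) \<xi> = axis i 1"
proof -
  have cx: "c \<in> charts_at \<A> x" if "x \<in> \<Omega>" for x
    using that \<Omega> c by (auto simp: charts_at_iff)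
  show r: "\<xi> \<in> coords c ` \<Omega> \<Longrightarrow> rep c (coord_field \<A> \<Omega> c i) \<xi> = axis i 1" for \<xi>
    using cx by (auto simp: rep_coords coord_field_def comp_tvec_of)
  have "smooth_on (coords c ` \<Omega>) (rep c (coord_field \<A> \<Omega> c i))"
    using smooth_on_cong[OF open_coords_image[OF c \<Omega>], of "rep c (coord_field \<A> \<Omega> c i)" "\<lambda>_. axis i 1"] r
    by (simp add: smooth_on_const)
  then show "coord_field \<A> \<Omega> c i \<in> vector_fields \<A> \<Omega>"
    by (intro vector_fieldsI_chart[OF c \<Omega>]) (auto simp: coord_field_def tvec_of_in_tangent_space cx)
qed

text \<open>Uniqueness makes the value independent of \<Omega>, \<open>V\<close> and
  \<open>D\<close>; existence keeps the implication inside the description from being vacuous, in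
  which case every \<open>r\<close> would satisfy it.\<close>

lemma christoffel_eq:
  assumes c: "c \<in> charts_at \<A> x" and v: "(x, v) \<in> A"
  shows "christoffel \<A> A L c x v k i j = Gc c (coords c x, comp v c) (axis i 1) (axis j 1) $ k"
proof -
  have cA: "c \<in> \<A>" using c by (simp add: charts_at_iff)
  interpret finsler_coords "Wc c" "lc c" by (rule coords_locale[OF cA])
  have val: "comp (D (coord_field \<A> \<Omega> c i) (coord_field \<A> \<Omega> c j) x) c $ k
      = Gc c (coords c x, comp v c) (axis i 1) (axis j 1) $ k"
    if h: "open \<Omega>" "x \<in> \<Omega>" "\<Omega> \<subseteq> dom_of c" "admissible \<A> A \<Omega> V" "V x = v" "chern_connection \<A> L \<Omega> V D"
    for \<Omega> V D
  proof -
    note cf = coord_field_rep[OF cA h(1,3)]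
    have xT: "coords c x \<in> coords c ` \<Omega>" using h by blast
    \<comment> \<open>A coordinate field has constant components, so only the \<Gamma> term of
      \<open>cov\<close> survives.\<close>
    have "frechet_derivative (rep c (coord_field \<A> \<Omega> c j)) (at (coords c x))
       = frechet_derivative (\<lambda>_. axis j 1) (at (coords c x))"
      by (rule fd_cong[OF open_coords_image[OF cA h(1,3)] xT]) (rule cf(2))
    moreover have "comp (coord_field \<A> \<Omega> c i x) c = axis i 1"
      using cf(2)[OF xT, of i] rep_coords[OF c] by metis
    ultimately show ?thesis
      unfolding conn_coords[OF h(1,4,6,2) c cf(1) cf(1)]
      using cf(2)[OF xT] h(5) rep_coords[OF c] by (simp add: cov_def)
  qed
  obtain \<Omega> V D where h: "open \<Omega>" "x \<in> \<Omega>" "\<Omega> \<subseteq> dom_of c" "admissible \<A> A \<Omega> V" "V x = v"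
    "chern_connection \<A> L \<Omega> V D"
    using chern_connection_exists[OF c v] .
  show ?thesis
    unfolding christoffel_def
  proof (rule the_equality)
    fix r
    assume "\<forall>\<Omega> V D. open \<Omega> \<and> x \<in> \<Omega> \<and> \<Omega> \<subseteq> dom_of c \<and> admissible \<A> A \<Omega> V \<and> V x = v \<and>
     chern_connection \<A> L \<Omega> V D \<longrightarrow>
     comp (D (coord_field \<A> \<Omega> c i) (coord_field \<A> \<Omega> c j) x) c $ k = r"
    then show "r = Gc c (coords c x, comp v c) (axis i 1) (axis j 1) $ k"
      using h val[OF h] by blast
  qed (use val in blast)
qed

lemma Gam_eq:
  assumes c: "c \<in> \<A>" and z: "(\<xi>, y) \<in> Wc c"
  shows "Gam \<A> A L c \<xi> y k i j = Gc c (\<xi>, y) (axis i 1) (axis j 1) $ k"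
proof -
  obtain x v where x: "c \<in> charts_at \<A> x" "\<xi> = coords c x" "y = comp v c" "(x, v) \<in> A" "v \<in> tangent_space \<A> x"
    using Wc_cases[OF c z] .
  have "x \<in> dom_of c" using x by (simp add: charts_at_iff)
  then show ?thesis
    using christoffel_eq[OF x(1,4)] tvec_of_comp[OF x(5,1)]
    by (simp add: Gam_def x(2,3) inv_coords_coords[OF c])
qed

section \<open>Curvature in charts\<close>

text \<open>Torsion-freeness writes the bracket as a difference of two smooth fields, which settles
  its smoothness in every chart at once.\<close>

lemma lie_bracket_vector_field:
  assumes "open \<Omega>" "chern_connection \<A> L \<Omega> V D" "X \<in> vector_fields \<A> \<Omega>" "Y \<in> vector_fields \<A> \<Omega>"
  shows "lie_bracket \<A> \<Omega> X Y \<in> vector_fields \<A> \<Omega>"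
proof -
  have D: "D X Y \<in> vector_fields \<A> \<Omega>" "D Y X \<in> vector_fields \<A> \<Omega>"
    using assms by (simp_all add: chern_connection_def affine_connection_def)
  have "lie_bracket \<A> \<Omega> X Y x = D X Y x - D Y X x" for x
  proof (cases "x \<in> \<Omega>")
    case True
    then show ?thesis using assms by (simp add: chern_connection_def)
  next
    case False
    have "lie_bracket \<A> \<Omega> X Y x = 0"
      by (rule tvec_eqI) (simp add: lie_bracket_def Tvec_inverse False)
    then show ?thesis
      using False vector_fields_zero[OF D(1)] vector_fields_zero[OF D(2)] by simp
  qed
  then have "lie_bracket \<A> \<Omega> X Y = (\<lambda>x. D X Y x - D Y X x)" by blast
  then show ?thesis
    using vector_fields_diff[OF assms(1) D] by simp
qed

lemma comp_curvature:
  assumes \<Omega>: "open \<Omega>" and V: "admissible \<A> A \<Omega> V" and D: "chern_connection \<A> L \<Omega> V D"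
    and x: "x \<in> \<Omega>" "c \<in> charts_at \<A> x"
    and XYZ: "X \<in> vector_fields \<A> \<Omega>" "Y \<in> vector_fields \<A> \<Omega>" "Z \<in> vector_fields \<A> \<Omega>"
  shows "comp (curvature \<A> \<Omega> D X Y Z x) c =
    finsler_coords.Rm (lc c) (rep c V) (rep c X) (rep c Y) (rep c Z) (coords c x)"
proof -
  have cA: "c \<in> \<A>" using x by (simp add: charts_at_iff)
  interpret finsler_coords "Wc c" "lc c" by (rule coords_locale[OF cA])
  let ?T = "coords c ` (dom_of c \<inter> \<Omega>)"
  have T: "open ?T" "coords c x \<in> ?T"
    using x cA \<Omega> by (auto simp: charts_at_iff intro: open_coords_image')
  note cc = conn_coords[OF \<Omega> V D]
  have DVF: "D X Y \<in> vector_fields \<A> \<Omega>" if "X \<in> vector_fields \<A> \<Omega>" "Y \<in> vector_fields \<A> \<Omega>" for X Y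
    using D that by (simp add: chern_connection_def affine_connection_def)
  \<comment> \<open>The outer derivative differentiates the inner field, whose components must
    therefore be known on all of \<open>?T\<close>, beyond the point \<open>x\<close>.\<close>
  have DD: "comp (D X (D Y Z) x) c
      = cov (rep c V) (\<lambda>\<xi>. cov (rep c V) (rep c Z) \<xi> (rep c Y \<xi>)) (coords c x) (rep c X (coords c x))"
    if XYZ: "X \<in> vector_fields \<A> \<Omega>" "Y \<in> vector_fields \<A> \<Omega>" "Z \<in> vector_fields \<A> \<Omega>" for X Y Z
  proof -
    have r: "rep c (D Y Z) \<xi> = cov (rep c V) (rep c Z) \<xi> (rep c Y \<xi>)" if \<xi>: "\<xi> \<in> ?T" for \<xi>
    proof -
      obtain y where y: "y \<in> dom_of c" "y \<in> \<Omega>" "\<xi> = coords c y" using \<xi> by blast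
      then have cy: "c \<in> charts_at \<A> y" using cA by (simp add: charts_at_iff)
      show ?thesis
        unfolding y(3) rep_coords[OF cy] by (rule cc[OF y(2) cy XYZ(2,3)])
    qed
    have "frechet_derivative (rep c (D Y Z)) (at (coords c x))
       = frechet_derivative (\<lambda>\<xi>. cov (rep c V) (rep c Z) \<xi> (rep c Y \<xi>)) (at (coords c x))"
      by (rule fd_cong[OF T]) (rule r)
    then show ?thesis
      unfolding cc[OF x XYZ(1) DVF[OF XYZ(2,3)]] rep_coords[OF x(2)]
      using r[OF T(2)] rep_coords[OF x(2), of Y]
      by (simp add: cov_def[of "rep c V" "rep c (D Y Z)"]
        cov_def[of "rep c V" "\<lambda>\<xi>. cov (rep c V) (rep c Z) \<xi> (rep c Y \<xi>)"])
  qed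
  show ?thesis
    unfolding curvature_def Rm_def
    using DD[OF XYZ] DD[OF XYZ(2,1,3)] cc[OF x lie_bracket_vector_field[OF \<Omega> D XYZ(1,2)] XYZ(3)]
    by (simp add: comp_lie_bracket[OF x] rep_coords[OF x(2)])
qed

lemma hh_coeff_eq:
  assumes c: "c \<in> \<A>" and z: "(\<xi>, y) \<in> Wc c"
  shows "hh_coeff \<A> A L c \<xi> y i j k l
    = finsler_coords.hh (lc c) (\<xi>, y) (axis k 1) (axis l 1) (axis j 1) $ i"
proof -
  interpret finsler_coords "Wc c" "lc c" by (rule coords_locale[OF c])
  let ?z = "(\<xi>, y)"
  let ?e = "\<lambda>i. axis i 1 :: real ^ 'n"
  \<comment> \<open>The lower indices are exchanged by the symmetry of \<Gamma>, since
    \<open>hh\<close> expects the direction of differentiation first.\<close>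
  have G: "Gam \<A> A L c (fst z) (snd z) i j l = Gm z (?e l) (?e j) $ i" if "z \<in> Wc c" for z i j l
    using Gam_eq[OF c, of "fst z" "snd z"] that Gm_sym[OF that] by simp
  have px: "partial k (\<lambda>x. Gam \<A> A L c x y i j l) \<xi>
      = frechet_derivative (\<lambda>w. Gm w (?e l) (?e j)) (at ?z) (?e k, 0) $ i" for i j k l
    by (rule partial_fd(1)[OF openW z smooth_Gm, where h = "\<lambda>x y. Gam \<A> A L c x y i j l"]) (rule G)
  have py: "partial k (\<lambda>y. Gam \<A> A L c \<xi> y i j l) y
      = frechet_derivative (\<lambda>w. Gm w (?e l) (?e j)) (at ?z) (0, ?e k) $ i" for i j k l
    by (rule partial_fd(2)[OF openW z smooth_Gm, where h = "\<lambda>x y. Gam \<A> A L c x y i j l"]) (rule G)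
  have N: "nonlin_coeff \<A> A L c \<xi> y p k = N ?z (?e k) $ p" for p k
    using linear_sum_nth[OF linear_Gm2[OF z], of y "?e k" p] Gm_y[OF z, of "?e k"] Gam_eq[OF c z]
    by (simp add: nonlin_coeff_def)
  have vert: "(\<Sum>p\<in>UNIV. N ?z a $ p * frechet_derivative (\<lambda>w. Gm w b d) (at ?z) (0, ?e p) $ i)
     = frechet_derivative (\<lambda>w. Gm w b d) (at ?z) (0, N ?z a) $ i" for a b d
    using linear_sum_nth[OF linear_compose[OF linear_inr linear_fd_Gm[OF z]]] by simp
  have GG: "(\<Sum>h\<in>UNIV. Gam \<A> A L c \<xi> y i h k * Gam \<A> A L c \<xi> y h j l)
     = Gm ?z (?e k) (Gm ?z (?e l) (?e j)) $ i" for k l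
    using linear_sum_nth[OF linear_Gm2[OF z], of "Gm ?z (?e l) (?e j)" "?e k" i] G[OF z]
    by (simp add: mult.commute)
  show ?thesis
    unfolding hh_coeff_def Let_def hh_def px py N vert GG by simp
qed

lemma hh_curvature_eq:
  assumes c: "c \<in> charts_at \<A> x" and v: "(x, v) \<in> A"
  shows "comp (hh_curvature \<A> A L c x v X Y Z) c
    = finsler_coords.hh (lc c) (coords c x, comp v c) (comp X c) (comp Y c) (comp Z c)"
proof -
  have cA: "c \<in> \<A>" using c by (simp add: charts_at_iff)
  interpret finsler_coords "Wc c" "lc c" by (rule coords_locale[OF cA])
  have z: "(coords c x, comp v c) \<in> Wc c"
    using Wc_iff[OF c A_tangent[OF v]] v by simp
  show ?thesis
    unfolding hh_curvature_def comp_tvec_of[OF c] hh_coeff_eq[OF cA z]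
    by (subst hh_expand[OF z]) (simp add: vec_eq_iff)
qed

text \<open>Along the curve \<open>V\<close> is the velocity, so by the chain rule the derivative of
  \<open>V\<close> in its own direction is the coordinate acceleration; the claim is the geodesic
  equation at time 0.\<close>

lemma geodesic_cov:
  assumes \<Omega>: "open \<Omega>" "p \<in> \<Omega>" and V: "admissible \<A> A \<Omega> V" and c: "c \<in> charts_at \<A> p"
    and I: "open I" "0 \<in> I" and geod: "geodesic \<A> A L I \<gamma>" "\<gamma> 0 = p"
    and ext: "\<forall>\<^sub>F t in nhds 0. V (\<gamma> t) = velocity \<A> \<gamma> t"
  shows "covc c (rep c V) (rep c V) (coords c p) (comp (V p) c) = 0"
proof -
  have cA: "c \<in> \<A>" and pc: "p \<in> dom_of c" using c by (auto simp: charts_at_iff)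
  interpret finsler_coords "Wc c" "lc c" by (rule coords_locale[OF cA])
  have VA: "(p, V p) \<in> A" and VF: "V \<in> vector_fields \<A> \<Omega>" using V \<Omega> by (auto simp: admissible_def)
  have z: "(coords c p, comp (V p) c) \<in> Wc c"
    using Wc_iff[OF c A_tangent[OF VA]] VA by simp
  \<comment> \<open>A property that holds eventually in \<open>nhds 0\<close> holds at 0
    itself.\<close>
  have V0: "velocity \<A> \<gamma> 0 = V p"
    using eventually_nhds_x_imp_x[OF ext] geod by simp
  have "\<gamma> \<midarrow>0\<rightarrow> p"
    using geod I unfolding geodesic_def smooth_curve_def
    by (auto simp: continuous_on_eq_continuous_at isCont_def)
  then have near: "\<forall>\<^sub>F t in nhds 0. \<gamma> t \<in> S" if "open S" "p \<in> S" for S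
  proof -
    have "\<forall>\<^sub>F t in nhds 0. t \<noteq> 0 \<longrightarrow> \<gamma> t \<in> S"
      using topological_tendstoD[OF \<open>\<gamma> \<midarrow>0\<rightarrow> p\<close> that] by (simp add: eventually_at_filter)
    then show ?thesis
    proof eventually_elim
      case (elim t)
      then show ?case using geod(2) that(2) by (cases "t = 0") auto
    qed
  qed
  have "smooth_on {t \<in> I. \<gamma> t \<in> dom_of c} (coords c \<circ> \<gamma>)"
    using geod(1) cA by (auto simp: geodesic_def smooth_curve_def)
  then have "(coords c \<circ> \<gamma>) differentiable (at 0)"
    by (rule smooth_on_differentiable) (use I geod pc in auto)
  then have "((coords c \<circ> \<gamma>) has_vector_derivative vector_derivative (coords c \<circ> \<gamma>) (at 0)) (at 0)"
    by (simp add: vector_derivative_works)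
  moreover have "vector_derivative (coords c \<circ> \<gamma>) (at 0) = comp (V p) c"
    using V0[symmetric] c geod(2) by (simp add: velocity_def Tvec_inverse)
  ultimately have d: "((\<lambda>t. coords c (\<gamma> t)) has_derivative (\<lambda>t. t *\<^sub>R comp (V p) c)) (at 0)"
    by (simp add: has_vector_derivative_def o_def)
  let ?dV = "frechet_derivative (rep c V) (at (coords c p))"
  have dV: "(rep c V has_derivative ?dV) (at (coords c (\<gamma> 0)))"
    using rep_has_derivative[OF \<Omega>(1) VF \<Omega>(2) c] geod(2) by simp
  have "((\<lambda>t. rep c V (coords c (\<gamma> t))) has_derivative (\<lambda>t. ?dV (t *\<^sub>R comp (V p) c))) (at 0)"
    by (rule has_derivative_compose[OF d dV])
  moreover have "?dV (t *\<^sub>R comp (V p) c) = t *\<^sub>R ?dV (comp (V p) c)" for t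
    using linear_scale[OF has_derivative_linear[OF dV]] by simp
  ultimately have "((\<lambda>t. rep c V (coords c (\<gamma> t)) $ k) has_derivative (\<lambda>t. ?dV (comp (V p) c) $ k * t)) (at 0)" for k
    using bounded_linear.has_derivative[OF bounded_linear_vec_nth[of k]] by (fastforce simp: mult.commute)
  then have "((\<lambda>t. rep c V (coords c (\<gamma> t)) $ k) has_real_derivative ?dV (comp (V p) c) $ k) (at 0)" for k
    by (simp add: has_field_derivative_def)
  note dk = DERIV_imp_deriv[OF this]
  \<comment> \<open>Near 0 the curve stays in the chart and \<open>V\<close> extends its velocity;
    equality of germs suffices for \<open>deriv\<close>.\<close>
  have "\<forall>\<^sub>F t in nhds 0. comp (velocity \<A> \<gamma> t) c $ k = rep c V (coords c (\<gamma> t)) $ k" for k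
    using ext near[OF open_dom[OF cA] pc]
    by eventually_elim (simp add: rep_coords charts_at_iff cA)
  from deriv_cong_ev[OF this refl] have dvel: "deriv (\<lambda>s. comp (velocity \<A> \<gamma> s) c $ k) 0 = ?dV (comp (V p) c) $ k" for k
    using dk by simp
  have "cov_deriv_curve \<A> A L c \<gamma> (velocity \<A> \<gamma>) 0 = 0"
    using geod I c by (auto simp: geodesic_def)
  then have "?dV (comp (V p) c) $ k + (\<Sum>i\<in>UNIV. \<Sum>j\<in>UNIV. comp (V p) c $ i * comp (V p) c $ j *
      christoffel \<A> A L c p (V p) k i j) = 0" for k
    unfolding cov_deriv_curve_def vec_eq_iff using dvel V0 geod(2) by simp
  moreover have "(\<Sum>i\<in>UNIV. \<Sum>j\<in>UNIV. comp (V p) c $ i * comp (V p) c $ j * christoffel \<A> A L c p (V p) k i j)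
     = Gm (coords c p, comp (V p) c) (comp (V p) c) (comp (V p) c) $ k" for k
  proof -
    let ?z = "(coords c p, comp (V p) c)"
    have "(\<Sum>i\<in>UNIV. \<Sum>j\<in>UNIV. comp (V p) c $ i * comp (V p) c $ j * christoffel \<A> A L c p (V p) k i j)
      = (\<Sum>i\<in>UNIV. comp (V p) c $ i * (\<Sum>j\<in>UNIV. comp (V p) c $ j * Gm ?z (axis i 1) (axis j 1) $ k))"
      by (simp add: christoffel_eq[OF c VA] sum_distrib_left mult.assoc)
    then show ?thesis
      by (simp only: linear_sum_nth[OF linear_Gm2[OF z]] linear_sum_nth[OF linear_Gm1[OF z]])
  qed
  ultimately show ?thesis
    by (simp add: vec_eq_iff cov_def rep_coords[OF c])
qed

end

theorem corollary3p5:
  fixes \<A> :: "('m::{t2_space, second_countable_topology}, 'n::finite) chart set"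
    and A :: "('m \<times> ('m, 'n) tvec) set"
    and L :: "'m \<times> ('m, 'n) tvec \<Rightarrow> real"
    and p :: 'm and v u :: "('m, 'n) tvec"
    and I :: "real set" and \<gamma> :: "real \<Rightarrow> 'm"
    and \<Omega> :: "'m set" and V U U' :: "'m \<Rightarrow> ('m, 'n) tvec"
    and nabla :: "('m, 'n) field_op"
    and c :: "('m, 'n) chart"
  assumes finsler: "pseudo_finsler \<A> A L"
    and v: "(p, v) \<in> A"
    and u: "u \<in> tangent_space \<A> p"
    and plane: "dim (span {v, u}) = 2"
    and nondeg: "\<forall>w\<in>span {v, u}. (\<forall>z\<in>span {v, u}. fund_tensor L p v w z = 0) \<longrightarrow> w = 0"
    and interval: "open I" "is_interval I" "0 \<in> I"
    and geod: "geodesic \<A> A L I \<gamma>" "\<gamma> 0 = p" "velocity \<A> \<gamma> 0 = v"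
    and Omega: "open \<Omega>" "p \<in> \<Omega>"
    and V: "admissible \<A> A \<Omega> V" "\<forall>\<^sub>F t in nhds 0. V (\<gamma> t) = velocity \<A> \<gamma> t"
    and U: "U \<in> vector_fields \<A> \<Omega>" "U p = u"
    and U': "U' \<in> vector_fields \<A> \<Omega>" "U' p = u"
    and nabla: "chern_connection \<A> L \<Omega> V nabla"
    and c: "c \<in> charts_at \<A> p"
  shows "fund_tensor L p v (curvature \<A> \<Omega> nabla V U U' p) v /
           (L (p, v) * fund_tensor L p v u u - (fund_tensor L p v v u)\<^sup>2)
         = flag_curvature \<A> A L c p v u"
proof -
  interpret finsler \<A> A L
    using finsler by unfold_locales (auto simp: pseudo_finsler_def)
  have cA: "c \<in> \<A>" and pc: "p \<in> dom_of c" using c by (auto simp: charts_at_iff)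
  interpret fc: finsler_coords "Wc c" "lc c" by (rule coords_locale[OF cA])
  have VF: "V \<in> vector_fields \<A> \<Omega>" using V by (simp add: admissible_def)
  have Vp: "V p = v"
    using eventually_nhds_x_imp_x[OF V(2)] geod by simp
  let ?\<xi> = "coords c p"
  let ?z = "(?\<xi>, comp v c)"
  let ?T = "coords c ` (dom_of c \<inter> \<Omega>)"
  have T: "open ?T" "?\<xi> \<in> ?T"
    using Omega pc cA by (auto intro: open_coords_image')
  have r: "rep c V ?\<xi> = comp v c" "rep c U ?\<xi> = comp u c" "rep c U' ?\<xi> = comp u c"
    using Vp U U' by (simp_all add: rep_coords[OF c])
  have vT: "v \<in> tangent_space \<A> p" by (rule A_tangent[OF v])
  have lb: "lie_bracket \<A> \<Omega> V U \<in> vector_fields \<A> \<Omega>"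
    by (rule lie_bracket_vector_field[OF Omega(1) nabla VF U(1)])
  have D: "nabla X Y \<in> vector_fields \<A> \<Omega>" if "X \<in> vector_fields \<A> \<Omega>" "Y \<in> vector_fields \<A> \<Omega>" for X Y
    using nabla that by (simp add: chern_connection_def affine_connection_def)
  \<comment> \<open>The passage from \<open>fund_tensor\<close> to \<open>g\<close> is valid for
    tangent vectors, so both curvature vectors are placed in the tangent space beforehand.\<close>
  have RT: "curvature \<A> \<Omega> nabla V U U' p \<in> tangent_space \<A> p"
    unfolding curvature_def
    by (intro tangent_space_diff vector_fields_tangent[OF _ Omega(2)] D lb VF U U')
  have HT: "hh_curvature \<A> A L c p v u v v \<in> tangent_space \<A> p"
    unfolding hh_curvature_def by (rule tvec_of_in_tangent_space[OF c])
  have geo: "fc.cov (rep c V) (rep c V) ?\<xi> (rep c V ?\<xi>) = 0"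
    unfolding r(1) Vp[symmetric]
    by (rule geodesic_cov[OF Omega V(1) c interval(1,3) geod(1,2) V(2)])
  \<comment> \<open>The denominators agree literally; only the numerators are compared, in the chart
    \<open>c\<close>.\<close>
  have "fund_tensor L p v (curvature \<A> \<Omega> nabla V U U' p) v
      = fc.g ?z (fc.Rm (rep c V) (rep c V) (rep c U) (rep c U') ?\<xi>) (comp v c)"
    unfolding fund_tensor_eq[OF c v RT vT]
      comp_curvature[OF Omega(1) V(1) nabla Omega(2) c VF U(1) U'(1)] ..
  also have "\<dots> = fc.g ?z (fc.hh ?z (comp u c) (comp v c) (comp v c)) (comp u c)"
    using fc.curvature_eq_flag[OF T admissible_coords[OF V(1) cA] vector_fields_smooth[OF VF cA]
        vector_fields_smooth[OF U(1) cA] vector_fields_smooth[OF U'(1) cA] geo]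
    by (simp add: r)
  also have "\<dots> = fund_tensor L p v (hh_curvature \<A> A L c p v u v v) u"
    unfolding fund_tensor_eq[OF c v HT u] hh_curvature_eq[OF c v] ..
  finally show ?thesis
    by (simp add: flag_curvature_def)
qed

end
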